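(* Let $N\ge 1$ and let $\Omega\subset\mathbb{R}^N$ be a bounded open set with $C^1$ boundary. Let $\mu^+$ be a nonnegative finite Borel measure on $[0,1]$ such that $\mu^+([\overline s,1])>0$ for some $\overline s\in(0,1]$. Let $(\varepsilon_n)$ be a decreasing sequence with $\varepsilon_n\to 0$. For each $n$, let $\mu_n^-$ be a finite Borel measure on $[0,1]$ with $$\mathrm{supp}(\mu_n^-)\subset[0,\varepsilon_n]\qquad\text{and}\qquad \mu_n^-([0,\varepsilon_n])=1.$$ Let $\lambda_0$ be the first eigenvalue of $$\int_{[0,1]}(-\Delta)^s u\,d\mu^+(s)=\lambda u\ \text{ in }\Omega,\qquad u=0\ \text{ in }\mathbb{R}^N\setminus\Omega,$$ namely $$\lambda_0=\min_{u\in X^+(\Omega)\setminus\{0\}}\frac{\int_{[0,1]}[u]_s^2\,d\mu^+(s)}{\int_\Omega |u|^2}.$$ For each $n$, let $$\lambda_{\varepsilon_n}=\min_{u\in X^+(\Omega)\setminus\{0\}}\frac{\int_{[0,1]}[u]_s^2\,d\mu^+(s)}{\int_{[0,\varepsilon_n]}[u]_s^2\,d\mu_n^-(s)}$$ be the first eigenvalue of $$\int_{[0,1]}(-\Delta)^s u\,d\mu^+(s)=\lambda\int_{[0,\varepsilon_n]}(-\Delta)^s u\,d\mu_n^-(s)\ \text{ in }\Omega,\qquad u=0\ \text{ in }\mathbb{R}^N\setminus\Omega.$$ Let $u_{\varepsilon_n}\in X^+(\Omega)$ be a corresponding eigenfunction normalized so that $$\int_{[0,\varepsilon_n]}[u_{\varepsilon_n}]_s^2\,d\mu_n^-(s)=1,\qquad\text{so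 that}\qquad \lambda_{\varepsilon_n}=\int_{[0,1]}[u_{\varepsilon_n}]_s^2\,d\mu^+(s).$$ Then $\lim_{n\to\infty}\lambda_{\varepsilon_n}=\lambda_0$. Moreover, there exists an eigenfunction $u_0$ corresponding to $\lambda_0$ such that, up to a subsequence, $u_{\varepsilon_n}\rightharpoonup u_0$ weakly in $X^+(\Omega)$ and $u_{\varepsilon_n}\to u_0$ strongly in $L^2(\Omega)$.
   Context: For $s\in(0,1)$, $$(-\Delta)^s u(x)=c_{N,s}\int_{\mathbb{R}^N}\frac{2u(x)-u(x+y)-u(x-y)}{|y|^{N+2s}}\,dy,\qquad c_{N,s}=\frac{2^{2s-1}\Gamma(\frac{N+2s}{2})}{\pi^{N/2}\Gamma(2-s)}s(1-s),$$ with $(-\Delta)^0u=u$ and $(-\Delta)^1u=-\Delta u$. The seminorms are $[u]_0=\|u\|_{L^2(\mathbb{R}^N)}$, $[u]_1=\|\nabla u\|_{L^2(\mathbb{R}^N)}$, and $$[u]_s^2=c_{N,s}\iint_{\mathbb{R}^{2N}}\frac{|u(x)-u(y)|^2}{|x-y|^{N+2s}}\,dx\,dy\quad\text{for } s\in(0,1).$$ The corresponding bilinear forms $\langle u,v\rangle_s$ are defined analogously (for $s=0$: $\int uv$; for $s=1$: $\int\nabla u\cdot\nabla v$). $X^+(\Omega)$ is the completion of $C^\infty_c(\Omega)$ under the norm $\|u\|_{X^+}^2=\int_{[0,1]}[u]_s^2\,d\mu^+(s)$, a Hilbert space of functions vanishing outside $\Omega$. Eigenvalue problems are understood weakly, by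 testing against $v\in C_c^\infty(\Omega)$ with the forms $\langle\cdot,\cdot\rangle_s$. For instance, $u_0$ being an eigenfunction for $\lambda_0$ means $u_0\in X^+(\Omega)\setminus\{0\}$ and $$\int_{[0,1]}\langle u_0,v\rangle_s\,d\mu^+(s)=\lambda_0\int_\Omega u_0v\quad\text{for all } v\in C^\infty_c(\Omega).$$ *)

theory Defs
  imports "HOL-Analysis.Analysis"
begin

coinductive smooth_fun :: "('a::euclidean_space \<Rightarrow> real) \<Rightarrow> bool" where
  "(\<forall>x. f differentiable (at x)) \<Longrightarrow>
   (\<forall>b\<in>Basis. smooth_fun (\<lambda>x. frechet_derivative f (at x) b)) \<Longrightarrow> smooth_fun f"

definition Cc_inf :: "'a::euclidean_space set \<Rightarrow> ('a \<Rightarrow> real) set" where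
  "Cc_inf \<Omega> = {\<phi>. smooth_fun \<phi> \<and> compact (closure {x. \<phi> x \<noteq> 0})
                     \<and> closure {x. \<phi> x \<noteq> 0} \<subseteq> \<Omega>}"

text \<open>Near every boundary point, after choosing a unit normal direction nu, the set is
  the subgraph of a C^1 function g defined on the hyperplane orthogonal to nu
  (g is given on the whole space; only its values on the hyperplane matter).\<close>
definition C1_boundary :: "'a::euclidean_space set \<Rightarrow> bool" where
  "C1_boundary \<Omega> \<longleftrightarrow> (\<forall>x\<in>frontier \<Omega>. \<exists>r>0. \<exists>\<nu>. norm \<nu> = 1 \<and>
     (\<exists>g :: 'a \<Rightarrow> real. \<exists>G :: 'a \<Rightarrow> 'a.
        (\<forall>y. (g has_derivative (\<lambda>h. G y \<bullet> h)) (at y)) \<and> continuous_on UNIV G \<and>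
        \<Omega> \<inter> ball x r =
          {y \<in> ball x r. (y - x) \<bullet> \<nu> < g ((y - x) - ((y - x) \<bullet> \<nu>) *\<^sub>R \<nu>)}))"

definition c_const :: "nat \<Rightarrow> real \<Rightarrow> real" where
  "c_const N s = 2 powr (2 * s - 1) * Gamma ((real N + 2 * s) / 2)
                 / (pi powr (real N / 2) * Gamma (2 - s)) * s * (1 - s)"

definition has_weak_grad :: "('a::euclidean_space \<Rightarrow> real) \<Rightarrow> ('a \<Rightarrow> 'a) \<Rightarrow> bool" where
  "has_weak_grad u G \<longleftrightarrow>
     (\<forall>K. compact K \<longrightarrow> set_integrable lborel K u \<and>
                         (\<forall>i\<in>Basis. set_integrable lborel K (\<lambda>x. G x \<bullet> i))) \<and>
     (\<forall>\<phi>\<in>Cc_inf (UNIV :: 'a set). \<forall>i\<in>Basis.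
        (\<integral>x. u x * frechet_derivative \<phi> (at x) i \<partial>lborel) = - (\<integral>x. (G x \<bullet> i) * \<phi> x \<partial>lborel))"

definition weak_grad :: "('a::euclidean_space \<Rightarrow> real) \<Rightarrow> ('a \<Rightarrow> 'a)" where
  "weak_grad u = (SOME G. has_weak_grad u G)"

definition seminorm_sq :: "real \<Rightarrow> ('a::euclidean_space \<Rightarrow> real) \<Rightarrow> ennreal" where
  "seminorm_sq s u =
    (if s = 0 then (\<integral>\<^sup>+ x. ennreal ((u x)\<^sup>2) \<partial>lborel)
     else if s = 1 then
       (if (\<exists>G. has_weak_grad u G)
        then (\<integral>\<^sup>+ x. ennreal ((norm (weak_grad u x))\<^sup>2) \<partial>lborel) else \<infinity>)
     else ennreal (c_const DIM('a) s) *
       (\<integral>\<^sup>+ p. ennreal ((u (fst p) - u (snd p))\<^sup>2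
                 / norm (fst p - snd p) powr (real DIM('a) + 2 * s)) \<partial>(lborel \<Otimes>\<^sub>M lborel)))"

definition form :: "real \<Rightarrow> ('a::euclidean_space \<Rightarrow> real) \<Rightarrow> ('a \<Rightarrow> real) \<Rightarrow> real" where
  "form s u v =
    (if s = 0 then (\<integral>x. u x * v x \<partial>lborel)
     else if s = 1 then (\<integral>x. weak_grad u x \<bullet> weak_grad v x \<partial>lborel)
     else c_const DIM('a) s *
       (\<integral> p. (u (fst p) - u (snd p)) * (v (fst p) - v (snd p))
              / norm (fst p - snd p) powr (real DIM('a) + 2 * s) \<partial>(lborel \<Otimes>\<^sub>M lborel)))"

definition Xnorm_sq :: "real measure \<Rightarrow> ('a::euclidean_space \<Rightarrow> real) \<Rightarrow> ennreal" where
  "Xnorm_sq \<mu> u = (\<integral>\<^sup>+ s. seminorm_sq s u \<partial>\<mu>)"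

definition Xinner :: "real measure \<Rightarrow> ('a::euclidean_space \<Rightarrow> real) \<Rightarrow> ('a \<Rightarrow> real) \<Rightarrow> real" where
  "Xinner \<mu> u v = (\<integral> s. form s u v \<partial>\<mu>)"

text \<open>X^+(Omega): the closure of C_c^infty(Omega) w.r.t. the X^+ norm, realised as
  square integrable functions vanishing (a.e.) outside Omega.\<close>
definition Xplus :: "real measure \<Rightarrow> 'a::euclidean_space set \<Rightarrow> ('a \<Rightarrow> real) set" where
  "Xplus \<mu> \<Omega> = {u. u \<in> borel_measurable lborel \<and> integrable lborel (\<lambda>x. (u x)\<^sup>2) \<and>
                    (AE x in lborel. x \<notin> \<Omega> \<longrightarrow> u x = 0) \<and>
                    (\<exists>\<phi>. (\<forall>k. \<phi> k \<in> Cc_inf \<Omega>) \<and>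
                         ((\<lambda>k. Xnorm_sq \<mu> (\<lambda>x. u x - \<phi> k x)) \<longlongrightarrow> 0) sequentially)}"

definition nonzero_fun :: "('a::euclidean_space \<Rightarrow> real) \<Rightarrow> bool" where
  "nonzero_fun u \<longleftrightarrow> \<not> (AE x in lborel. u x = 0)"

definition lambda0 :: "real measure \<Rightarrow> 'a::euclidean_space set \<Rightarrow> real" where
  "lambda0 \<mu> \<Omega> = Inf {enn2real (Xnorm_sq \<mu> u) / enn2real (\<integral>\<^sup>+ x\<in>\<Omega>. ennreal ((u x)\<^sup>2) \<partial>lborel)
                        | u. u \<in> Xplus \<mu> \<Omega> \<and> nonzero_fun u}"

definition lambda_eps :: "real measure \<Rightarrow> real measure \<Rightarrow> real \<Rightarrow> 'a::euclidean_space set \<Rightarrow> real" where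
  "lambda_eps \<mu>p \<mu>m \<epsilon> \<Omega> =
     Inf {enn2real (Xnorm_sq \<mu>p u) / enn2real (\<integral>\<^sup>+ s\<in>{0..\<epsilon>}. seminorm_sq s u \<partial>\<mu>m)
          | u. u \<in> Xplus \<mu>p \<Omega> \<and> nonzero_fun u}"

definition is_eigenfunction0 :: "real measure \<Rightarrow> 'a::euclidean_space set \<Rightarrow> real \<Rightarrow> ('a \<Rightarrow> real) \<Rightarrow> bool" where
  "is_eigenfunction0 \<mu> \<Omega> lam u \<longleftrightarrow> u \<in> Xplus \<mu> \<Omega> \<and> nonzero_fun u \<and>
     (\<forall>v\<in>Cc_inf \<Omega>. Xinner \<mu> u v = lam * (LINT x:\<Omega>|lborel. u x * v x))"

definition is_eigenfunction_eps ::
  "real measure \<Rightarrow> real measure \<Rightarrow> real \<Rightarrow> 'a::euclidean_space set \<Rightarrow> real \<Rightarrow> ('a \<Rightarrow> real) \<Rightarrow> bool" where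
  "is_eigenfunction_eps \<mu>p \<mu>m \<epsilon> \<Omega> lam u \<longleftrightarrow> u \<in> Xplus \<mu>p \<Omega> \<and> nonzero_fun u \<and>
     (\<forall>v\<in>Cc_inf \<Omega>. Xinner \<mu>p u v = lam * (\<integral>s. indicator {0..\<epsilon>} s * form s u v \<partial>\<mu>m))"

definition Xweak_conv :: "real measure \<Rightarrow> 'a::euclidean_space set \<Rightarrow> (nat \<Rightarrow> 'a \<Rightarrow> real) \<Rightarrow> ('a \<Rightarrow> real) \<Rightarrow> bool" where
  "Xweak_conv \<mu> \<Omega> u u0 \<longleftrightarrow>
     (\<forall>v\<in>Xplus \<mu> \<Omega>. ((\<lambda>k. Xinner \<mu> (u k) v) \<longlongrightarrow> Xinner \<mu> u0 v) sequentially)"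

end

theory Submission
  imports Defs "HOL-Complex_Analysis.Great_Picard"
begin

text \<open>
  The key is a real-space two-sided estimate. For \<open>u\<close> supported in \<open>\<Omega>\<close> and \<open>R\<close> exceeding the diameter,
  the part of the Gagliardo integral with \<open>norm (x - y) \<ge> R\<close> is an explicit multiple \<open>lo s\<close> of the squared
  \<open>L\<^sup>2\<close> norm with \<open>lo s \<rightarrow> 1\<close> as \<open>s \<rightarrow> 0\<close>, and the remaining part is at most \<open>o(1)\<close> times the seminorm of a
  fixed order \<open>s0 > 0\<close>. That seminorm is bounded by the energy, because \<open>\<mu>p\<close> charges a compact subset of
  \<open>(0,1)\<close> or the point \<open>1\<close>. Hence the denominators of the two Rayleigh quotients agree up to \<open>o(1)\<close> times
  the energy, uniformly in \<open>u\<close>, which gives the convergence of the eigenvalues. Testing the equation of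
  \<open>u n\<close> with \<open>u n\<close> itself shows that its energy is the eigenvalue and that its \<open>L\<^sup>2\<close> norm tends to \<open>1\<close>, so
  \<open>u n\<close> is a minimising sequence for \<open>lambda0\<close>. Such a sequence has a subsequence converging in \<open>L\<^sup>2\<close> by a
  Rellich argument, and then strongly in the energy norm by the parallelogram law; the limit is a
  minimiser, so the first variation vanishes.
\<close>

section \<open>Square integrable functions\<close>

text \<open>Two features of the definitions shape the argument. The eigenvalue equation is tested
  only with functions in \<open>Cc_inf\<close>, so using \<open>u n\<close> as its own test function
  means approximating it in the energy and knowing that the small-order form is continuous for the
  energy; this continuity is the two-sided estimate combined with a Poincare inequality. Moreover,
  the orders 0 and 1 have formulas of their own, and a measure on the orders may have an atom at 1,
  so weak gradients need uniqueness, closedness and a translation estimate. The limit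
  \<open>lo s\<close> -> 1 is a matter of normalisation: the far part of the integral contributes a
  factor 1/s, which the factor s of \<open>c_const\<close> cancels, and \<open>gam_const N 0\<close>
  is the reciprocal of the area of the unit sphere. Every finite seminorm is the squared L2 norm of
  a linear image of the function; expanding it at \<open>u + t * v\<close> as a polynomial in
  \<open>t\<close> yields the bilinear form, Cauchy-Schwarz, the parallelogram law and the first
  variation. Weak convergence in the conclusion is read off from strong convergence in the
  energy.\<close>

definition sqint :: "'m measure \<Rightarrow> ('m \<Rightarrow> 'b::euclidean_space) \<Rightarrow> bool" where
  "sqint M f \<longleftrightarrow> f \<in> borel_measurable M \<and> integrable M (\<lambda>x. (norm (f x))\<^sup>2)"

lemma sqint_measurable [measurable_dest]: "sqint M f \<Longrightarrow> f \<in> borel_measurable M"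
  and sqint_integrable: "sqint M f \<Longrightarrow> integrable M (\<lambda>x. (norm (f x))\<^sup>2)"
  by (auto simp: sqint_def)

lemma sqint_iff_nn:
  assumes "f \<in> borel_measurable M"
  shows "sqint M f \<longleftrightarrow> (\<integral>\<^sup>+x. ennreal ((norm (f x))\<^sup>2) \<partial>M) < \<infinity>"
proof -
  have m: "(\<lambda>x. (norm (f x))\<^sup>2) \<in> borel_measurable M" using assms by measurable
  show ?thesis unfolding sqint_def integrable_iff_bounded using assms m by simp
qed

lemma sqint_nn_eq: "sqint M f \<Longrightarrow> (\<integral>\<^sup>+x. ennreal ((norm (f x))\<^sup>2) \<partial>M) = ennreal (\<integral>x. (norm (f x))\<^sup>2 \<partial>M)"
  by (rule nn_integral_eq_integral) (auto simp: sqint_def)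

lemma inner_abs_le: "\<bar>a \<bullet> b\<bar> \<le> (norm a)\<^sup>2 + (norm (b::'b::real_inner))\<^sup>2"
proof -
  have "\<bar>a \<bullet> b\<bar> \<le> norm a * norm b" by (rule Cauchy_Schwarz_ineq2)
  also have "\<dots> \<le> (norm a)\<^sup>2 + (norm b)\<^sup>2"
    using sum_squares_bound[of "norm a" "norm b"] mult_nonneg_nonneg[OF norm_ge_zero[of a] norm_ge_zero[of b]]
    by linarith
  finally show ?thesis .
qed

lemma sqint_inner_integrable:
  assumes "sqint M f" "sqint M g" shows "integrable M (\<lambda>x. f x \<bullet> g x)"
proof (rule Bochner_Integration.integrable_bound)
  show "integrable M (\<lambda>x. (norm (f x))\<^sup>2 + (norm (g x))\<^sup>2)"
    using assms by (auto simp: sqint_def)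
  show "(\<lambda>x. f x \<bullet> g x) \<in> borel_measurable M" using assms by (auto simp: sqint_def)
  show "AE x in M. norm (f x \<bullet> g x) \<le> norm ((norm (f x))\<^sup>2 + (norm (g x))\<^sup>2)"
    using inner_abs_le by (auto intro!: AE_I2)
qed

lemma norm_sq_add_scaled: "(norm (a + t *\<^sub>R b))\<^sup>2 = (norm a)\<^sup>2 + 2*t*(a \<bullet> b) + t\<^sup>2 * (norm (b::'b::real_inner))\<^sup>2"
  unfolding power2_norm_eq_inner by (simp add: inner_simps inner_commute power2_eq_square algebra_simps)

text \<open>Vector values and an arbitrary measure space let one expansion in \<open>t\<close> serve
  functions, gradients and difference quotients on the product space alike.\<close>

lemma
  assumes "sqint M f" "sqint M g"
  shows sqint_add_scaled: "sqint M (\<lambda>x. f x + t *\<^sub>R g x)"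
    and integral_norm_sq_add_scaled: "(\<integral>x. (norm (f x + t *\<^sub>R g x))\<^sup>2 \<partial>M)
      = (\<integral>x. (norm (f x))\<^sup>2 \<partial>M) + 2*t*(\<integral>x. f x \<bullet> g x \<partial>M) + t\<^sup>2 * (\<integral>x. (norm (g x))\<^sup>2 \<partial>M)"
proof -
  note [simp] = sqint_inner_integrable[OF assms] sqint_integrable[OF assms(1)] sqint_integrable[OF assms(2)]
  have [measurable]: "f \<in> borel_measurable M" "g \<in> borel_measurable M" using assms by (auto simp: sqint_def)
  show "sqint M (\<lambda>x. f x + t *\<^sub>R g x)"
    unfolding sqint_def norm_sq_add_scaled by (auto intro!: Bochner_Integration.integrable_add integrable_mult_right)
  show "(\<integral>x. (norm (f x + t *\<^sub>R g x))\<^sup>2 \<partial>M)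
      = (\<integral>x. (norm (f x))\<^sup>2 \<partial>M) + 2*t*(\<integral>x. f x \<bullet> g x \<partial>M) + t\<^sup>2 * (\<integral>x. (norm (g x))\<^sup>2 \<partial>M)"
    unfolding norm_sq_add_scaled by (simp add: Bochner_Integration.integral_add)
qed

lemma nn_norm_sq_add_scaled:
  assumes "sqint M f" "sqint M g"
  shows "(\<integral>\<^sup>+x. ennreal ((norm (f x + t *\<^sub>R g x))\<^sup>2) \<partial>M)
    = ennreal (enn2real (\<integral>\<^sup>+x. ennreal ((norm (f x))\<^sup>2) \<partial>M) + 2*t*(\<integral>x. f x \<bullet> g x \<partial>M)
        + t\<^sup>2 * enn2real (\<integral>\<^sup>+x. ennreal ((norm (g x))\<^sup>2) \<partial>M))"
proof -
  have "0 \<le> (\<integral>x. (norm (f x))\<^sup>2 \<partial>M)" "0 \<le> (\<integral>x. (norm (g x))\<^sup>2 \<partial>M)" by (simp_all add: integral_nonneg_AE)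
  then show ?thesis
    unfolding sqint_nn_eq[OF sqint_add_scaled[OF assms]] sqint_nn_eq[OF assms(1)] sqint_nn_eq[OF assms(2)]
      integral_norm_sq_add_scaled[OF assms] by simp
qed

lemma sqint_diff: "sqint M f \<Longrightarrow> sqint M g \<Longrightarrow> sqint M (\<lambda>x. f x - g x)"
  using sqint_add_scaled[of M f g "-1"] by simp

text \<open>Riesz-Fischer. Besides the norm limit it delivers a subsequence converging almost
  everywhere, on which the later Fatou arguments for the seminorms rely.\<close>

lemma L2_complete:
  fixes f :: "nat \<Rightarrow> 'm \<Rightarrow> real"
  assumes sq: "\<And>n. sqint M (f n)"
    and cau: "\<And>e. e > 0 \<Longrightarrow> \<exists>N. \<forall>m\<ge>N. \<forall>n\<ge>N. (\<integral>\<^sup>+x. ennreal ((f m x - f n x)\<^sup>2) \<partial>M) \<le> ennreal e"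
  obtains g and r :: "nat \<Rightarrow> nat" where "sqint M g" "strict_mono r" "AE x in M. (\<lambda>k. f (r k) x) \<longlonglongrightarrow> g x"
    "(\<lambda>n. \<integral>\<^sup>+x. ennreal ((f n x - g x)\<^sup>2) \<partial>M) \<longlonglongrightarrow> 0"
proof -
  have [measurable]: "f n \<in> borel_measurable M" for n using sq by (auto simp: sqint_def)
  have "\<exists>N. \<forall>k. (\<forall>m\<ge>N k. \<forall>n\<ge>N k. (\<integral>\<^sup>+x. ennreal ((f m x - f n x)\<^sup>2) \<partial>M) \<le> ennreal ((1/8)^k))"
    by (rule choice) (use cau in auto)
  then obtain N where N: "\<And>k m n. m \<ge> N k \<Longrightarrow> n \<ge> N k \<Longrightarrow> (\<integral>\<^sup>+x. ennreal ((f m x - f n x)\<^sup>2) \<partial>M) \<le> ennreal ((1/8)^k)"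
    by blast
  \<comment> \<open>The sum makes \<open>r k\<close> dominate \<open>N k\<close>; the summand
    \<open>k\<close> makes \<open>r\<close> strictly increasing even where \<open>N\<close>
    vanishes.\<close>
  define r where "r = (\<lambda>k. k + (\<Sum>j\<le>k. N j))"
  have r: "strict_mono r" unfolding r_def by (rule strict_monoI_Suc) simp
  have rN: "r k \<ge> N k" for k
  proof -
    have "N k \<le> (\<Sum>j\<le>k. N j)" by (rule member_le_sum) auto
    then show ?thesis by (simp add: r_def)
  qed
  define d where "d k x = f (r (Suc k)) x - f (r k) x" for k x
  have [measurable]: "d k \<in> borel_measurable M" for k unfolding d_def by measurable
  have dk: "(\<integral>\<^sup>+x. ennreal ((d k x)\<^sup>2) \<partial>M) \<le> ennreal ((1/8)^k)" for k
    unfolding d_def by (rule N) (use rN[of k] strict_mono_less_eq[OF r, of k "Suc k"] in auto)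
  \<comment> \<open>The increments have squared norm at most 8^(-k), so the weights 2^k still leave
    a convergent series. Almost everywhere the weighted squares are therefore summable, and 2 |d| <=
    2^(-k) + 2^k d^2 makes the increments themselves absolutely summable.\<close>
  have "(\<integral>\<^sup>+x. (\<Sum>k. ennreal (2^k * (d k x)\<^sup>2)) \<partial>M) = (\<Sum>k. \<integral>\<^sup>+x. ennreal (2^k * (d k x)\<^sup>2) \<partial>M)"
    by (rule nn_integral_suminf) measurable
  also have "\<dots> = (\<Sum>k. ennreal (2^k) * (\<integral>\<^sup>+x. ennreal ((d k x)\<^sup>2) \<partial>M))"
    by (simp add: ennreal_mult nn_integral_cmult)
  also have "\<dots> \<le> (\<Sum>k. ennreal (2^k) * ennreal ((1/8)^k))"
    by (intro suminf_le mult_left_mono dk) auto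
  also have "\<dots> = (\<Sum>k. ennreal ((1/4)^k))"
    by (simp add: ennreal_mult[symmetric] power_mult_distrib[symmetric])
  also have "\<dots> = ennreal (\<Sum>k. (1/4)^k)"
    by (rule suminf_ennreal2) (auto intro!: summable_geometric)
  also have "\<dots> < \<infinity>" by simp
  finally have fin: "(\<integral>\<^sup>+x. (\<Sum>k. ennreal (2^k * (d k x)\<^sup>2)) \<partial>M) \<noteq> \<infinity>" by simp
  have "AE x in M. (\<Sum>k. ennreal (2^k * (d k x)\<^sup>2)) \<noteq> \<infinity>"
    by (rule nn_integral_PInf_AE[OF _ fin]) measurable
  then have conv: "AE x in M. convergent (\<lambda>k. f (r k) x)"
  proof eventually_elim
    case (elim x)
    have s1: "summable (\<lambda>k. 2^k * (d k x)\<^sup>2)"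
      by (rule summable_suminf_not_top) (use elim in auto)
    have s2: "summable (\<lambda>k. (1/2)^k + 2^k * (d k x)\<^sup>2)"
      by (intro summable_add s1 summable_geometric) auto
    have "summable (\<lambda>k. d k x)"
    proof (rule summable_comparison_test'[OF s2])
      fix k
      have e: "(1/2::real)^k * 2^k = 1" by (simp add: power_mult_distrib[symmetric])
      have "0 \<le> (1/2)^k * (1 - 2^k * \<bar>d k x\<bar>)\<^sup>2" by simp
      also have "\<dots> = (1/2)^k - 2 * ((1/2::real)^k * 2^k) * \<bar>d k x\<bar> + ((1/2)^k*2^k) * 2^k * (d k x)\<^sup>2"
        by (simp add: power2_eq_square algebra_simps)
      finally have "2 * \<bar>d k x\<bar> \<le> (1/2)^k + 2^k * (d k x)\<^sup>2" unfolding e by simp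
      then show "norm (d k x) \<le> (1/2)^k + 2^k * (d k x)\<^sup>2" by simp
    qed
    then have "convergent (\<lambda>n. \<Sum>k<n. d k x)" by (simp add: summable_iff_convergent)
    moreover have "(\<Sum>k<n. d k x) = f (r n) x - f (r 0) x" for n
      unfolding d_def by (rule sum_lessThan_telescope)
    ultimately have "convergent (\<lambda>n. (f (r n) x - f (r 0) x) + f (r 0) x)"
      by (intro convergent_add convergent_const) simp
    then show ?case by simp
  qed
  define g where "g x = lim (\<lambda>k. f (r k) x)" for x
  have [measurable]: "g \<in> borel_measurable M" unfolding g_def by measurable
  have lim: "AE x in M. (\<lambda>k. f (r k) x) \<longlonglongrightarrow> g x"
    using conv by eventually_elim (simp add: g_def convergent_LIMSEQ_iff)
  \<comment> \<open>Fatou along the subsequence, with \<open>n\<close> fixed, turns the Cauchy bound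
    into a bound on the distance to the limit.\<close>
  have fat: "(\<integral>\<^sup>+x. ennreal ((f n x - g x)\<^sup>2) \<partial>M) \<le> ennreal ((1/8)^k)" if "n \<ge> N k" for n k
  proof -
    have "(\<integral>\<^sup>+x. ennreal ((f n x - g x)\<^sup>2) \<partial>M) = (\<integral>\<^sup>+x. liminf (\<lambda>j. ennreal ((f n x - f (r j) x)\<^sup>2)) \<partial>M)"
    proof (rule nn_integral_cong_AE, use lim in eventually_elim)
      case (elim x)
      have "(\<lambda>j. ennreal ((f n x - f (r j) x)\<^sup>2)) \<longlonglongrightarrow> ennreal ((f n x - g x)\<^sup>2)"
        by (intro tendsto_ennrealI tendsto_intros elim)
      then show ?case by (metis lim_imp_Liminf trivial_limit_sequentially)
    qed
    also have "\<dots> \<le> liminf (\<lambda>j. \<integral>\<^sup>+x. ennreal ((f n x - f (r j) x)\<^sup>2) \<partial>M)"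
      by (rule nn_integral_liminf) measurable
    also have "\<dots> \<le> liminf (\<lambda>j. ennreal ((1/8)^k))"
    proof (rule Liminf_mono)
      show "\<forall>\<^sub>F j in sequentially. (\<integral>\<^sup>+x. ennreal ((f n x - f (r j) x)\<^sup>2) \<partial>M) \<le> ennreal ((1/8)^k)"
        using eventually_ge_at_top[of "N k"]
      proof eventually_elim
        case (elim j)
        then show ?case using seq_suble[OF r, of j] by (intro N that) auto
      qed
    qed
    also have "\<dots> = ennreal ((1/8)^k)" by (simp add: Liminf_const)
    finally show ?thesis .
  qed
  have conv0: "(\<lambda>n. \<integral>\<^sup>+x. ennreal ((f n x - g x)\<^sup>2) \<partial>M) \<longlonglongrightarrow> 0"
  proof (rule order_tendstoI)
    fix a :: ennreal assume "0 < a"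
    have t0: "(\<lambda>k. ennreal ((1/8)^k)) \<longlonglongrightarrow> ennreal 0"
      by (intro tendsto_ennrealI LIMSEQ_realpow_zero) auto
    then have "\<forall>\<^sub>F k in sequentially. ennreal ((1/8)^k) < a"
      using \<open>0 < a\<close> by (intro order_tendstoD) (auto simp: ennreal_0)
    then obtain k where k: "ennreal ((1/8)^k) < a" using eventually_happens'[OF sequentially_bot] by blast
    show "\<forall>\<^sub>F n in sequentially. (\<integral>\<^sup>+x. ennreal ((f n x - g x)\<^sup>2) \<partial>M) < a"
      using eventually_ge_at_top[of "N k"] by eventually_elim (use fat k in \<open>auto intro: le_less_trans\<close>)
  qed simp
  have "sqint M (\<lambda>x. f (N 0) x - g x)"
    using fat[of 0 "N 0"] by (subst sqint_iff_nn) (auto intro: le_less_trans)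
  from sqint_diff[OF sq[of "N 0"] this] have "sqint M g" by simp
  then show thesis by (rule that[OF _ r lim conv0])
qed

section \<open>Bump functions and the fundamental lemma of the calculus of variations\<close>

text \<open>The functions t^(-k) exp(-1/t), extended by zero, are closed under differentiation up to
  linear combinations. The index \<open>k\<close> is there for that closure; the bumps themselves
  are built from index 0.\<close>

definition bump_profile :: "nat \<Rightarrow> real \<Rightarrow> real" where
  "bump_profile k t = (if t > 0 then exp (- inverse t) * inverse t ^ k else 0)"

lemma bump_profile_tendsto_0: "(bump_profile k \<longlongrightarrow> 0) (at 0)"
proof (rule filterlim_split_at)
  have "((\<lambda>x. inverse x ^ k / exp (inverse x)) \<longlongrightarrow> (0::real)) (at_right 0)"
    by (rule filterlim_compose[OF tendsto_power_div_exp_0 filterlim_inverse_at_top_right])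
  then show "(bump_profile k \<longlongrightarrow> 0) (at_right 0)"
    by (rule Lim_transform_eventually)
      (auto simp: bump_profile_def eventually_at_filter exp_minus field_simps)
  show "(bump_profile k \<longlongrightarrow> 0) (at_left 0)"
    by (rule tendsto_eventually) (auto simp: bump_profile_def eventually_at_filter)
qed

lemma bump_profile_DERIV:
  "(bump_profile k has_real_derivative (bump_profile (k+2) t - real k * bump_profile (k+1) t)) (at t)"
proof -
  consider "t > 0" | "t < 0" | "t = 0" by linarith
  then show ?thesis
  proof cases
    case 1
    have "((\<lambda>t. exp (- inverse t) * inverse t ^ k) has_real_derivative
       (bump_profile (k+2) t - real k * bump_profile (k+1) t)) (at t)"
    proof -
      have i: "(inverse has_real_derivative - (inverse t)\<^sup>2) (at t)"
        using DERIV_inverse[of t] 1 by (simp add: numeral_2_eq_2)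
      have e: "((\<lambda>t. exp (- inverse t)) has_real_derivative exp (- inverse t) * (inverse t)\<^sup>2) (at t)"
        using DERIV_fun_exp[OF DERIV_minus[OF i]] by simp
      have p: "((\<lambda>t. inverse t ^ k) has_real_derivative - real k * inverse t ^ (k+1)) (at t)"
        using DERIV_power[OF i, of k] by (cases k) (simp_all add: power2_eq_square algebra_simps)
      show ?thesis
        using DERIV_mult[OF e p] 1 by (simp add: bump_profile_def power2_eq_square mult.assoc mult.left_commute mult.commute)
    qed
    then show ?thesis
      by (rule has_field_derivative_transform_within_open[where S="{0<..}"])
        (use 1 in \<open>auto simp: bump_profile_def\<close>)
  next
    case 2
    have "((\<lambda>t. 0) has_real_derivative (bump_profile (k+2) t - real k * bump_profile (k+1) t)) (at t)"
      using 2 by (simp add: bump_profile_def)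
    then show ?thesis
      by (rule has_field_derivative_transform_within_open[where S="{..<0}"])
        (use 2 in \<open>auto simp: bump_profile_def\<close>)
  next
    case 3
    \<comment> \<open>At 0 the difference quotient of index \<open>k\<close> is the profile of index
      \<open>k + 1\<close>, so the limit already proved is the derivative.\<close>
    have "((\<lambda>h. (bump_profile k (0 + h) - bump_profile k 0) / h) \<longlongrightarrow> 0) (at 0)"
      by (rule Lim_transform_eventually[OF bump_profile_tendsto_0[of "Suc k"]])
        (auto simp: bump_profile_def eventually_at_filter field_simps)
    then show ?thesis using 3 by (simp add: DERIV_def bump_profile_def)
  qed
qed

text \<open>An inductive class of functions closed under partial derivatives; by coinduction each member
  is a \<open>smooth_fun\<close>, which yields products, sums, translates and bump functions in one stroke.\<close>

inductive smooth_gen :: "('a::euclidean_space \<Rightarrow> real) \<Rightarrow> bool" where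
  shift: "smooth_fun f \<Longrightarrow> smooth_gen (\<lambda>x. f (x - h))"
| const: "smooth_gen (\<lambda>x. c)"
| profile: "smooth_gen (\<lambda>x. bump_profile k (\<alpha> + \<beta> \<bullet> x))"
| add: "smooth_gen f \<Longrightarrow> smooth_gen g \<Longrightarrow> smooth_gen (\<lambda>x. f x + g x)"
| mult: "smooth_gen f \<Longrightarrow> smooth_gen g \<Longrightarrow> smooth_gen (\<lambda>x. f x * g x)"

lemma smooth_fun_differentiable: "smooth_fun f \<Longrightarrow> f differentiable (at x)"
  by (erule smooth_fun.cases) auto

lemma smooth_fun_frechet: "smooth_fun f \<Longrightarrow> b \<in> Basis \<Longrightarrow> smooth_fun (\<lambda>x. frechet_derivative f (at x) b)"
  by (erule smooth_fun.cases) auto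

text \<open>In the product case the factors must lie in the class themselves, since they reappear
  beside the derivatives; this is why the class contains the functions and not only their
  derivatives.\<close>

lemma smooth_gen_derivative:
  assumes "smooth_gen f"
  shows "\<exists>D. (\<forall>x. (f has_derivative D x) (at x)) \<and> (\<forall>b\<in>Basis. smooth_gen (\<lambda>x. D x b))"
  using assms
proof induction
  case (shift f h)
  have "((\<lambda>x. f (x - h)) has_derivative frechet_derivative f (at (x - h))) (at x)" for x
  proof -
    have "(f has_derivative frechet_derivative f (at (x - h))) (at (x - h))"
      using smooth_fun_differentiable[OF shift] by (simp add: frechet_derivative_works)
    then have "((f \<circ> (\<lambda>x. x - h)) has_derivative (frechet_derivative f (at (x - h)) \<circ> (\<lambda>x. x))) (at x)"
      by (intro diff_chain_at) (auto intro!: derivative_eq_intros)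
    then show ?thesis by (simp add: o_def)
  qed
  moreover have "smooth_gen (\<lambda>x. frechet_derivative f (at (x - h)) b)" if "b \<in> Basis" for b
    using smooth_gen.shift[OF smooth_fun_frechet[OF shift that]] .
  ultimately show ?case by (intro exI[of _ "\<lambda>x. frechet_derivative f (at (x - h))"]) auto
next
  case (const c)
  show ?case by (rule exI[of _ "\<lambda>_ _. 0"]) (auto intro: smooth_gen.const)
next
  case (profile k \<alpha> \<beta>)
  let ?d = "\<lambda>x. bump_profile (k+2) (\<alpha> + \<beta> \<bullet> x) + (- real k) * bump_profile (k+1) (\<alpha> + \<beta> \<bullet> x)"
  have "((\<lambda>x. bump_profile k (\<alpha> + \<beta> \<bullet> x)) has_derivative (\<lambda>v. ?d x * (\<beta> \<bullet> v))) (at x)" for x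
  proof -
    have "((\<lambda>x. \<alpha> + \<beta> \<bullet> x) has_derivative (\<lambda>v. \<beta> \<bullet> v)) (at x)"
      by (auto intro!: derivative_eq_intros)
    from diff_chain_at[OF this bump_profile_DERIV[THEN has_field_derivative_imp_has_derivative]]
    show ?thesis by (simp add: o_def algebra_simps)
  qed
  moreover have "smooth_gen (\<lambda>x. ?d x * (\<beta> \<bullet> b))" for b
    by (intro smooth_gen.add smooth_gen.mult smooth_gen.const smooth_gen.profile)
  ultimately show ?case by (intro exI[of _ "\<lambda>x v. ?d x * (\<beta> \<bullet> v)"]) blast
next
  case (add f g)
  from add.IH(1) obtain D where D: "\<And>x. (f has_derivative D x) (at x)" "\<And>b. b \<in> Basis \<Longrightarrow> smooth_gen (\<lambda>x. D x b)" by blast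
  from add.IH(2) obtain E where E: "\<And>x. (g has_derivative E x) (at x)" "\<And>b. b \<in> Basis \<Longrightarrow> smooth_gen (\<lambda>x. E x b)" by blast
  show ?case
    by (rule exI[of _ "\<lambda>x v. D x v + E x v"]) (auto intro!: has_derivative_add smooth_gen.add D E)
next
  case (mult f g)
  from mult.IH(1) obtain D where D: "\<And>x. (f has_derivative D x) (at x)" "\<And>b. b \<in> Basis \<Longrightarrow> smooth_gen (\<lambda>x. D x b)" by blast
  from mult.IH(2) obtain E where E: "\<And>x. (g has_derivative E x) (at x)" "\<And>b. b \<in> Basis \<Longrightarrow> smooth_gen (\<lambda>x. E x b)" by blast
  show ?case
    by (rule exI[of _ "\<lambda>x v. f x * E x v + D x v * g x"])
      (auto intro!: has_derivative_mult smooth_gen.add smooth_gen.mult mult.hyps D E)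
qed

lemma smooth_gen_imp_smooth: "smooth_gen f \<Longrightarrow> smooth_fun f"
proof (coinduction arbitrary: f)
  case smooth_fun
  from smooth_gen_derivative[OF this]
  obtain D where D: "\<And>x. (f has_derivative D x) (at x)" "\<And>b. b \<in> Basis \<Longrightarrow> smooth_gen (\<lambda>x. D x b)" by blast
  have "frechet_derivative f (at x) = D x" for x
    using frechet_derivative_at[OF D(1)] by simp
  then show ?case using D by (auto simp: differentiable_def)
qed

lemma smooth_gen_smooth: "smooth_fun f \<Longrightarrow> smooth_gen f"
  using smooth_gen.shift[of f 0] by simp

lemma smooth_gen_prod: "finite I \<Longrightarrow> (\<And>i. i \<in> I \<Longrightarrow> smooth_gen (f i)) \<Longrightarrow> smooth_gen (\<lambda>x. \<Prod>i\<in>I. f i x)"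
  by (induction I rule: finite_induct) (auto intro: smooth_gen.const smooth_gen.mult)

lemma smooth_fun_has_derivative: "smooth_fun f \<Longrightarrow> (f has_derivative frechet_derivative f (at x)) (at x)"
  using smooth_fun_differentiable by (simp add: frechet_derivative_works)

lemma smooth_fun_continuous: "smooth_fun f \<Longrightarrow> continuous_on UNIV f"
  using smooth_fun_differentiable by (meson continuous_at_imp_continuous_on differentiable_imp_continuous_within)

section \<open>Closure properties of test functions\<close>

lemma compact_closure_subset:
  fixes K :: "'a::euclidean_space set"
  assumes "compact K" "closure S \<subseteq> K" shows "compact (closure S)"
  unfolding compact_closure
  by (rule bounded_subset[OF compact_imp_bounded[OF assms(1)]]) (use assms(2) closure_subset in blast)

lemma Cc_inf_add_scaled:
  assumes "\<phi> \<in> Cc_inf \<Omega>" "\<psi> \<in> Cc_inf \<Omega>" shows "(\<lambda>x. \<phi> x + t * \<psi> x) \<in> Cc_inf \<Omega>"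
proof -
  have "smooth_fun (\<lambda>x. \<phi> x + t * \<psi> x)"
    using assms by (intro smooth_gen_imp_smooth[OF smooth_gen.add[OF smooth_gen_smooth
        smooth_gen.mult[OF smooth_gen.const smooth_gen_smooth]]]) (auto simp: Cc_inf_def)
  moreover have sub: "closure {x. \<phi> x + t * \<psi> x \<noteq> 0} \<subseteq> closure {x. \<phi> x \<noteq> 0} \<union> closure {x. \<psi> x \<noteq> 0}"
    unfolding closure_Un[symmetric] by (rule closure_mono) auto
  moreover have "compact (closure {x. \<phi> x \<noteq> 0} \<union> closure {x. \<psi> x \<noteq> 0})"
    using assms by (auto simp: Cc_inf_def)
  then have "compact (closure {x. \<phi> x + t * \<psi> x \<noteq> 0})"
    using sub by (rule compact_closure_subset)
  ultimately show ?thesis using assms by (auto simp: Cc_inf_def)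
qed

lemma Cc_inf_UNIV_I:
  assumes "smooth_fun \<phi>" "compact K" "\<And>x. x \<notin> K \<Longrightarrow> \<phi> x = 0" shows "\<phi> \<in> Cc_inf UNIV"
proof -
  have "closure {x. \<phi> x \<noteq> 0} \<subseteq> K"
    using assms(2,3) by (intro closure_minimal) (auto intro: compact_imp_closed)
  then have "compact (closure {x. \<phi> x \<noteq> 0})"
    by (rule compact_closure_subset[OF assms(2)])
  then show ?thesis using assms by (auto simp: Cc_inf_def)
qed

text \<open>Replaces the closed support by a plain compact set. The derivatives vanish off it as
  well, because the complement of the closure is open and the function is constantly 0
  there.\<close>

lemma Cc_inf_support:
  assumes "\<phi> \<in> Cc_inf \<Omega>"
  obtains K where "compact K" "K \<subseteq> \<Omega>" "\<And>x. x \<notin> K \<Longrightarrow> \<phi> x = 0"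
    "\<And>x b. x \<notin> K \<Longrightarrow> frechet_derivative \<phi> (at x) b = 0"
proof (rule that[of "closure {x. \<phi> x \<noteq> 0}"])
  show "compact (closure {x. \<phi> x \<noteq> 0})" "closure {x. \<phi> x \<noteq> 0} \<subseteq> \<Omega>"
    using assms by (auto simp: Cc_inf_def)
  show "\<phi> x = 0" if "x \<notin> closure {x. \<phi> x \<noteq> 0}" for x
    using that closure_subset[of "{x. \<phi> x \<noteq> 0}"] by blast
  show "frechet_derivative \<phi> (at x) b = 0" if "x \<notin> closure {x. \<phi> x \<noteq> 0}" for x b
  proof -
    have "((\<lambda>x. 0) has_derivative (\<lambda>v. 0)) (at x)" by simp
    then have "(\<phi> has_derivative (\<lambda>v. 0)) (at x)"
      by (rule has_derivative_transform_within_open[OF _ open_Compl[OF closed_closure[of "{x. \<phi> x \<noteq> 0}"]]])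
        (use that closure_subset[of "{x. \<phi> x \<noteq> 0}"] in auto)
    from frechet_derivative_at[OF this, symmetric] show ?thesis by simp
  qed
qed

lemma Cc_inf_translate:
  assumes "\<phi> \<in> Cc_inf UNIV" shows "(\<lambda>x. \<phi> (x - h)) \<in> Cc_inf UNIV"
proof -
  obtain K where K: "compact K" "\<And>x. x \<notin> K \<Longrightarrow> \<phi> x = 0" by (rule Cc_inf_support[OF assms]) blast
  show ?thesis
  proof (rule Cc_inf_UNIV_I)
    show "smooth_fun (\<lambda>x. \<phi> (x - h))"
      using smooth_gen_imp_smooth[OF smooth_gen.shift] assms by (auto simp: Cc_inf_def)
    show "compact ((+) h ` K)" by (rule compact_translation[OF K(1)])
    show "\<phi> (x - h) = 0" if "x \<notin> (+) h ` K" for x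
      using that by (intro K(2)) (auto simp: image_iff)
  qed
qed

lemma frechet_translate:
  assumes "smooth_fun \<phi>" shows "frechet_derivative (\<lambda>x. \<phi> (x - h)) (at x) = frechet_derivative \<phi> (at (x - h))"
proof -
  have "((\<phi> \<circ> (\<lambda>x. x - h)) has_derivative (frechet_derivative \<phi> (at (x - h)) \<circ> (\<lambda>x. x))) (at x)"
    by (intro diff_chain_at smooth_fun_has_derivative assms) (auto intro!: derivative_eq_intros)
  from frechet_derivative_at[OF this, symmetric] show ?thesis by (simp add: o_def)
qed

text \<open>A product of one-dimensional profiles of slope \<open>k\<close>: it vanishes off the
  open box and rises to 1 inside as \<open>k\<close> grows. The arguments are written as affine
  forms in \<open>x\<close> so that the \<open>profile\<close> rule of \<open>smooth_gen\<close>
  applies; \<open>box_bump_eq\<close> is the form used for estimates.\<close>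

definition box_bump :: "'a::euclidean_space \<Rightarrow> 'a \<Rightarrow> nat \<Rightarrow> 'a \<Rightarrow> real" where
  "box_bump a b k x = (\<Prod>i\<in>Basis. bump_profile 0 (- real k * (a \<bullet> i) + (real k *\<^sub>R i) \<bullet> x)
      * bump_profile 0 (real k * (b \<bullet> i) + (- real k *\<^sub>R i) \<bullet> x))"

lemma box_bump_eq: "box_bump a b k x = (\<Prod>i\<in>Basis. bump_profile 0 (real k * (x \<bullet> i - a \<bullet> i))
      * bump_profile 0 (real k * (b \<bullet> i - x \<bullet> i)))"
  unfolding box_bump_def by (intro prod.cong) (auto simp: algebra_simps inner_commute)

lemma bump_profile_0_bounds: "0 \<le> bump_profile 0 t" "bump_profile 0 t \<le> 1"
  by (auto simp: bump_profile_def)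

lemma box_bump_bounds: "0 \<le> box_bump a b k x" "box_bump a b k x \<le> 1"
  unfolding box_bump_eq
  by (auto intro!: prod_nonneg prod_le_1 mult_nonneg_nonneg mult_le_one bump_profile_0_bounds)

lemma box_bump_outside: assumes "x \<notin> box a b" shows "box_bump a b k x = 0"
proof -
  obtain i where "i \<in> Basis" "x \<bullet> i \<le> a \<bullet> i \<or> b \<bullet> i \<le> x \<bullet> i"
    using assms by (auto simp: mem_box not_less)
  then show ?thesis unfolding box_bump_eq
    by (intro prod_zero bexI[of _ i]) (auto simp: bump_profile_def mult_le_0_iff zero_less_mult_iff)
qed

lemma box_bump_Cc_inf: "box_bump a b k \<in> Cc_inf UNIV"
proof (rule Cc_inf_UNIV_I[OF _ compact_cbox[of a b]])
  show "smooth_fun (box_bump a b k)"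
    unfolding box_bump_def[abs_def]
    by (intro smooth_gen_imp_smooth smooth_gen_prod smooth_gen.mult smooth_gen.profile) auto
  show "box_bump a b k x = 0" if "x \<notin> cbox a b" for x
    using that box_subset_cbox by (intro box_bump_outside) blast
qed

lemma bump_profile_0_lim: assumes "t > 0" shows "(\<lambda>k. bump_profile 0 (real k * t)) \<longlonglongrightarrow> 1"
proof -
  have "(\<lambda>k. exp (- (inverse (real k) * inverse t))) \<longlonglongrightarrow> exp (- (0 * inverse t))"
    by (intro tendsto_intros lim_inverse_n)
  then have "(\<lambda>k. exp (- inverse (real k * t))) \<longlonglongrightarrow> 1" by simp
  then show ?thesis
    by (rule Lim_transform_eventually)
      (use eventually_gt_at_top[of "0::nat"] in eventually_elim, use assms in \<open>auto simp: bump_profile_def\<close>)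
qed

lemma box_bump_lim: "(\<lambda>k. box_bump a b k x) \<longlonglongrightarrow> indicator (box a b) x"
proof (cases "x \<in> box a b")
  case True
  have "(\<lambda>k. box_bump a b k x) \<longlonglongrightarrow> (\<Prod>i\<in>(Basis::'a set). 1 * 1)"
    unfolding box_bump_eq using True
    by (intro tendsto_prod tendsto_mult bump_profile_0_lim) (auto simp: mem_box)
  then show ?thesis using True by simp
qed (simp add: box_bump_outside)

text \<open>The positive and negative parts are densities of finite measures that agree on all
  boxes. Boxes are stable under intersection and generate the Borel sets, so the measures, and hence
  the densities, coincide.\<close>

lemma AE_zero_of_box_integrals:
  fixes f :: "'a::euclidean_space \<Rightarrow> real"
  assumes f: "integrable lborel f" and z: "\<And>a b. (\<integral>x. f x * indicator (box a b) x \<partial>lborel) = 0"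
  shows "AE x in lborel. f x = 0"
proof -
  have [measurable]: "f \<in> borel_measurable borel" using f by auto
  define p where "p x = max 0 (f x)" for x
  define q where "q x = max 0 (- f x)" for x
  have [measurable]: "p \<in> borel_measurable borel" "q \<in> borel_measurable borel" unfolding p_def q_def by measurable
  have ip: "integrable lborel p" "integrable lborel q" unfolding p_def q_def using f by auto
  have fpq: "f x = p x - q x" for x by (auto simp: p_def q_def)
  have eq: "(\<integral>\<^sup>+x. ennreal (p x) * indicator (box a b) x \<partial>lborel) = (\<integral>\<^sup>+x. ennreal (q x) * indicator (box a b) x \<partial>lborel)" for a b
  proof -
    have i: "integrable lborel (\<lambda>x. p x * indicator (box a b) x)" "integrable lborel (\<lambda>x. q x * indicator (box a b) x)"
      using ip by (auto intro!: integrable_real_mult_indicator)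
    have "(\<integral>x. p x * indicator (box a b) x \<partial>lborel) - (\<integral>x. q x * indicator (box a b) x \<partial>lborel)
       = (\<integral>x. p x * indicator (box a b) x - q x * indicator (box a b) x \<partial>lborel)"
      using i by (rule Bochner_Integration.integral_diff[symmetric])
    also have "\<dots> = (\<integral>x. f x * indicator (box a b) x \<partial>lborel)"
      unfolding fpq by (simp add: left_diff_distrib)
    finally have e: "(\<integral>x. p x * indicator (box a b) x \<partial>lborel) = (\<integral>x. q x * indicator (box a b) x \<partial>lborel)"
      unfolding z by simp
    have c: "ennreal (g x) * indicator (box a b) x = ennreal (g x * indicator (box a b) x)" for g :: "'a \<Rightarrow> real" and x
      by (simp add: indicator_def)
    have "(\<integral>\<^sup>+x. ennreal (p x * indicator (box a b) x) \<partial>lborel) = ennreal (\<integral>x. p x * indicator (box a b) x \<partial>lborel)"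
      by (rule nn_integral_eq_integral[OF i(1)]) (simp add: p_def)
    moreover have "(\<integral>\<^sup>+x. ennreal (q x * indicator (box a b) x) \<partial>lborel) = ennreal (\<integral>x. q x * indicator (box a b) x \<partial>lborel)"
      by (rule nn_integral_eq_integral[OF i(2)]) (simp add: q_def)
    ultimately show ?thesis unfolding c e by simp
  qed
  have "density lborel p = density lborel q"
  proof (rule measure_eqI_generator_eq)
    let ?E = "range (\<lambda>(a, b). box a b::'a set)"
    show "Int_stable ?E" by (auto simp: Int_stable_def box_Int_box)
    show "?E \<subseteq> Pow UNIV" "sets (density lborel p) = sigma_sets UNIV ?E" "sets (density lborel q) = sigma_sets UNIV ?E"
      by (simp_all add: borel_eq_box)
    let ?A = "\<lambda>n::nat. box (- (real n *\<^sub>R One)) (real n *\<^sub>R One) :: 'a set"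
    show "range ?A \<subseteq> ?E" "(\<Union>i. ?A i) = UNIV" unfolding UN_box_eq_UNIV by auto
    show "emeasure (density lborel p) (?A i) \<noteq> \<infinity>" for i
    proof -
      have "emeasure (density lborel p) (?A i) = (\<integral>\<^sup>+x. ennreal (p x) * indicator (?A i) x \<partial>lborel)"
        by (rule emeasure_density) auto
      also have "\<dots> \<le> (\<integral>\<^sup>+x. ennreal (p x) \<partial>lborel)"
        by (rule nn_integral_mono) (auto simp: indicator_def)
      also have "\<dots> = ennreal (\<integral>x. p x \<partial>lborel)"
        by (rule nn_integral_eq_integral[OF ip(1)]) (simp add: p_def)
      finally show ?thesis by (auto simp: top_unique)
    qed
    show "emeasure (density lborel p) X = emeasure (density lborel q) X" if "X \<in> ?E" for X
      using that eq by (auto simp: emeasure_density)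
  qed
  then have "AE x in lborel. ennreal (p x) = ennreal (q x)"
    by (intro sigma_finite_measure.density_unique[OF sigma_finite_lborel]) auto
  then show ?thesis by eventually_elim (auto simp: p_def q_def max_def split: if_splits)
qed

text \<open>The bumps of a box converge boundedly to its indicator, so dominated convergence carries
  the hypothesis from test functions over to boxes.\<close>

lemma fundamental_lemma:
  fixes g :: "'a::euclidean_space \<Rightarrow> real"
  assumes loc: "\<And>K. compact K \<Longrightarrow> set_integrable lborel K g"
    and z: "\<And>\<phi>. \<phi> \<in> Cc_inf UNIV \<Longrightarrow> (\<integral>x. g x * \<phi> x \<partial>lborel) = 0"
  shows "AE x in lborel. g x = 0"
proof -
  have bz: "(\<integral>x. g x * indicator (box a b) x \<partial>lborel) = 0" for a b
  proof -
    have il: "integrable lborel (\<lambda>x. indicator (cbox a b) x * g x)"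
      using loc[OF compact_cbox[of a b]] by (simp add: set_integrable_def)
    have bb: "g x * box_bump a b k x = indicator (cbox a b) x * g x * box_bump a b k x" for k x
      using box_bump_outside[of x a b k] box_subset_cbox[of a b] by (auto simp: indicator_def)
    have gi: "g x * indicator (box a b) x = indicator (cbox a b) x * g x * indicator (box a b) x" for x
      using box_subset_cbox[of a b] by (auto simp: indicator_def)
    have bm[measurable]: "box_bump a b k \<in> borel_measurable borel" for k
      using box_bump_Cc_inf[of a b k]
      by (auto simp: Cc_inf_def intro!: borel_measurable_continuous_onI smooth_fun_continuous)
    have [measurable]: "(\<lambda>x. indicator (cbox a b) x * g x) \<in> borel_measurable borel" using il by auto
    have "(\<lambda>k. \<integral>x. g x * box_bump a b k x \<partial>lborel) \<longlonglongrightarrow> (\<integral>x. g x * indicator (box a b) x \<partial>lborel)"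
      unfolding bb gi
    proof (rule integral_dominated_convergence)
      show "integrable lborel (\<lambda>x. \<bar>indicator (cbox a b) x * g x\<bar>)" using il by (rule integrable_abs)
      show "AE x in lborel. (\<lambda>k. indicator (cbox a b) x * g x * box_bump a b k x)
           \<longlonglongrightarrow> indicator (cbox a b) x * g x * indicator (box a b) x"
        by (intro AE_I2 tendsto_intros box_bump_lim)
      show "AE x in lborel. norm (indicator (cbox a b) x * g x * box_bump a b k x) \<le> \<bar>indicator (cbox a b) x * g x\<bar>" for k
        using box_bump_bounds[of a b k]
        by (auto simp: abs_mult intro!: AE_I2 mult_right_le_one_le)
    qed measurable
    moreover have "(\<integral>x. g x * box_bump a b k x \<partial>lborel) = 0" for k
      by (rule z[OF box_bump_Cc_inf])
    ultimately show ?thesis by (simp add: LIMSEQ_const_iff)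
  qed
  \<comment> \<open>As \<open>g\<close> is only locally integrable, it is cut off to an exhausting
    sequence of boxes. Two boxes intersect in a box, so the cut-off function still has vanishing
    integrals over all boxes.\<close>
  have "AE x in lborel. indicator (box (- (real n *\<^sub>R One)) (real n *\<^sub>R One)) x * g x = 0" for n :: nat
  proof (rule AE_zero_of_box_integrals)
    let ?B = "box (- (real n *\<^sub>R One)) (real n *\<^sub>R One) :: 'a set"
    let ?C = "cbox (- (real n *\<^sub>R One)) (real n *\<^sub>R One) :: 'a set"
    have "integrable lborel (\<lambda>x. (indicator ?C x * g x) * indicator ?B x)"
      using loc[OF compact_cbox] by (intro integrable_real_mult_indicator) (auto simp: set_integrable_def)
    moreover have "(indicator ?C x * g x) * indicator ?B x = indicator ?B x * g x" for x
      using box_subset_cbox[of "- (real n *\<^sub>R One)::'a" "real n *\<^sub>R One"] by (auto simp: indicator_def)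
    ultimately show "integrable lborel (\<lambda>x. indicator ?B x * g x)" by simp
    fix a b :: 'a
    obtain c d where cd: "box a b \<inter> ?B = box c d" using box_Int_box by blast
    have "(\<lambda>x. indicator ?B x * g x * indicator (box a b) x) = (\<lambda>x. g x * indicator (box c d) x)"
      unfolding cd[symmetric] by (auto simp: indicator_def)
    then show "(\<integral>x. indicator ?B x * g x * indicator (box a b) x \<partial>lborel) = 0"
      by (simp only: bz)
  qed
  then have "AE x in lborel. \<forall>n::nat. indicator (box (- (real n *\<^sub>R One)) (real n *\<^sub>R One)) x * g x = 0"
    unfolding AE_all_countable by blast
  then show ?thesis
  proof eventually_elim
    case (elim x)
    obtain n :: nat where "x \<in> box (- (real n *\<^sub>R One)) (real n *\<^sub>R One)"
      using UN_box_eq_UNIV by blast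
    then show ?case using elim[rule_format, of n] by simp
  qed
qed

section \<open>Weak gradients\<close>

text \<open>The sign of \<open>c\<close> is part of what has to be derived. The lemma yields both
  Cauchy-Schwarz inequalities below and, with \<open>a = 0\<close>, the Euler-Lagrange equation of a
  minimiser.\<close>

lemma quadratic_discriminant:
  fixes a b c :: real
  assumes "\<And>t. 0 \<le> a + 2*t*b + t\<^sup>2*c" shows "b\<^sup>2 \<le> a * c"
proof (cases "c = 0")
  case True
  have "b = 0"
  proof (rule ccontr)
    assume "b \<noteq> 0"
    then have "2 * (-(a+1)/(2*b)) * b = -(a+1)" by simp
    then show False using assms[of "-(a+1)/(2*b)"] unfolding True by linarith
  qed
  then show ?thesis using True by simp
next
  case False
  have c: "c > 0"
  proof (rule ccontr)
    assume "\<not> c > 0"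
    then have c: "c < 0" using False by simp
    \<comment> \<open>Chosen so that \<open>s * (-c)\<close> equals -c + |a| + 2 |b|; the quadratic
      term then outweighs the other two and the polynomial is negative at \<open>s\<close>.\<close>
    define s where "s = 1 + \<bar>a\<bar>/(-c) + 2*\<bar>b\<bar>/(-c)"
    have "0 \<le> \<bar>a\<bar>/(-c)" "0 \<le> 2*\<bar>b\<bar>/(-c)" using c by (intro divide_nonneg_pos; simp)+
    then have s1: "s \<ge> 1" unfolding s_def by linarith
    have "s * (-c) = (-c) + \<bar>a\<bar> + 2*\<bar>b\<bar>" using c by (simp add: s_def field_simps)
    then have "s * (s * (-c)) = s * ((-c) + \<bar>a\<bar> + 2*\<bar>b\<bar>)" by simp
    then have e: "s\<^sup>2 * c = - (s * (-c)) - s * \<bar>a\<bar> - 2 * s * \<bar>b\<bar>" by (simp add: power2_eq_square algebra_simps)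
    have "0 \<le> a + 2 * s * b + s\<^sup>2 * c" by (rule assms)
    moreover have "2 * s * b \<le> 2 * s * \<bar>b\<bar>" using s1 by simp
    moreover have "\<bar>a\<bar> \<le> s * \<bar>a\<bar>" using s1 by (simp add: mult_le_cancel_right1)
    moreover have "s * (-c) > 0" using s1 c by (simp add: mult_less_0_iff)
    ultimately show False using e by linarith
  qed
  \<comment> \<open>The point -b/c is the vertex of the parabola.\<close>
  have "0 \<le> a + 2*(-b/c)*b + (-b/c)\<^sup>2*c" by (rule assms)
  also have "\<dots> = a - b\<^sup>2/c" using c by (simp add: power2_eq_square field_simps)
  finally show ?thesis using c by (simp add: field_simps)
qed

lemma sqint_Cauchy_Schwarz:
  assumes "sqint M f" "sqint M g"
  shows "(\<integral>x. f x \<bullet> g x \<partial>M)\<^sup>2 \<le> (\<integral>x. (norm (f x))\<^sup>2 \<partial>M) * (\<integral>x. (norm (g x))\<^sup>2 \<partial>M)"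
proof (rule quadratic_discriminant)
  fix t
  have "0 \<le> (\<integral>x. (norm (f x + t *\<^sub>R g x))\<^sup>2 \<partial>M)" by (rule integral_nonneg_AE) simp
  then show "0 \<le> (\<integral>x. (norm (f x))\<^sup>2 \<partial>M) + 2*t*(\<integral>x. f x \<bullet> g x \<partial>M) + t\<^sup>2 * (\<integral>x. (norm (g x))\<^sup>2 \<partial>M)"
    unfolding integral_norm_sq_add_scaled[OF assms] .
qed

lemma sqint_inner_tendsto:
  fixes f :: "'m \<Rightarrow> real"
  assumes "\<And>n. sqint M (F n)" "sqint M f" "sqint M g"
    and "(\<lambda>n. \<integral>\<^sup>+x. ennreal ((F n x - f x)\<^sup>2) \<partial>M) \<longlonglongrightarrow> 0"
  shows "(\<lambda>n. \<integral>x. F n x * g x \<partial>M) \<longlonglongrightarrow> (\<integral>x. f x * g x \<partial>M)"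
proof -
  have d: "sqint M (\<lambda>x. F n x - f x)" for n by (intro sqint_diff assms)
  have "(\<lambda>n. ennreal (\<integral>x. (F n x - f x)\<^sup>2 \<partial>M)) \<longlonglongrightarrow> ennreal 0"
    using assms(4) sqint_nn_eq[OF d] by simp
  then have z: "(\<lambda>n. \<integral>x. (F n x - f x)\<^sup>2 \<partial>M) \<longlonglongrightarrow> 0"
    by (subst (asm) tendsto_ennreal_iff) (auto simp: integral_nonneg_AE)
  have "(\<lambda>n. (\<integral>x. F n x * g x \<partial>M) - (\<integral>x. f x * g x \<partial>M)) \<longlonglongrightarrow> 0"
  proof (rule Lim_null_comparison)
    show "(\<lambda>n. sqrt ((\<integral>x. (F n x - f x)\<^sup>2 \<partial>M) * (\<integral>x. (g x)\<^sup>2 \<partial>M))) \<longlonglongrightarrow> 0"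
      using tendsto_real_sqrt[OF tendsto_mult_left_zero[OF z]] by simp
    show "\<forall>\<^sub>F n in sequentially. norm ((\<integral>x. F n x * g x \<partial>M) - (\<integral>x. f x * g x \<partial>M))
        \<le> sqrt ((\<integral>x. (F n x - f x)\<^sup>2 \<partial>M) * (\<integral>x. (g x)\<^sup>2 \<partial>M))"
    proof (rule always_eventually, rule allI)
      fix n
      have "(\<integral>x. F n x * g x \<partial>M) - (\<integral>x. f x * g x \<partial>M) = (\<integral>x. (F n x - f x) * g x \<partial>M)"
        using sqint_inner_integrable[OF assms(1,3)] sqint_inner_integrable[OF assms(2,3)]
        by (simp add: left_diff_distrib)
      then show "norm ((\<integral>x. F n x * g x \<partial>M) - (\<integral>x. f x * g x \<partial>M)) \<le> sqrt ((\<integral>x. (F n x - f x)\<^sup>2 \<partial>M) * (\<integral>x. (g x)\<^sup>2 \<partial>M))"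
        using sqint_Cauchy_Schwarz[OF d assms(3)] by (simp add: real_le_rsqrt)
    qed
  qed
  then show ?thesis by (rule LIM_zero_cancel)
qed

section \<open>Translation invariance and local integrability\<close>

lemma
  fixes c :: "'a::euclidean_space" and g :: "'a \<Rightarrow> real"
  shows nn_integral_shift: "f \<in> borel_measurable borel \<Longrightarrow> (\<integral>\<^sup>+x. f (x + c) \<partial>lborel) = (\<integral>\<^sup>+x. f x \<partial>lborel)"
    and integral_shift: "g \<in> borel_measurable borel \<Longrightarrow> (\<integral>x. g (x + c) \<partial>lborel) = (\<integral>x. g x \<partial>lborel)"
    and integrable_shift: "integrable lborel g \<Longrightarrow> integrable lborel (\<lambda>x. g (x + c))"
    and AE_shift: "(AE x in lborel. P x) \<Longrightarrow> (AE x in lborel. P (x + c))"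
proof -
  have c: "(\<lambda>x. c + x) = (\<lambda>x. x + c)" by (simp add: add.commute)
  have m: "(\<lambda>x. x + c) \<in> measurable lborel borel" by measurable
  note l = lborel_distr_plus[of c, unfolded c]
  show "(\<integral>\<^sup>+x. f (x + c) \<partial>lborel) = (\<integral>\<^sup>+x. f x \<partial>lborel)" if "f \<in> borel_measurable borel"
    using nn_integral_distr[OF m, of f] that unfolding l by simp
  show "(\<integral>x. g (x + c) \<partial>lborel) = (\<integral>x. g x \<partial>lborel)" if "g \<in> borel_measurable borel"
    using integral_distr[OF m, of g] that unfolding l by simp
  show "integrable lborel (\<lambda>x. g (x + c))" if "integrable lborel g"
    using integrable_distr[OF m, of g] that unfolding l by simp
  show "AE x in lborel. P (x + c)" if "AE x in lborel. P x"
    using AE_distrD[OF m, of P] that unfolding l by simp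
qed

lemma sqint_shift: "sqint lborel f \<Longrightarrow> sqint lborel (\<lambda>x. f (x + c))"
  unfolding sqint_def using integrable_shift[of "\<lambda>x. (norm (f x))\<^sup>2" c]
    measurable_compose[of "\<lambda>x. x + c" borel borel f borel] by simp

lemma sqint_indicator_compact: "compact K \<Longrightarrow> sqint lborel (indicat_real K)"
proof -
  assume K: "compact K"
  have "integrable lborel (indicat_real K)"
    using emeasure_compact_finite[OF K] compact_imp_closed[OF K] by (intro integrable_real_indicator) auto
  moreover have "(norm (indicat_real K x))\<^sup>2 = indicat_real K x" for x by (simp add: indicator_def)
  ultimately show ?thesis using compact_imp_closed[OF K] by (simp add: sqint_def)
qed

lemma sqint_set_integrable:
  fixes f :: "'a::euclidean_space \<Rightarrow> real"
  assumes "sqint lborel f" "compact K" shows "set_integrable lborel K f"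
  using sqint_inner_integrable[OF sqint_indicator_compact[OF assms(2)] assms(1)] by (simp add: set_integrable_def)

lemma sqint_component: "sqint M f \<Longrightarrow> i \<in> Basis \<Longrightarrow> sqint M (\<lambda>x. f x \<bullet> i)"
proof -
  assume f: "sqint M f" and i: "i \<in> Basis"
  have [measurable]: "f \<in> borel_measurable M" using f by (simp add: sqint_def)
  have "integrable M (\<lambda>x. (norm (f x \<bullet> i))\<^sup>2)"
  proof (rule Bochner_Integration.integrable_bound[OF sqint_integrable[OF f]])
    show "AE x in M. norm ((norm (f x \<bullet> i))\<^sup>2) \<le> norm ((norm (f x))\<^sup>2)"
      using Basis_le_norm[OF i] by (auto intro!: AE_I2 simp: power2_le_iff_abs_le abs_le_square_iff[symmetric])
  qed measurable
  then show ?thesis by (simp add: sqint_def)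
qed

lemma continuous_compact_support_sqint:
  fixes f :: "'a::euclidean_space \<Rightarrow> real"
  assumes "continuous_on UNIV f" "compact K" "\<And>x. x \<notin> K \<Longrightarrow> f x = 0"
  shows "sqint lborel f" "\<exists>B. \<forall>x. \<bar>f x\<bar> \<le> B"
proof -
  have "bounded (f ` K)"
    using assms by (intro compact_imp_bounded compact_continuous_image) (auto intro: continuous_on_subset)
  then obtain B where B: "\<And>x. x \<in> K \<Longrightarrow> \<bar>f x\<bar> \<le> B" by (auto simp: bounded_iff)
  have B': "\<bar>f x\<bar> \<le> \<bar>B\<bar>" for x using B[of x] assms(3)[of x] by (cases "x \<in> K") auto
  then show "\<exists>B. \<forall>x. \<bar>f x\<bar> \<le> B" by blast
  have [measurable]: "f \<in> borel_measurable borel" using assms(1) by (rule borel_measurable_continuous_onI)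
  have "integrable lborel (\<lambda>x. B\<^sup>2 * (norm (indicat_real K x))\<^sup>2)"
    using sqint_integrable[OF sqint_indicator_compact[OF assms(2)]] by simp
  then have "integrable lborel (\<lambda>x. (norm (f x))\<^sup>2)"
  proof (rule Bochner_Integration.integrable_bound)
    show "AE x in lborel. norm ((norm (f x))\<^sup>2) \<le> norm (B\<^sup>2 * (norm (indicat_real K x))\<^sup>2)"
    proof (rule AE_I2)
      fix x show "norm ((norm (f x))\<^sup>2) \<le> norm (B\<^sup>2 * (norm (indicat_real K x))\<^sup>2)"
        using B'[of x] assms(3)[of x] by (cases "x \<in> K") (auto simp: abs_le_square_iff)
    qed
  qed measurable
  then show "sqint lborel f" by (simp add: sqint_def)
qed

lemma locally_integrable_mult:
  fixes g f :: "'a::euclidean_space \<Rightarrow> real"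
  assumes g: "\<And>K. compact K \<Longrightarrow> set_integrable lborel K g"
    and f: "continuous_on UNIV f" "compact K" "\<And>x. x \<notin> K \<Longrightarrow> f x = 0"
  shows "integrable lborel (\<lambda>x. g x * f x)"
proof -
  obtain B where B: "\<And>x. \<bar>f x\<bar> \<le> B" using continuous_compact_support_sqint(2)[OF f] by blast
  have [measurable]: "f \<in> borel_measurable borel" using f(1) by (rule borel_measurable_continuous_onI)
  have i: "integrable lborel (\<lambda>x. indicator K x * g x)" using g[OF f(2)] by (simp add: set_integrable_def)
  have "integrable lborel (\<lambda>x. (indicator K x * g x) * f x)"
  proof (rule Bochner_Integration.integrable_bound)
    show "integrable lborel (\<lambda>x. B * (indicator K x * g x))" using i by simp
    show "(\<lambda>x. indicator K x * g x * f x) \<in> borel_measurable lborel"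
      using borel_measurable_integrable[OF i] by measurable
    show "AE x in lborel. norm (indicator K x * g x * f x) \<le> norm (B * (indicator K x * g x))"
    proof (rule AE_I2)
      fix x
      have "\<bar>f x\<bar> * \<bar>indicator K x * g x\<bar> \<le> \<bar>B\<bar> * \<bar>indicator K x * g x\<bar>"
        using B[of x] by (intro mult_right_mono) auto
      then show "norm (indicator K x * g x * f x) \<le> norm (B * (indicator K x * g x))"
        by (simp add: abs_mult mult.commute)
    qed
  qed
  moreover have "(indicator K x * g x) * f x = g x * f x" for x using f(3)[of x] by (auto simp: indicator_def)
  ultimately show ?thesis by simp
qed

lemma Cc_inf_continuous: "\<phi> \<in> Cc_inf \<Omega> \<Longrightarrow> continuous_on UNIV \<phi>"
  by (auto simp: Cc_inf_def intro: smooth_fun_continuous)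

lemma Cc_inf_partial_continuous: "\<phi> \<in> Cc_inf \<Omega> \<Longrightarrow> i \<in> Basis \<Longrightarrow> continuous_on UNIV (\<lambda>x. frechet_derivative \<phi> (at x) i)"
  by (auto simp: Cc_inf_def intro: smooth_fun_continuous smooth_fun_frechet)

lemma Cc_inf_measurable: "\<phi> \<in> Cc_inf \<Omega> \<Longrightarrow> \<phi> \<in> borel_measurable borel"
  by (rule borel_measurable_continuous_onI) (rule Cc_inf_continuous)

lemma Cc_inf_sqint: "\<phi> \<in> Cc_inf \<Omega> \<Longrightarrow> sqint lborel \<phi>"
proof -
  assume \<phi>: "\<phi> \<in> Cc_inf \<Omega>"
  obtain K where "compact K" "\<And>x. x \<notin> K \<Longrightarrow> \<phi> x = 0" by (rule Cc_inf_support[OF \<phi>]) blast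
  then show ?thesis by (rule continuous_compact_support_sqint(1)[OF Cc_inf_continuous[OF \<phi>]])
qed

lemma Cc_inf_partial_sqint:
  assumes "\<phi> \<in> Cc_inf \<Omega>" "i \<in> Basis" shows "sqint lborel (\<lambda>x. frechet_derivative \<phi> (at x) i)"
proof -
  obtain K where "compact K" "\<And>x. x \<notin> K \<Longrightarrow> frechet_derivative \<phi> (at x) i = 0"
    by (rule Cc_inf_support[OF assms(1)]) blast
  then show ?thesis by (rule continuous_compact_support_sqint(1)[OF Cc_inf_partial_continuous[OF assms]])
qed

lemma locally_integrable_mult_Cc_inf:
  assumes "\<And>K. compact K \<Longrightarrow> set_integrable lborel K g" "\<phi> \<in> Cc_inf \<Omega>"
  shows "integrable lborel (\<lambda>x. g x * \<phi> x)"
    and "i \<in> Basis \<Longrightarrow> integrable lborel (\<lambda>x. g x * frechet_derivative \<phi> (at x) i)"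
proof -
  obtain K where K: "compact K" "\<And>x. x \<notin> K \<Longrightarrow> \<phi> x = 0" "\<And>x b. x \<notin> K \<Longrightarrow> frechet_derivative \<phi> (at x) b = 0"
    by (rule Cc_inf_support[OF assms(2)]) blast
  show "integrable lborel (\<lambda>x. g x * \<phi> x)"
    by (rule locally_integrable_mult[OF assms(1) Cc_inf_continuous[OF assms(2)] K(1,2)])
  show "integrable lborel (\<lambda>x. g x * frechet_derivative \<phi> (at x) i)" if "i \<in> Basis"
    by (rule locally_integrable_mult[OF assms(1) Cc_inf_partial_continuous[OF assms(2) that] K(1,3)])
qed

section \<open>Uniqueness, linearity and closedness of weak gradients\<close>

lemma has_weak_grad_local:
  assumes "has_weak_grad u G" "compact K"
  shows "set_integrable lborel K u" and "i \<in> Basis \<Longrightarrow> set_integrable lborel K (\<lambda>x. G x \<bullet> i)"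
  using assms by (auto simp: has_weak_grad_def)

lemma has_weak_grad_parts:
  assumes "has_weak_grad u G" "\<phi> \<in> Cc_inf UNIV" "i \<in> Basis"
  shows "(\<integral>x. u x * frechet_derivative \<phi> (at x) i \<partial>lborel) = - (\<integral>x. (G x \<bullet> i) * \<phi> x \<partial>lborel)"
  using assms by (auto simp: has_weak_grad_def)

text \<open>The function is the pointwise limit of its restrictions to growing balls, each of which
  is measurable by integrability. Measurability of weak gradients comes from here.\<close>

lemma locally_integrable_measurable:
  fixes g :: "'a::euclidean_space \<Rightarrow> real"
  assumes "\<And>K. compact K \<Longrightarrow> set_integrable lborel K g" shows "g \<in> borel_measurable borel"
proof -
  have m: "(\<lambda>x. indicator (cball 0 (real n)) x * g x) \<in> borel_measurable borel" for n
    using assms[of "cball 0 (real n)"] by (auto simp: set_integrable_def)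
  show ?thesis
  proof (rule borel_measurable_LIMSEQ_real[OF _ m])
    fix x :: 'a
    obtain N :: nat where N: "norm x \<le> real N" using real_arch_simple by blast
    show "(\<lambda>n. indicator (cball 0 (real n)) x * g x) \<longlonglongrightarrow> g x"
    proof (rule tendsto_eventually, rule eventually_mono[OF eventually_ge_at_top[of N]])
      fix n assume "N \<le> n"
      then have "norm x \<le> real n" using N by linarith
      then show "indicator (cball 0 (real n)) x * g x = g x" by simp
    qed
  qed
qed

lemma has_weak_grad_measurable: "has_weak_grad u G \<Longrightarrow> G \<in> borel_measurable borel"
  by (subst borel_measurable_euclidean_space) (auto intro!: locally_integrable_measurable has_weak_grad_local(2))

text \<open>Uniqueness makes the arbitrary choice in \<open>weak_grad\<close> harmless: the seminorm
  of order 1 may be computed from any weak gradient at hand.\<close>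

lemma has_weak_grad_unique:
  assumes "has_weak_grad u G" "has_weak_grad u H" shows "AE x in lborel. G x = H x"
proof -
  have "AE x in lborel. G x \<bullet> i - H x \<bullet> i = 0" if i: "i \<in> Basis" for i
  proof (rule fundamental_lemma)
    show "set_integrable lborel K (\<lambda>x. G x \<bullet> i - H x \<bullet> i)" if "compact K" for K
      by (rule set_integral_diff(1)[OF has_weak_grad_local(2)[OF assms(1) that i] has_weak_grad_local(2)[OF assms(2) that i]])
    fix \<phi> :: "'a \<Rightarrow> real" assume \<phi>: "\<phi> \<in> Cc_inf UNIV"
    have "integrable lborel (\<lambda>x. (G x \<bullet> i) * \<phi> x)" "integrable lborel (\<lambda>x. (H x \<bullet> i) * \<phi> x)"
      by (rule locally_integrable_mult_Cc_inf(1)[OF has_weak_grad_local(2)[OF assms(1) _ i] \<phi>] 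
        locally_integrable_mult_Cc_inf(1)[OF has_weak_grad_local(2)[OF assms(2) _ i] \<phi>]; assumption)+
    then show "(\<integral>x. (G x \<bullet> i - H x \<bullet> i) * \<phi> x \<partial>lborel) = 0"
      using has_weak_grad_parts[OF assms(1) \<phi> i] has_weak_grad_parts[OF assms(2) \<phi> i]
      by (simp add: left_diff_distrib)
  qed
  then have "AE x in lborel. \<forall>i\<in>Basis. G x \<bullet> i - H x \<bullet> i = 0" by (intro AE_finite_allI) auto
  then show ?thesis by eventually_elim (auto intro: euclidean_eqI)
qed

lemma has_weak_grad_add_scaled:
  assumes "has_weak_grad u G" "has_weak_grad v H"
  shows "has_weak_grad (\<lambda>x. u x + t * v x) (\<lambda>x. G x + t *\<^sub>R H x)"
  unfolding has_weak_grad_def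
proof (intro conjI allI impI ballI)
  fix K :: "'a set" assume K: "compact K"
  show "set_integrable lborel K (\<lambda>x. u x + t * v x)"
    by (intro set_integral_add(1) set_integrable_mult_right has_weak_grad_local(1)[OF assms(1) K] has_weak_grad_local(1)[OF assms(2) K])
  fix i :: 'a assume i: "i \<in> Basis"
  show "set_integrable lborel K (\<lambda>x. (G x + t *\<^sub>R H x) \<bullet> i)" unfolding inner_simps
    by (intro set_integral_add(1) set_integrable_mult_right has_weak_grad_local(2)[OF assms(1) K i] has_weak_grad_local(2)[OF assms(2) K i])
next
  fix \<phi> :: "'a \<Rightarrow> real" and i :: 'a assume \<phi>: "\<phi> \<in> Cc_inf UNIV" and i: "i \<in> Basis"
  have [simp]: "integrable lborel (\<lambda>x. (G x \<bullet> i) * \<phi> x)" "integrable lborel (\<lambda>x. (H x \<bullet> i) * \<phi> x)"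
    by (rule locally_integrable_mult_Cc_inf(1)[OF has_weak_grad_local(2)[OF assms(1) _ i] \<phi>] 
        locally_integrable_mult_Cc_inf(1)[OF has_weak_grad_local(2)[OF assms(2) _ i] \<phi>]; assumption)+
  have [simp]: "integrable lborel (\<lambda>x. u x * frechet_derivative \<phi> (at x) i)" "integrable lborel (\<lambda>x. v x * frechet_derivative \<phi> (at x) i)"
    by (rule locally_integrable_mult_Cc_inf(2)[OF has_weak_grad_local(1)[OF assms(1)] \<phi> i] 
        locally_integrable_mult_Cc_inf(2)[OF has_weak_grad_local(1)[OF assms(2)] \<phi> i]; assumption)+
  show "(\<integral>x. (u x + t * v x) * frechet_derivative \<phi> (at x) i \<partial>lborel) = - (\<integral>x. ((G x + t *\<^sub>R H x) \<bullet> i) * \<phi> x \<partial>lborel)"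
    using has_weak_grad_parts[OF assms(1) \<phi> i] has_weak_grad_parts[OF assms(2) \<phi> i]
    by (simp add: inner_simps distrib_right mult.assoc)
qed

lemma weak_grad_works: "has_weak_grad u G \<Longrightarrow> has_weak_grad u (weak_grad u)"
  unfolding weak_grad_def by (rule someI[of "has_weak_grad u"])

lemma weak_grad_AE: "has_weak_grad u G \<Longrightarrow> AE x in lborel. weak_grad u x = G x"
  using has_weak_grad_unique[OF weak_grad_works] by blast

lemma seminorm_sq_1: "has_weak_grad u G \<Longrightarrow> seminorm_sq 1 u = (\<integral>\<^sup>+x. ennreal ((norm (G x))\<^sup>2) \<partial>lborel)"
proof -
  assume G: "has_weak_grad u G"
  have "(\<integral>\<^sup>+x. ennreal ((norm (weak_grad u x))\<^sup>2) \<partial>lborel) = (\<integral>\<^sup>+x. ennreal ((norm (G x))\<^sup>2) \<partial>lborel)"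
    by (rule nn_integral_cong_AE) (use weak_grad_AE[OF G] in eventually_elim, simp)
  then show ?thesis using G by (auto simp: seminorm_sq_def)
qed

lemma seminorm_sq_1_finite:
  assumes "seminorm_sq 1 u < \<infinity>" obtains G where "has_weak_grad u G" "sqint lborel G"
proof -
  obtain G where G: "has_weak_grad u G"
    using assms by (auto simp: seminorm_sq_def split: if_splits)
  have "sqint lborel G"
    using has_weak_grad_measurable[OF G] assms unfolding seminorm_sq_1[OF G] by (subst sqint_iff_nn) auto
  with G show thesis by (rule that)
qed

text \<open>Both sides of the integration by parts are L2 inner products with a fixed test function
  or its derivative, hence continuous under L2 convergence. Gradients are compared componentwise to
  match \<open>L2_complete\<close>, which is about real functions.\<close>

lemma has_weak_grad_closed:
  assumes W: "\<And>n. has_weak_grad (u n) (G n)" "\<And>n. sqint lborel (u n)" "\<And>n. sqint lborel (G n)"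
    and L: "sqint lborel v" "sqint lborel H"
    and C: "(\<lambda>n. \<integral>\<^sup>+x. ennreal ((u n x - v x)\<^sup>2) \<partial>lborel) \<longlonglongrightarrow> 0"
      "\<And>i. i \<in> Basis \<Longrightarrow> (\<lambda>n. \<integral>\<^sup>+x. ennreal ((G n x \<bullet> i - H x \<bullet> i)\<^sup>2) \<partial>lborel) \<longlonglongrightarrow> 0"
  shows "has_weak_grad v H"
  unfolding has_weak_grad_def
proof (intro conjI allI impI ballI)
  fix K :: "'a set" assume K: "compact K"
  show "set_integrable lborel K v" by (rule sqint_set_integrable[OF L(1) K])
  show "set_integrable lborel K (\<lambda>x. H x \<bullet> i)" if "i \<in> Basis" for i
    by (rule sqint_set_integrable[OF sqint_component[OF L(2) that] K])
next
  fix \<phi> :: "'a \<Rightarrow> real" and i :: 'a assume \<phi>: "\<phi> \<in> Cc_inf UNIV" and i: "i \<in> Basis"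
  have "(\<lambda>n. \<integral>x. u n x * frechet_derivative \<phi> (at x) i \<partial>lborel) \<longlonglongrightarrow> (\<integral>x. v x * frechet_derivative \<phi> (at x) i \<partial>lborel)"
    by (rule sqint_inner_tendsto[OF W(2) L(1) Cc_inf_partial_sqint[OF \<phi> i] C(1)])
  moreover have "(\<lambda>n. \<integral>x. (G n x \<bullet> i) * \<phi> x \<partial>lborel) \<longlonglongrightarrow> (\<integral>x. (H x \<bullet> i) * \<phi> x \<partial>lborel)"
    by (rule sqint_inner_tendsto[OF sqint_component[OF W(3) i] sqint_component[OF L(2) i] Cc_inf_sqint[OF \<phi>] C(2)[OF i]])
  then have "(\<lambda>n. - (\<integral>x. (G n x \<bullet> i) * \<phi> x \<partial>lborel)) \<longlonglongrightarrow> - (\<integral>x. (H x \<bullet> i) * \<phi> x \<partial>lborel)" by (rule tendsto_minus)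
  ultimately show "(\<integral>x. v x * frechet_derivative \<phi> (at x) i \<partial>lborel) = - (\<integral>x. (H x \<bullet> i) * \<phi> x \<partial>lborel)"
    unfolding has_weak_grad_parts[OF W(1) \<phi> i] by (rule LIMSEQ_unique)
qed

section \<open>Translates of functions with a weak gradient\<close>

lemma frechet_derivative_directional:
  fixes f :: "'a::euclidean_space \<Rightarrow> real"
  assumes "f differentiable (at x)"
  shows "frechet_derivative f (at x) h = (\<Sum>i\<in>Basis. (h \<bullet> i) * frechet_derivative f (at x) i)"
proof -
  have l: "linear (frechet_derivative f (at x))" by (rule linear_frechet_derivative[OF assms])
  have "frechet_derivative f (at x) (\<Sum>i\<in>Basis. (h \<bullet> i) *\<^sub>R i) = (\<Sum>i\<in>Basis. (h \<bullet> i) * frechet_derivative f (at x) i)"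
    by (simp add: linear_sum[OF l] linear_scale[OF l])
  then show ?thesis by (simp add: euclidean_representation)
qed

lemma Cc_inf_smooth: "\<phi> \<in> Cc_inf \<Omega> \<Longrightarrow> smooth_fun \<phi>"
  by (simp add: Cc_inf_def)

lemmas Cc_inf_directional = frechet_derivative_directional[OF smooth_fun_differentiable[OF Cc_inf_smooth]]

lemma Cc_inf_directional_continuous: "\<phi> \<in> Cc_inf \<Omega> \<Longrightarrow> continuous_on UNIV (\<lambda>x. frechet_derivative \<phi> (at x) h)"
  unfolding Cc_inf_directional[of _ _ _ h] by (intro continuous_intros Cc_inf_partial_continuous)

lemma Cc_inf_directional_sqint:
  assumes "\<phi> \<in> Cc_inf \<Omega>" shows "sqint lborel (\<lambda>x. frechet_derivative \<phi> (at x) h)"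
proof -
  obtain K where "compact K" "\<And>x. x \<notin> K \<Longrightarrow> frechet_derivative \<phi> (at x) h = 0"
    by (rule Cc_inf_support[OF assms(1)]) blast
  then show ?thesis by (rule continuous_compact_support_sqint(1)[OF Cc_inf_directional_continuous[OF assms]])
qed

lemma const_set_integrable_compact: "compact K \<Longrightarrow> set_integrable lborel K (\<lambda>x::'a::euclidean_space. 1::real)"
  using emeasure_compact_finite[of K] compact_imp_closed[of K] by (simp add: set_integrable_def)

lemma Cc_inf_integrable: "\<phi> \<in> Cc_inf \<Omega> \<Longrightarrow> integrable lborel \<phi>"
  using locally_integrable_mult_Cc_inf(1)[OF const_set_integrable_compact] by simp

lemma Cc_inf_directional_integrable: "\<phi> \<in> Cc_inf \<Omega> \<Longrightarrow> integrable lborel (\<lambda>x. frechet_derivative \<phi> (at x) h)"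
proof -
  assume \<phi>: "\<phi> \<in> Cc_inf \<Omega>"
  have "integrable lborel (\<lambda>x. frechet_derivative \<phi> (at x) i)" if "i \<in> Basis" for i
    using locally_integrable_mult_Cc_inf(2)[OF const_set_integrable_compact \<phi> that] by simp
  then show ?thesis unfolding Cc_inf_directional[OF \<phi>, of _ h] by simp
qed

lemma Cc_inf_FTC:
  assumes "\<phi> \<in> Cc_inf \<Omega>"
  shows "(\<integral>t. indicator {0..1} t * frechet_derivative \<phi> (at (x + t *\<^sub>R h)) h \<partial>lborel) = \<phi> (x + h) - \<phi> x"
proof -
  have "(\<integral>t. frechet_derivative \<phi> (at (x + t *\<^sub>R h)) h * indicator {0..1} t \<partial>lborel) = \<phi> (x + 1 *\<^sub>R h) - \<phi> (x + 0 *\<^sub>R h)"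
  proof (rule integral_FTC_Icc_real)
    fix t :: real
    have d: "((\<lambda>t. x + t *\<^sub>R h) has_derivative (\<lambda>s. s *\<^sub>R h)) (at t)" by (auto intro!: derivative_eq_intros)
    note hd = smooth_fun_has_derivative[OF Cc_inf_smooth[OF assms]]
    have l: "linear (frechet_derivative \<phi> (at (x + t *\<^sub>R h)))"
      by (rule linear_frechet_derivative[OF smooth_fun_differentiable[OF Cc_inf_smooth[OF assms]]])
    from diff_chain_at[OF d hd]
    have "((\<lambda>t. \<phi> (x + t *\<^sub>R h)) has_derivative (\<lambda>s. s * frechet_derivative \<phi> (at (x + t *\<^sub>R h)) h)) (at t)"
      by (simp add: o_def linear_scale[OF l])
    then show "((\<lambda>t. \<phi> (x + t *\<^sub>R h)) has_real_derivative frechet_derivative \<phi> (at (x + t *\<^sub>R h)) h) (at t)"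
      unfolding has_field_derivative_def mult_commute_abs .
    have "isCont (\<lambda>y. frechet_derivative \<phi> (at y) h) (x + t *\<^sub>R h)"
      using Cc_inf_directional_continuous[OF assms] by (simp add: continuous_on_eq_continuous_at)
    then show "isCont (\<lambda>t. frechet_derivative \<phi> (at (x + t *\<^sub>R h)) h) t"
      by (rule isCont_o2[where f="\<lambda>t. x + t *\<^sub>R h" and g="\<lambda>y. frechet_derivative \<phi> (at y) h", rotated]) simp
  qed simp
  then show ?thesis by (simp add: mult.commute)
qed

lemma measurable_fst_lborel [measurable]: "fst \<in> borel_measurable (lborel \<Otimes>\<^sub>M N)"
  and measurable_snd_lborel [measurable]: "snd \<in> borel_measurable (N \<Otimes>\<^sub>M lborel)"
  using measurable_fst[of lborel N] measurable_snd[of N lborel] by simp_all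

lemma shift_product_integrable:
  fixes f :: "'a::euclidean_space \<Rightarrow> real"
  assumes f: "integrable lborel f"
  shows "integrable (lborel \<Otimes>\<^sub>M lborel) (\<lambda>p. indicator {0..1} (fst p) * f (snd p + fst p *\<^sub>R h))"
proof (rule lborel_pair.Fubini_integrable)
  have [measurable]: "f \<in> borel_measurable borel" using f by auto
  show "(\<lambda>p. indicator {0..1} (fst p) * f (snd p + fst p *\<^sub>R h)) \<in> borel_measurable (lborel \<Otimes>\<^sub>M lborel)"
    by measurable
  have "(\<integral>y. norm (indicator {0..1} t * f (y + t *\<^sub>R h)) \<partial>lborel) = indicator {0..1} t * (\<integral>y. \<bar>f y\<bar> \<partial>lborel)" for t :: real
    using integral_shift[of "\<lambda>x. \<bar>f x\<bar>" "t *\<^sub>R h"] by (simp add: abs_mult)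
  then show "integrable lborel (\<lambda>x. \<integral>y. norm (indicator {0..1} (fst (x, y)) * f (snd (x, y) + fst (x, y) *\<^sub>R h)) \<partial>lborel)"
    by simp
  show "AE x in lborel. integrable lborel (\<lambda>y. indicator {0..1} (fst (x, y)) * f (snd (x, y) + fst (x, y) *\<^sub>R h))"
    using integrable_shift[OF f] by simp
qed

lemma sqint_shift_product:
  fixes f :: "'a::euclidean_space \<Rightarrow> 'b::euclidean_space"
  assumes f: "sqint lborel f"
  shows "sqint (lborel \<Otimes>\<^sub>M lborel) (\<lambda>p. indicator {0..1} (fst p) *\<^sub>R f (snd p + fst p *\<^sub>R h))"
proof -
  have [measurable]: "f \<in> borel_measurable borel" using f by (simp add: sqint_def)
  have "(norm (indicator {0..1} t *\<^sub>R f y))\<^sup>2 = indicator {0..1} t * (norm (f y))\<^sup>2" for t :: real and y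
    by (simp add: indicator_def)
  then show ?thesis
    using shift_product_integrable[OF sqint_integrable[OF f]] by (simp add: sqint_def)
qed

lemma shift_product_Fubini:
  fixes f g :: "'a::euclidean_space \<Rightarrow> real"
  assumes f: "sqint lborel f" and g: "sqint lborel g"
  shows "integrable (lborel \<Otimes>\<^sub>M lborel) (\<lambda>(t,x). indicator {0..1} t * (f (x + t *\<^sub>R h) * g x))"
    and "(\<integral>x. \<integral>t. indicator {0..1} t * (f (x + t *\<^sub>R h) * g x) \<partial>lborel \<partial>lborel)
      = (\<integral>t. indicator {0..1} t * (\<integral>x. f (x + t *\<^sub>R h) * g x \<partial>lborel) \<partial>lborel)"
proof -
  \<comment> \<open>Giving \<open>g\<close> the shift 0 presents the integrand as a product of two
    square integrable functions on the product space, which makes it integrable.\<close>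
  have "integrable (lborel \<Otimes>\<^sub>M lborel) (\<lambda>p. (indicator {0..1} (fst p) *\<^sub>R f (snd p + fst p *\<^sub>R h))
      \<bullet> (indicator {0..1} (fst p) *\<^sub>R g (snd p + fst p *\<^sub>R 0)))"
    by (intro sqint_inner_integrable sqint_shift_product f g)
  moreover have "(\<lambda>p. (indicator {0..1} (fst p) *\<^sub>R f (snd p + fst p *\<^sub>R h))
      \<bullet> (indicator {0..1} (fst p) *\<^sub>R g (snd p + fst p *\<^sub>R 0)))
    = (\<lambda>(t,x). indicator {0..1::real} t * (f (x + t *\<^sub>R h) * g x))"
    by (auto simp: indicator_def)
  ultimately show i: "integrable (lborel \<Otimes>\<^sub>M lborel) (\<lambda>(t,x). indicator {0..1} t * (f (x + t *\<^sub>R h) * g x))"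
    by simp
  show "(\<integral>x. \<integral>t. indicator {0..1} t * (f (x + t *\<^sub>R h) * g x) \<partial>lborel \<partial>lborel)
      = (\<integral>t. indicator {0..1} t * (\<integral>x. f (x + t *\<^sub>R h) * g x \<partial>lborel) \<partial>lborel)"
    using lborel_pair.Fubini_integral[OF i] by simp
qed

text \<open>By translation invariance the integral of phi(x + h) - phi(x) is 0. Writing this
  difference as an integral of the derivative along the segment and exchanging the integrals leaves
  the integral of the derivative itself.\<close>

lemma integral_directional_zero:
  assumes \<phi>: "\<phi> \<in> Cc_inf (UNIV :: 'a::euclidean_space set)"
  shows "(\<integral>x. frechet_derivative \<phi> (at x) h \<partial>lborel) = 0"
proof -
  let ?D = "\<lambda>x. frechet_derivative \<phi> (at x) h"
  have [measurable]: "?D \<in> borel_measurable borel" using Cc_inf_directional_sqint[OF \<phi>] by (simp add: sqint_def)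
  have [measurable]: "\<phi> \<in> borel_measurable borel" using Cc_inf_measurable[OF \<phi>] .
  have i: "integrable (lborel \<Otimes>\<^sub>M lborel) (\<lambda>(t,x). indicator {0..1} t * ?D (x + t *\<^sub>R h))"
    using shift_product_integrable[OF Cc_inf_directional_integrable[OF \<phi>], of h] by (simp add: case_prod_beta')
  have "0 = (\<integral>x. \<phi> (x + h) \<partial>lborel) - (\<integral>x. \<phi> x \<partial>lborel)" by (simp add: integral_shift)
  also have "\<dots> = (\<integral>x. \<phi> (x + h) - \<phi> x \<partial>lborel)"
    by (rule Bochner_Integration.integral_diff[symmetric]) (intro integrable_shift Cc_inf_integrable[OF \<phi>])+
  also have "\<dots> = (\<integral>x. \<integral>t. indicator {0..1} t * ?D (x + t *\<^sub>R h) \<partial>lborel \<partial>lborel)"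
    unfolding Cc_inf_FTC[OF \<phi>] ..
  also have "\<dots> = (\<integral>t. \<integral>x. indicator {0..1} t * ?D (x + t *\<^sub>R h) \<partial>lborel \<partial>lborel)"
    using lborel_pair.Fubini_integral[OF i] .
  also have "\<dots> = (\<integral>t. indicator {0..1::real} t * (\<integral>x. ?D x \<partial>lborel) \<partial>lborel)"
    using integral_shift[of ?D] by simp
  also have "\<dots> = (\<integral>x. ?D x \<partial>lborel)" by simp
  finally show ?thesis by simp
qed

lemma Cc_inf_mult:
  assumes "\<phi> \<in> Cc_inf \<Omega>" "\<psi> \<in> Cc_inf UNIV" shows "(\<lambda>x. \<phi> x * \<psi> x) \<in> Cc_inf UNIV"
proof -
  obtain K where K: "compact K" "\<And>x. x \<notin> K \<Longrightarrow> \<phi> x = 0" by (rule Cc_inf_support[OF assms(1)]) blast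
  show ?thesis
  proof (rule Cc_inf_UNIV_I[OF _ K(1)])
    show "smooth_fun (\<lambda>x. \<phi> x * \<psi> x)"
      by (intro smooth_gen_imp_smooth[OF smooth_gen.mult[OF smooth_gen_smooth smooth_gen_smooth]]
          Cc_inf_smooth[OF assms(1)] Cc_inf_smooth[OF assms(2)])
  qed (simp add: K)
qed

definition grad :: "('a::euclidean_space \<Rightarrow> real) \<Rightarrow> 'a \<Rightarrow> 'a" where
  "grad f x = (\<Sum>i\<in>Basis. frechet_derivative f (at x) i *\<^sub>R i)"

lemma grad_inner: "i \<in> Basis \<Longrightarrow> grad f x \<bullet> i = frechet_derivative f (at x) i"
  by (simp add: grad_def inner_sum_left inner_Basis if_distrib[of "\<lambda>z. _ * z"] cong: if_cong)

text \<open>The derivative of a product of test functions has integral 0, and the product rule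
  splits that integral into the two sides of the integration by parts.\<close>

lemma Cc_inf_has_weak_grad:
  assumes \<phi>: "\<phi> \<in> Cc_inf \<Omega>" shows "has_weak_grad \<phi> (grad \<phi>)"
  unfolding has_weak_grad_def
proof (intro conjI allI impI ballI)
  fix K :: "'a set" assume K: "compact K"
  show "set_integrable lborel K \<phi>" by (rule sqint_set_integrable[OF Cc_inf_sqint[OF \<phi>] K])
  show "set_integrable lborel K (\<lambda>x. grad \<phi> x \<bullet> i)" if "i \<in> Basis" for i
    using sqint_set_integrable[OF Cc_inf_directional_sqint[OF \<phi>] K] that by (simp add: grad_inner)
next
  fix \<psi> :: "'a \<Rightarrow> real" and i :: 'a assume \<psi>: "\<psi> \<in> Cc_inf UNIV" and i: "i \<in> Basis"
  have d: "frechet_derivative (\<lambda>x. \<phi> x * \<psi> x) (at x) = (\<lambda>v. \<phi> x * frechet_derivative \<psi> (at x) v + frechet_derivative \<phi> (at x) v * \<psi> x)" for x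
    by (rule frechet_derivative_at[symmetric], rule has_derivative_mult;
        rule smooth_fun_has_derivative, rule Cc_inf_smooth, rule \<phi> \<psi>)
  have i1: "integrable lborel (\<lambda>x. \<phi> x * frechet_derivative \<psi> (at x) i)"
    using sqint_inner_integrable[OF Cc_inf_sqint[OF \<phi>] Cc_inf_directional_sqint[OF \<psi>]] by simp
  have i2: "integrable lborel (\<lambda>x. frechet_derivative \<phi> (at x) i * \<psi> x)"
    using sqint_inner_integrable[OF Cc_inf_directional_sqint[OF \<phi>] Cc_inf_sqint[OF \<psi>]] by simp
  have "(\<integral>x. frechet_derivative (\<lambda>x. \<phi> x * \<psi> x) (at x) i \<partial>lborel) = 0"
    by (rule integral_directional_zero[OF Cc_inf_mult[OF \<phi> \<psi>]])
  then show "(\<integral>x. \<phi> x * frechet_derivative \<psi> (at x) i \<partial>lborel) = - (\<integral>x. (grad \<phi> x \<bullet> i) * \<psi> x \<partial>lborel)"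
    unfolding d grad_inner[OF i] Bochner_Integration.integral_add[OF i1 i2] by simp
qed

lemma sqint_of_components:
  fixes f :: "'m \<Rightarrow> 'b::euclidean_space"
  assumes "\<And>i. i \<in> Basis \<Longrightarrow> sqint M (\<lambda>x. f x \<bullet> i)" shows "sqint M f"
proof -
  have m: "f \<in> borel_measurable M"
    using assms by (subst borel_measurable_euclidean_space) (auto simp: sqint_def)
  have "(norm (f x))\<^sup>2 = (\<Sum>i\<in>Basis. (norm (f x \<bullet> i))\<^sup>2)" for x
    unfolding power2_norm_eq_inner by (subst euclidean_inner) (simp add: power2_eq_square)
  then have "integrable M (\<lambda>x. (norm (f x))\<^sup>2)"
    using sqint_integrable[OF assms] by simp
  with m show ?thesis by (simp add: sqint_def)
qed

lemma Cc_inf_grad_sqint: "\<phi> \<in> Cc_inf \<Omega> \<Longrightarrow> sqint lborel (grad \<phi>)"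
  by (rule sqint_of_components) (simp add: grad_inner Cc_inf_partial_sqint)

text \<open>The fundamental theorem of calculus for weak gradients, by duality. Tested against
  \<open>\<phi>\<close>, the shift moves onto \<open>\<phi>\<close>, where the classical theorem
  applies; integration by parts for each translate and Fubini then bring the derivative back to
  \<open>u\<close>.\<close>

lemma weak_grad_difference:
  fixes u :: "'a::euclidean_space \<Rightarrow> real"
  assumes W: "has_weak_grad u G" and u: "sqint lborel u" and G: "sqint lborel G"
  shows "AE x in lborel. u (x + h) - u x = (\<integral>t. indicator {0..1} t * (G (x + t *\<^sub>R h) \<bullet> h) \<partial>lborel)"
proof -
  define D where "D x = G x \<bullet> h" for x
  define V where "V x = (\<integral>t. indicator {0..1} t * D (x + t *\<^sub>R h) \<partial>lborel)" for x
  have Dsum: "D x = (\<Sum>i\<in>Basis. (h \<bullet> i) * (G x \<bullet> i))" for x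
    unfolding D_def by (subst euclidean_inner) (simp add: mult.commute)
  have D: "sqint lborel D"
  proof -
    have [measurable]: "G \<in> borel_measurable borel" using G by (simp add: sqint_def)
    have "integrable lborel (\<lambda>x. (norm h)\<^sup>2 * (norm (G x))\<^sup>2)" using sqint_integrable[OF G] by simp
    then have "integrable lborel (\<lambda>x. (norm (D x))\<^sup>2)"
    proof (rule Bochner_Integration.integrable_bound)
      show "AE x in lborel. norm ((norm (D x))\<^sup>2) \<le> norm ((norm h)\<^sup>2 * (norm (G x))\<^sup>2)"
      proof (rule AE_I2)
        fix x
        have "\<bar>D x\<bar> \<le> norm h * norm (G x)" using Cauchy_Schwarz_ineq2[of "G x" h] by (simp add: D_def mult.commute)
        then have "\<bar>D x\<bar>\<^sup>2 \<le> (norm h * norm (G x))\<^sup>2" by (rule power_mono) simp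
        then show "norm ((norm (D x))\<^sup>2) \<le> norm ((norm h)\<^sup>2 * (norm (G x))\<^sup>2)" by (simp add: power_mult_distrib)
      qed
    qed (simp add: D_def[abs_def])
    then show ?thesis by (simp add: sqint_def D_def[abs_def])
  qed
  have [measurable]: "D \<in> borel_measurable borel" "u \<in> borel_measurable borel" using D u by (auto simp: sqint_def)
  have Vint: "integrable lborel (\<lambda>x. V x * g x)" if g: "sqint lborel g" for g :: "'a \<Rightarrow> real"
  proof -
    have "integrable lborel (\<lambda>x. \<integral>t. indicator {0..1} t * (D (x + t *\<^sub>R h) * g x) \<partial>lborel)"
      using lborel_pair.integrable_snd[OF shift_product_Fubini(1)[OF D g, of h]] by simp
    moreover have "(\<integral>t. indicator {0..1} t * (D (x + t *\<^sub>R h) * g x) \<partial>lborel) = V x * g x" for x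
      unfolding V_def by (simp add: mult.assoc[symmetric])
    ultimately show ?thesis by simp
  qed
  have "AE x in lborel. u (x + h) - u x - V x = 0"
  proof (rule fundamental_lemma)
    fix K :: "'a set" assume K: "compact K"
    have "set_integrable lborel K V"
      using Vint[OF sqint_indicator_compact[OF K]] by (simp add: set_integrable_def mult.commute)
    then show "set_integrable lborel K (\<lambda>x. u (x + h) - u x - V x)"
      by (intro set_integral_diff(1) sqint_set_integrable[OF sqint_shift[OF u] K] sqint_set_integrable[OF u K])
  next
    fix \<phi> :: "'a \<Rightarrow> real" assume \<phi>: "\<phi> \<in> Cc_inf UNIV"
    note [measurable] = Cc_inf_measurable[OF \<phi>]
    note s\<phi> = Cc_inf_sqint[OF \<phi>]
    \<comment> \<open>Differentiating in direction \<open>-h\<close> absorbs the minus sign of the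
      integration by parts.\<close>
    have par: "(\<integral>x. u x * frechet_derivative \<psi> (at x) (-h) \<partial>lborel) = (\<integral>x. D x * \<psi> x \<partial>lborel)" if \<psi>: "\<psi> \<in> Cc_inf UNIV" for \<psi>
    proof -
      have iu: "integrable lborel (\<lambda>x. u x * frechet_derivative \<psi> (at x) i)" for i
        using sqint_inner_integrable[OF u Cc_inf_directional_sqint[OF \<psi>]] by simp
      have iG: "integrable lborel (\<lambda>x. (G x \<bullet> i) * \<psi> x)" if "i \<in> Basis" for i
        using sqint_inner_integrable[OF sqint_component[OF G that] Cc_inf_sqint[OF \<psi>]] by simp
      have "(\<integral>x. u x * frechet_derivative \<psi> (at x) (-h) \<partial>lborel)
         = (\<integral>x. (\<Sum>i\<in>Basis. (-h \<bullet> i) * (u x * frechet_derivative \<psi> (at x) i)) \<partial>lborel)"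
        unfolding Cc_inf_directional[OF \<psi>, of _ "-h"] sum_distrib_left
        by (rule arg_cong[where f="integral\<^sup>L lborel"], rule ext, rule sum.cong) simp_all
      also have "\<dots> = (\<Sum>i\<in>Basis. (-h \<bullet> i) * (\<integral>x. u x * frechet_derivative \<psi> (at x) i \<partial>lborel))"
        using iu by (subst Bochner_Integration.integral_sum) simp_all
      also have "\<dots> = (\<Sum>i\<in>Basis. (h \<bullet> i) * (\<integral>x. (G x \<bullet> i) * \<psi> x \<partial>lborel))"
        by (rule sum.cong) (simp_all add: has_weak_grad_parts[OF W \<psi>])
      also have "\<dots> = (\<integral>x. (\<Sum>i\<in>Basis. (h \<bullet> i) * ((G x \<bullet> i) * \<psi> x)) \<partial>lborel)"
        using iG by (subst Bochner_Integration.integral_sum) simp_all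
      also have "\<dots> = (\<integral>x. D x * \<psi> x \<partial>lborel)"
        unfolding Dsum sum_distrib_right by (simp add: mult.assoc)
      finally show ?thesis .
    qed
    have "(\<integral>x. u (x + h) * \<phi> x \<partial>lborel) = (\<integral>x. u x * \<phi> (x - h) \<partial>lborel)"
      using integral_shift[of "\<lambda>x. u x * \<phi> (x - h)" h] by simp
    then have "(\<integral>x. u (x + h) * \<phi> x \<partial>lborel) - (\<integral>x. u x * \<phi> x \<partial>lborel)
       = (\<integral>x. u x * \<phi> (x - h) \<partial>lborel) - (\<integral>x. u x * \<phi> x \<partial>lborel)" by simp
    also have "\<dots> = (\<integral>x. u x * \<phi> (x - h) - u x * \<phi> x \<partial>lborel)"
    proof (rule Bochner_Integration.integral_diff[symmetric])
      show "integrable lborel (\<lambda>x. u x * \<phi> (x - h))"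
        using sqint_inner_integrable[OF u sqint_shift[OF s\<phi>, of "-h"]] by simp
      show "integrable lborel (\<lambda>x. u x * \<phi> x)" using sqint_inner_integrable[OF u s\<phi>] by simp
    qed
    also have "\<dots> = (\<integral>x. \<integral>t. indicator {0..1} t * (frechet_derivative \<phi> (at (x + t *\<^sub>R (-h))) (-h) * u x) \<partial>lborel \<partial>lborel)"
    proof (rule Bochner_Integration.integral_cong[OF refl])
      fix x
      have "u x * \<phi> (x - h) - u x * \<phi> x = (\<phi> (x + (-h)) - \<phi> x) * u x" by (simp add: algebra_simps)
      also have "\<dots> = (\<integral>t. (indicator {0..1} t * frechet_derivative \<phi> (at (x + t *\<^sub>R (-h))) (-h)) * u x \<partial>lborel)"
        unfolding Cc_inf_FTC[OF \<phi>, symmetric] by (rule integral_mult_left_zero[symmetric])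
      finally show "u x * \<phi> (x - h) - u x * \<phi> x
        = (\<integral>t. indicator {0..1} t * (frechet_derivative \<phi> (at (x + t *\<^sub>R (-h))) (-h) * u x) \<partial>lborel)"
        by (simp add: mult.assoc)
    qed
    also have "\<dots> = (\<integral>t. indicator {0..1} t * (\<integral>x. frechet_derivative \<phi> (at (x + t *\<^sub>R (-h))) (-h) * u x \<partial>lborel) \<partial>lborel)"
      by (rule shift_product_Fubini(2)[OF Cc_inf_directional_sqint[OF \<phi>] u])
    also have "\<dots> = (\<integral>t. indicator {0..1} t * (\<integral>x. D (x + t *\<^sub>R h) * \<phi> x \<partial>lborel) \<partial>lborel)"
    proof (rule Bochner_Integration.integral_cong[OF refl])
      fix t :: real
      have "(\<integral>x. frechet_derivative \<phi> (at (x + t *\<^sub>R (-h))) (-h) * u x \<partial>lborel)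
        = (\<integral>x. u x * frechet_derivative (\<lambda>x. \<phi> (x - t *\<^sub>R h)) (at x) (-h) \<partial>lborel)"
        unfolding frechet_translate[OF Cc_inf_smooth[OF \<phi>]] by (simp add: mult.commute)
      also have "\<dots> = (\<integral>x. D x * \<phi> (x - t *\<^sub>R h) \<partial>lborel)" by (rule par[OF Cc_inf_translate[OF \<phi>]])
      also have "\<dots> = (\<integral>x. D (x + t *\<^sub>R h) * \<phi> x \<partial>lborel)"
        using integral_shift[of "\<lambda>x. D x * \<phi> (x - t *\<^sub>R h)" "t *\<^sub>R h"] by simp
      finally show "indicator {0..1} t * (\<integral>x. frechet_derivative \<phi> (at (x + t *\<^sub>R (-h))) (-h) * u x \<partial>lborel)
        = indicator {0..1} t * (\<integral>x. D (x + t *\<^sub>R h) * \<phi> x \<partial>lborel)" by simp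
    qed
    also have "\<dots> = (\<integral>x. \<integral>t. indicator {0..1} t * (D (x + t *\<^sub>R h) * \<phi> x) \<partial>lborel \<partial>lborel)"
      by (rule shift_product_Fubini(2)[OF D s\<phi>, symmetric])
    also have "\<dots> = (\<integral>x. V x * \<phi> x \<partial>lborel)"
      unfolding V_def by (simp add: mult.assoc[symmetric])
    finally show "(\<integral>x. (u (x + h) - u x - V x) * \<phi> x \<partial>lborel) = 0"
      using Vint[OF s\<phi>] sqint_inner_integrable[OF u s\<phi>] sqint_inner_integrable[OF sqint_shift[OF u] s\<phi>, of h]
      by (simp add: left_diff_distrib)
  qed
  then show ?thesis unfolding V_def D_def by eventually_elim simp
qed

text \<open>Cauchy-Schwarz against the constant 1 on an interval of length 1; only the case of a
  finite right-hand side needs an argument.\<close>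

lemma square_integral_01_le:
  fixes f :: "real \<Rightarrow> real"
  assumes f [measurable]: "f \<in> borel_measurable borel"
  shows "ennreal ((\<integral>t. indicator {0..1} t * f t \<partial>lborel)\<^sup>2) \<le> (\<integral>\<^sup>+t. indicator {0..1} t * ennreal ((f t)\<^sup>2) \<partial>lborel)"
proof (cases "(\<integral>\<^sup>+t. indicator {0..1} t * ennreal ((f t)\<^sup>2) \<partial>lborel) = \<infinity>")
  case False
  define I where "I = indicat_real {0..1::real}"
  define g where "g t = I t * f t" for t
  have [measurable]: "g \<in> borel_measurable lborel" unfolding g_def I_def by simp
  have e: "ennreal ((norm (g t))\<^sup>2) = indicator {0..1} t * ennreal ((f t)\<^sup>2)" for t
    by (simp add: g_def I_def indicator_def)
  have "(\<integral>\<^sup>+t. ennreal ((norm (g t))\<^sup>2) \<partial>lborel) < \<infinity>"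
    unfolding e infinity_ennreal_def using False[unfolded infinity_ennreal_def less_top] .
  then have s: "sqint lborel g" using sqint_iff_nn[of g lborel] by simp
  have i: "sqint lborel I" unfolding I_def by (rule sqint_indicator_compact[OF compact_Icc])
  have II: "(norm (I t))\<^sup>2 = I t" and gI: "g t \<bullet> I t = g t" for t
    by (simp_all add: I_def g_def indicator_def)
  have "integral\<^sup>L lborel I = 1" unfolding I_def by simp
  then have "(\<integral>t. g t \<partial>lborel)\<^sup>2 \<le> (\<integral>t. (norm (g t))\<^sup>2 \<partial>lborel)"
    using sqint_Cauchy_Schwarz[OF s i] unfolding II gI by simp
  then have "ennreal ((\<integral>t. g t \<partial>lborel)\<^sup>2) \<le> ennreal (\<integral>t. (norm (g t))\<^sup>2 \<partial>lborel)" by (rule ennreal_leI)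
  also have "\<dots> = (\<integral>\<^sup>+t. ennreal ((norm (g t))\<^sup>2) \<partial>lborel)" by (rule sqint_nn_eq[OF s, symmetric])
  finally show ?thesis unfolding e unfolding g_def I_def .
qed simp

text \<open>Serves twice: it tames the singular kernel near the origin, and with a shift that moves
  the domain off itself it becomes a Poincare inequality.\<close>

lemma difference_norm_le_weak_grad:
  fixes u :: "'a::euclidean_space \<Rightarrow> real"
  assumes W: "has_weak_grad u G" and u: "sqint lborel u" and G: "sqint lborel G"
  shows "(\<integral>\<^sup>+x. ennreal ((u (x + h) - u x)\<^sup>2) \<partial>lborel) \<le> ennreal ((norm h)\<^sup>2) * (\<integral>\<^sup>+x. ennreal ((norm (G x))\<^sup>2) \<partial>lborel)"
proof -
  have [measurable]: "G \<in> borel_measurable borel" using G by (simp add: sqint_def)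
  have "(\<integral>\<^sup>+x. ennreal ((u (x + h) - u x)\<^sup>2) \<partial>lborel)
     = (\<integral>\<^sup>+x. ennreal ((\<integral>t. indicator {0..1} t * (G (x + t *\<^sub>R h) \<bullet> h) \<partial>lborel)\<^sup>2) \<partial>lborel)"
    by (rule nn_integral_cong_AE) (use weak_grad_difference[OF W u G, of h] in eventually_elim, simp)
  also have "\<dots> \<le> (\<integral>\<^sup>+x. \<integral>\<^sup>+t. indicator {0..1} t * ennreal ((G (x + t *\<^sub>R h) \<bullet> h)\<^sup>2) \<partial>lborel \<partial>lborel)"
    by (intro nn_integral_mono square_integral_01_le) measurable
  also have "\<dots> \<le> (\<integral>\<^sup>+x. \<integral>\<^sup>+t. indicator {0..1} t * (ennreal ((norm h)\<^sup>2) * ennreal ((norm (G (x + t *\<^sub>R h)))\<^sup>2)) \<partial>lborel \<partial>lborel)"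
  proof (intro nn_integral_mono mult_left_mono)
    fix x and t :: real
    have "\<bar>G (x + t *\<^sub>R h) \<bullet> h\<bar>\<^sup>2 \<le> (norm (G (x + t *\<^sub>R h)) * norm h)\<^sup>2"
      using Cauchy_Schwarz_ineq2 by (rule power_mono) simp
    then show "ennreal ((G (x + t *\<^sub>R h) \<bullet> h)\<^sup>2) \<le> ennreal ((norm h)\<^sup>2) * ennreal ((norm (G (x + t *\<^sub>R h)))\<^sup>2)"
      by (simp add: ennreal_mult[symmetric] power_mult_distrib mult.commute ennreal_leI)
  qed simp
  also have "\<dots> = (\<integral>\<^sup>+t. \<integral>\<^sup>+x. indicator {0..1} t * (ennreal ((norm h)\<^sup>2) * ennreal ((norm (G (x + t *\<^sub>R h)))\<^sup>2)) \<partial>lborel \<partial>lborel)"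
    by (rule lborel_pair.Fubini') measurable
  also have "\<dots> = (\<integral>\<^sup>+t. indicator {0..1::real} t * (ennreal ((norm h)\<^sup>2) * (\<integral>\<^sup>+x. ennreal ((norm (G x))\<^sup>2) \<partial>lborel)) \<partial>lborel)"
    using nn_integral_shift[of "\<lambda>x. ennreal ((norm (G x))\<^sup>2)"] by (simp add: nn_integral_cmult)
  also have "\<dots> = ennreal ((norm h)\<^sup>2) * (\<integral>\<^sup>+x. ennreal ((norm (G x))\<^sup>2) \<partial>lborel)"
    by (simp add: nn_integral_multc)
  finally show ?thesis .
qed

section \<open>The fractional seminorms\<close>

definition sphere_area :: "nat \<Rightarrow> real" where
  "sphere_area N = real N * unit_ball_vol (real N)"

text \<open>The part of \<open>c_const\<close> left after removing the factors s and 1 - s. It stays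
  continuous and positive up to both endpoints, so the degeneration of \<open>c_const\<close> at 0
  and 1 becomes explicit.\<close>

definition gam_const :: "nat \<Rightarrow> real \<Rightarrow> real" where
  "gam_const N s = 2 powr (2 * s - 1) * Gamma ((real N + 2 * s) / 2) / (pi powr (real N / 2) * Gamma (2 - s))"

lemma c_const_eq: "c_const N s = gam_const N s * s * (1 - s)"
  by (simp add: c_const_def gam_const_def)

lemma gam_const_pos: assumes "N > 0" "0 \<le> s" "s \<le> 1" shows "gam_const N s > 0"
  using assms unfolding gam_const_def by (intro divide_pos_pos mult_pos_pos Gamma_real_pos) auto

lemma gam_const_continuous: assumes "N > 0" shows "continuous_on {0..1} (gam_const N)"
proof (rule continuous_at_imp_continuous_on, rule ballI)
  fix s :: real assume s: "s \<in> {0..1}"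
  have 1: "(real N + 2 * s) / 2 \<notin> \<int>\<^sub>\<le>\<^sub>0"
  proof
    assume "(real N + 2 * s) / 2 \<in> \<int>\<^sub>\<le>\<^sub>0"
    then have "(real N + 2 * s) / 2 \<le> 0" by (rule nonpos_Ints_nonpos)
    then show False using assms s by simp
  qed
  have 2: "2 - s \<notin> \<int>\<^sub>\<le>\<^sub>0"
  proof
    assume "2 - s \<in> \<int>\<^sub>\<le>\<^sub>0"
    then have "2 - s \<le> 0" by (rule nonpos_Ints_nonpos)
    then show False using s by simp
  qed
  have "0 < 2 - s" using s by simp
  from Gamma_real_pos[OF this] have 3: "Gamma (2 - s) \<noteq> 0" by (rule less_imp_neq[symmetric])
  show "isCont (gam_const N) s"
    unfolding gam_const_def[abs_def] using 1 2 3
    by (intro isCont_divide isCont_mult isCont_Gamma continuous_intros) simp_all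
qed

lemma sphere_area_pos: "N > 0 \<Longrightarrow> sphere_area N > 0"
  by (simp add: sphere_area_def)

text \<open>The normalisation behind the limit s -> 0: the volume of the unit ball contains
  Gamma(N/2 + 1) = (N/2) Gamma(N/2), whose Gamma(N/2) cancels the one in the constant.\<close>

lemma gam_const_0: assumes "N > 0" shows "gam_const N 0 * sphere_area N = 1"
proof -
  define x where "x = Gamma (real N / 2)"
  have g: "Gamma (real N / 2 + 1) = real N / 2 * x" unfolding x_def
  proof (rule Gamma_plus1, rule notI)
    assume "real N / 2 \<in> \<int>\<^sub>\<le>\<^sub>0"
    then have "real N / 2 \<le> 0" by (rule nonpos_Ints_nonpos)
    then show False using assms by simp
  qed
  have x: "x > 0" using assms by (simp add: x_def)
  have 2: "Gamma (2::real) = 1" using Gamma_numeral[of "Num.Bit0 Num.One", where 'a=real] by simp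
  have p: "(2::real) powr (-1) = 1/2" by (simp add: powr_minus)
  have "gam_const N 0 * sphere_area N = (1/2 * x / pi powr (real N / 2)) * (real N * (pi powr (real N / 2) / (real N / 2 * x)))"
    unfolding gam_const_def sphere_area_def unit_ball_vol_def g by (simp add: 2 p x_def)
  also have "\<dots> = 1" using x assms by (simp add: field_simps)
  finally show ?thesis .
qed

text \<open>Polar coordinates for radial integrands. Both measures assign to the half-line up to
  \<open>a\<close> the volume of the ball of radius \<open>a\<close>, and these half-lines form an
  intersection-stable generator of the Borel sets.\<close>

lemma distr_norm_lborel:
  "distr (lborel :: 'a::euclidean_space measure) borel norm
    = density lborel (\<lambda>r. ennreal (sphere_area DIM('a) * r ^ (DIM('a) - 1)) * indicator {0..} r)"
  (is "?M = ?N")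
proof (rule measure_eqI_generator_eq)
  let ?E = "range (\<lambda>a::real. {..a})"
  have em: "emeasure ?M {..a} = (if a \<ge> 0 then ennreal (unit_ball_vol (real DIM('a)) * a ^ DIM('a)) else 0)" for a
  proof -
    have "emeasure ?M {..a} = emeasure lborel (norm -` {..a} :: 'a set)"
      by (subst emeasure_distr) auto
    also have "norm -` {..a} = (cball 0 a :: 'a set)" by auto
    finally show ?thesis by (simp add: emeasure_cball)
  qed
  have en: "emeasure ?N {..a} = (if a \<ge> 0 then ennreal (unit_ball_vol (real DIM('a)) * a ^ DIM('a)) else 0)" for a
  proof -
    have "emeasure ?N {..a} = (\<integral>\<^sup>+r. ennreal (sphere_area DIM('a) * r ^ (DIM('a) - 1)) * indicator {0..a} r \<partial>lborel)"
      by (subst emeasure_density) (auto intro!: nn_integral_cong simp: indicator_def)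
    also have "\<dots> = (if a \<ge> 0 then ennreal (unit_ball_vol (real DIM('a)) * a ^ DIM('a)) else 0)"
    proof (cases "a \<ge> 0")
      case True
      have "(\<integral>\<^sup>+r. ennreal (sphere_area DIM('a) * r ^ (DIM('a) - 1)) * indicator {0..a} r \<partial>lborel)
        = ennreal (unit_ball_vol (real DIM('a)) * a ^ DIM('a) - unit_ball_vol (real DIM('a)) * 0 ^ DIM('a))"
      proof (rule nn_integral_FTC_Icc)
        show "((\<lambda>r. unit_ball_vol (real DIM('a)) * r ^ DIM('a)) has_real_derivative
            sphere_area DIM('a) * r ^ (DIM('a) - 1)) (at r)" for r
          by (auto intro!: derivative_eq_intros simp: sphere_area_def)
        show "0 \<le> sphere_area DIM('a) * r ^ (DIM('a) - 1)" if "r \<in> {0..a}" for r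
          using that sphere_area_pos[of "DIM('a)"] by (simp add: less_imp_le)
      qed (use True in auto)
      then show ?thesis using True by (simp add: power_0_left)
    qed simp
    finally show ?thesis .
  qed
  show "Int_stable ?E" by (auto simp: Int_stable_def)
  show "?E \<subseteq> Pow UNIV" by simp
  show "sets ?M = sigma_sets UNIV ?E" "sets ?N = sigma_sets UNIV ?E"
    by (simp_all add: borel_eq_atMost)
  show "range (\<lambda>n. {..real n}) \<subseteq> ?E" by auto
  show "(\<Union>n. {..real n}) = UNIV" using real_arch_simple by auto
  show "emeasure ?M {..real n} \<noteq> \<infinity>" for n unfolding em by simp
  show "emeasure ?M X = emeasure ?N X" if "X \<in> ?E" for X using that em en by auto
qed

lemma nn_integral_radial:
  assumes [measurable]: "f \<in> borel_measurable borel"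
  shows "(\<integral>\<^sup>+h. f (norm (h::'a::euclidean_space)) \<partial>lborel)
    = (\<integral>\<^sup>+r. ennreal (sphere_area DIM('a) * r ^ (DIM('a) - 1)) * indicator {0..} r * f r \<partial>lborel)"
proof -
  have "(\<integral>\<^sup>+h. f (norm (h::'a)) \<partial>lborel) = (\<integral>\<^sup>+r. f r \<partial>distr (lborel :: 'a measure) borel norm)"
    by (subst nn_integral_distr) simp_all
  also have "\<dots> = (\<integral>\<^sup>+r. ennreal (sphere_area DIM('a) * r ^ (DIM('a) - 1)) * indicator {0..} r * f r \<partial>lborel)"
    unfolding distr_norm_lborel by (subst nn_integral_density) simp_all
  finally show ?thesis .
qed

lemma radial_weight:
  assumes "r > 0" "N > 0" shows "r ^ (N - 1) / r powr (real N + p) = r powr (- 1 - p)"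
proof -
  have "r ^ (N - 1) = r powr (real N - 1)"
    using powr_realpow[OF assms(1), of "N - 1"] assms(2) by (simp add: of_nat_diff)
  then show ?thesis by (simp add: powr_diff[symmetric])
qed

lemma nn_integral_tail:
  assumes R: "R > 0" and p: "p > 0"
  shows "(\<integral>\<^sup>+h. indicator {h. R \<le> norm h} h * ennreal (1 / norm (h::'a::euclidean_space) powr (real DIM('a) + p)) \<partial>lborel)
    = ennreal (sphere_area DIM('a) * R powr (- p) / p)"
proof -
  let ?S = "sphere_area DIM('a)"
  have S: "?S > 0" by (rule sphere_area_pos) simp
  have "(\<integral>\<^sup>+h. indicator {h. R \<le> norm h} h * ennreal (1 / norm (h::'a) powr (real DIM('a) + p)) \<partial>lborel)
    = (\<integral>\<^sup>+h. (\<lambda>r. indicator {R..} r * ennreal (1 / r powr (real DIM('a) + p))) (norm (h::'a)) \<partial>lborel)"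
    by (intro nn_integral_cong) (simp add: indicator_def)
  also have "\<dots> = (\<integral>\<^sup>+r. ennreal (?S * r ^ (DIM('a) - 1)) * indicator {0..} r * (indicator {R..} r * ennreal (1 / r powr (real DIM('a) + p))) \<partial>lborel)"
    by (rule nn_integral_radial) measurable
  also have "\<dots> = (\<integral>\<^sup>+r. ennreal (?S * r powr (- 1 - p)) * indicator {R..} r \<partial>lborel)"
  proof (rule nn_integral_cong)
    fix r :: real
    show "ennreal (?S * r ^ (DIM('a) - 1)) * indicator {0..} r * (indicator {R..} r * ennreal (1 / r powr (real DIM('a) + p)))
      = ennreal (?S * r powr (- 1 - p)) * indicator {R..} r"
    proof (cases "r \<ge> R")
      case True
      then have r: "r > 0" using R by simp
      have "?S * r ^ (DIM('a) - 1) * (1 / r powr (real DIM('a) + p)) = ?S * r powr (- 1 - p)"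
        using radial_weight[OF r, of "DIM('a)" p] by (simp add: field_simps)
      then show ?thesis using True r S by (simp add: ennreal_mult[symmetric])
    qed simp
  qed
  also have "\<dots> = ennreal (0 - (- (?S / p) * R powr (- p)))"
  proof (rule nn_integral_FTC_atLeast)
    show "((\<lambda>r. - (?S / p) * r powr (- p)) has_real_derivative ?S * r powr (- 1 - p)) (at r)" if "R \<le> r" for r
    proof -
      have e: "- p - 1 = - 1 - p" by simp
      show ?thesis
        using DERIV_cmult[OF has_real_derivative_powr[of r "- p"], of "- (?S / p)"] that R p unfolding e by simp
    qed
    show "0 \<le> ?S * r powr (- 1 - p)" for r using S by simp
    have "((\<lambda>r. r powr (- p)) \<longlongrightarrow> 0) at_top"
      using p by (intro tendsto_neg_powr) (simp_all add: filterlim_ident)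
    then show "((\<lambda>r. - (?S / p) * r powr (- p)) \<longlongrightarrow> 0) at_top"
      by (rule tendsto_mult_right_zero)
  qed measurable
  finally show ?thesis by simp
qed

text \<open>In polar coordinates the integrand is r^(1-p), which is integrable at 0 because p <
  2.\<close>

lemma nn_integral_near:
  assumes p: "0 < p" "p < 2"
  shows "(\<integral>\<^sup>+h. indicator (ball 0 1) h * ennreal ((norm h)\<^sup>2 / norm (h::'a::euclidean_space) powr (real DIM('a) + p)) \<partial>lborel)
    \<le> ennreal (sphere_area DIM('a) / (2 - p))"
proof -
  let ?S = "sphere_area DIM('a)"
  have S: "?S > 0" by (rule sphere_area_pos) simp
  \<comment> \<open>The derivative rule for real powers holds away from 0, so the integral is
    computed on [1/(n+1), 1] and Fatou recovers the whole interval.\<close>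
  define g where "g n = (\<integral>\<^sup>+r. ennreal (?S * r powr (1 - p)) * indicator {1 / real (Suc n)..1} r \<partial>lborel)" for n
  have g: "g n \<le> ennreal (?S / (2 - p))" for n
  proof -
    have "g n = ennreal (?S / (2 - p) * 1 powr (2 - p) - ?S / (2 - p) * (1 / real (Suc n)) powr (2 - p))"
      unfolding g_def
    proof (rule nn_integral_FTC_Icc)
      fix r assume "r \<in> {1 / real (Suc n)..1}"
      moreover have "0 < 1 / real (Suc n)" by simp
      ultimately have "r > 0" by (meson atLeastAtMost_iff less_le_trans)
      then show "((\<lambda>r. ?S / (2 - p) * r powr (2 - p)) has_real_derivative ?S * r powr (1 - p)) (at r)"
        using DERIV_cmult[OF has_real_derivative_powr[of r "2 - p"], of "?S / (2 - p)"] p by simp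
      show "0 \<le> ?S * r powr (1 - p)" using S by simp
    qed (simp_all add: field_simps)
    also have "\<dots> \<le> ennreal (?S / (2 - p))" using S p by (intro ennreal_leI) (simp add: divide_nonneg_pos)
    finally show ?thesis .
  qed
  have "(\<integral>\<^sup>+h. indicator (ball 0 1) h * ennreal ((norm h)\<^sup>2 / norm (h::'a) powr (real DIM('a) + p)) \<partial>lborel)
    = (\<integral>\<^sup>+h. (\<lambda>r. indicator {..<1} r * ennreal (r\<^sup>2 / r powr (real DIM('a) + p))) (norm (h::'a)) \<partial>lborel)"
    by (intro nn_integral_cong) (simp add: indicator_def)
  also have "\<dots> = (\<integral>\<^sup>+r. ennreal (?S * r ^ (DIM('a) - 1)) * indicator {0..} r * (indicator {..<1} r * ennreal (r\<^sup>2 / r powr (real DIM('a) + p))) \<partial>lborel)"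
    by (rule nn_integral_radial) measurable
  also have "\<dots> \<le> (\<integral>\<^sup>+r. liminf (\<lambda>n. ennreal (?S * r powr (1 - p)) * indicator {1 / real (Suc n)..1} r) \<partial>lborel)"
  proof (rule nn_integral_mono)
    fix r :: real
    show "ennreal (?S * r ^ (DIM('a) - 1)) * indicator {0..} r * (indicator {..<1} r * ennreal (r\<^sup>2 / r powr (real DIM('a) + p)))
      \<le> liminf (\<lambda>n. ennreal (?S * r powr (1 - p)) * indicator {1 / real (Suc n)..1} r)"
    proof (cases "0 < r \<and> r < 1")
      case True
      have "r powr 2 = r\<^sup>2" using powr_realpow[of r 2] True by simp
      then have "r ^ (DIM('a) - 1) * (r\<^sup>2 / r powr (real DIM('a) + p)) = r powr (- 1 - p) * r powr 2"
        using radial_weight[of r "DIM('a)" p] True by (simp add: field_simps)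
      also have "\<dots> = r powr (1 - p)" by (subst powr_add[symmetric]) simp
      finally have "?S * r ^ (DIM('a) - 1) * (r\<^sup>2 / r powr (real DIM('a) + p)) = ?S * r powr (1 - p)" by (simp only: mult.assoc)
      then have l: "ennreal (?S * r ^ (DIM('a) - 1)) * indicator {0..} r * (indicator {..<1} r * ennreal (r\<^sup>2 / r powr (real DIM('a) + p)))
         = ennreal (?S * r powr (1 - p))"
        using True S by (simp add: ennreal_mult[symmetric])
      have ev: "\<forall>\<^sub>F n in sequentially. ennreal (?S * r powr (1 - p)) * indicator {1 / real (Suc n)..1} r = ennreal (?S * r powr (1 - p))"
      proof -
        obtain m :: nat where m: "1 / r < real m" using reals_Archimedean2 by blast
        show ?thesis
        proof (rule eventually_mono[OF eventually_ge_at_top[of m]])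
          fix n assume "m \<le> n"
          then have "1 / r < real (Suc n)" using m by linarith
          then have "1 / real (Suc n) \<le> r" using True by (simp add: field_simps)
          then show "ennreal (?S * r powr (1 - p)) * indicator {1 / real (Suc n)..1} r = ennreal (?S * r powr (1 - p))"
            using True by simp
        qed
      qed
      have "liminf (\<lambda>n. ennreal (?S * r powr (1 - p)) * indicator {1 / real (Suc n)..1} r) = ennreal (?S * r powr (1 - p))"
        by (rule lim_imp_Liminf[OF trivial_limit_sequentially tendsto_eventually[OF ev]])
      then show ?thesis unfolding l by simp
    next
      case False
      then have "r \<le> 0 \<or> 1 \<le> r" by auto
      then have "ennreal (?S * r ^ (DIM('a) - 1)) * indicator {0..} r * (indicator {..<1} r * ennreal (r\<^sup>2 / r powr (real DIM('a) + p))) = 0"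
        by (cases "r = 0") (auto simp: indicator_def)
      then show ?thesis by (rule order_trans[OF eq_refl zero_le])
    qed
  qed
  also have "\<dots> \<le> liminf g"
    unfolding g_def by (rule nn_integral_liminf) measurable
  also have "\<dots> \<le> liminf (\<lambda>n. ennreal (?S / (2 - p)))"
    by (rule Liminf_mono) (simp add: g)
  also have "\<dots> = ennreal (?S / (2 - p))" by (simp add: Liminf_const)
  finally show ?thesis .
qed

section \<open>Seminorms as weighted averages of translation differences\<close>

definition nrm_sq :: "('a::euclidean_space \<Rightarrow> real) \<Rightarrow> ennreal" where
  "nrm_sq u = (\<integral>\<^sup>+x. ennreal ((u x)\<^sup>2) \<partial>lborel)"

definition shift_diff :: "('a::euclidean_space \<Rightarrow> real) \<Rightarrow> 'a \<Rightarrow> ennreal" where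
  "shift_diff u h = (\<integral>\<^sup>+x. ennreal ((u (x + h) - u x)\<^sup>2) \<partial>lborel)"

lemma shift_diff_measurable [measurable]:
  assumes [measurable]: "u \<in> borel_measurable borel" shows "shift_diff u \<in> borel_measurable borel"
  unfolding shift_diff_def[abs_def] by measurable

text \<open>At the origin the power is 0 and the quotient defaults to 0, so the kernel vanishes
  there.\<close>

definition kern :: "real \<Rightarrow> 'a::euclidean_space \<Rightarrow> ennreal" where
  "kern s h = ennreal (1 / norm h powr (real DIM('a) + 2 * s))"

lemma kern_measurable [measurable]: "kern s \<in> borel_measurable borel"
  unfolding kern_def[abs_def] by measurable

text \<open>The substitution x = y + h and an exchange of integrals separate the kernel from the
  function, so that estimates on single translates become estimates on the seminorm.\<close>

lemma seminorm_sq_frac: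
  fixes u :: "'a::euclidean_space \<Rightarrow> real"
  assumes s: "0 < s" "s < 1" and [measurable]: "u \<in> borel_measurable borel"
  shows "seminorm_sq s u = ennreal (c_const DIM('a) s) * (\<integral>\<^sup>+h. kern s h * shift_diff u h \<partial>lborel)"
proof -
  define F where "F x y = ennreal ((u x - u y)\<^sup>2 / norm (x - y) powr (real DIM('a) + 2 * s))" for x y :: 'a
  have [measurable]: "case_prod F \<in> borel_measurable (lborel \<Otimes>\<^sub>M lborel)" unfolding F_def by measurable
  have [measurable]: "(\<lambda>x. F x y) \<in> borel_measurable borel" for y unfolding F_def by measurable
  have m2 [measurable]: "(\<lambda>(h, y). F (h + y) y) \<in> borel_measurable (lborel \<Otimes>\<^sub>M lborel)" unfolding F_def by measurable
  have "(\<integral>\<^sup>+p. ennreal ((u (fst p) - u (snd p))\<^sup>2 / norm (fst p - snd p) powr (real DIM('a) + 2 * s)) \<partial>(lborel \<Otimes>\<^sub>M lborel))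
    = (\<integral>\<^sup>+y. \<integral>\<^sup>+x. F x y \<partial>lborel \<partial>lborel)"
    using lborel_pair.nn_integral_snd[of "case_prod F"] by (simp add: F_def case_prod_beta')
  also have "\<dots> = (\<integral>\<^sup>+y. \<integral>\<^sup>+h. F (h + y) y \<partial>lborel \<partial>lborel)"
    by (intro nn_integral_cong nn_integral_shift[symmetric]) measurable
  also have "\<dots> = (\<integral>\<^sup>+h. \<integral>\<^sup>+y. F (h + y) y \<partial>lborel \<partial>lborel)"
    by (rule lborel_pair.Fubini') (rule m2)
  also have "\<dots> = (\<integral>\<^sup>+h. kern s h * shift_diff u h \<partial>lborel)"
  proof (rule nn_integral_cong)
    fix h :: 'a
    have "F (h + y) y = kern s h * ennreal ((u (y + h) - u y)\<^sup>2)" for y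
      unfolding F_def kern_def by (simp add: ennreal_mult[symmetric] add.commute)
    then show "(\<integral>\<^sup>+y. F (h + y) y \<partial>lborel) = kern s h * shift_diff u h"
      unfolding shift_diff_def by (simp add: nn_integral_cmult)
  qed
  finally show ?thesis using s by (simp add: seminorm_sq_def)
qed

lemma seminorm_sq_0: "seminorm_sq 0 u = nrm_sq u"
  by (simp add: seminorm_sq_def nrm_sq_def)

lemma shift_diff_le:
  assumes [measurable]: "u \<in> borel_measurable borel" shows "shift_diff u h \<le> 4 * nrm_sq u"
proof -
  have "shift_diff u h \<le> (\<integral>\<^sup>+x. 2 * ennreal ((u (x + h))\<^sup>2) + 2 * ennreal ((u x)\<^sup>2) \<partial>lborel)"
    unfolding shift_diff_def
  proof (rule nn_integral_mono)
    fix x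
    have "0 \<le> (u (x + h) + u x)\<^sup>2" by simp
    then have "(u (x + h) - u x)\<^sup>2 \<le> 2 * (u (x + h))\<^sup>2 + 2 * (u x)\<^sup>2" by (simp add: power2_eq_square algebra_simps)
    then have "ennreal ((u (x + h) - u x)\<^sup>2) \<le> ennreal (2 * (u (x + h))\<^sup>2 + 2 * (u x)\<^sup>2)" by (rule ennreal_leI)
    also have "\<dots> = 2 * ennreal ((u (x + h))\<^sup>2) + 2 * ennreal ((u x)\<^sup>2)" by (simp add: ennreal_plus ennreal_mult)
    finally show "ennreal ((u (x + h) - u x)\<^sup>2) \<le> 2 * ennreal ((u (x + h))\<^sup>2) + 2 * ennreal ((u x)\<^sup>2)" .
  qed
  also have "\<dots> = 2 * nrm_sq u + 2 * nrm_sq u"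
    unfolding nrm_sq_def using nn_integral_shift[of "\<lambda>x. ennreal ((u x)\<^sup>2)" h]
    by (simp add: nn_integral_add nn_integral_cmult)
  also have "\<dots> = 4 * nrm_sq u"
    unfolding distrib_right[symmetric] by simp
  finally show ?thesis .
qed

section \<open>Splitting the kernel integral at the diameter of the domain\<close>

locale domain =
  fixes \<Omega> :: "'a::euclidean_space set" and R :: real
  assumes R1: "R \<ge> 1" and diam: "\<And>x y. x \<in> \<Omega> \<Longrightarrow> y \<in> \<Omega> \<Longrightarrow> norm (x - y) < R"
begin

definition supp :: "('a \<Rightarrow> real) \<Rightarrow> bool" where
  "supp u \<longleftrightarrow> sqint lborel u \<and> (AE x in lborel. x \<notin> \<Omega> \<longrightarrow> u x = 0)"

lemma supp_sqint: "supp u \<Longrightarrow> sqint lborel u"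
  by (simp add: supp_def)

lemma supp_measurable: "supp u \<Longrightarrow> u \<in> borel_measurable borel"
  by (simp add: supp_def sqint_def)

lemma shift_diff_far:
  assumes u: "supp u" and h: "R \<le> norm h" shows "shift_diff u h = 2 * nrm_sq u"
proof -
  have [measurable]: "u \<in> borel_measurable borel" by (rule supp_measurable[OF u])
  have ae: "AE x in lborel. x \<notin> \<Omega> \<longrightarrow> u x = 0" using u by (simp add: supp_def)
  have "shift_diff u h = (\<integral>\<^sup>+x. ennreal ((u (x + h))\<^sup>2) + ennreal ((u x)\<^sup>2) \<partial>lborel)"
    unfolding shift_diff_def
  proof (rule nn_integral_cong_AE, use ae AE_shift[OF ae, of h] in eventually_elim)
    case (elim x)
    have "u (x + h) * u x = 0"
    proof (cases "x \<in> \<Omega>")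
      case True
      then have "x + h \<notin> \<Omega>" using diam[of "x + h" x] h by auto
      then show ?thesis using elim by simp
    qed (use elim in simp)
    then have "(u (x + h) - u x)\<^sup>2 = (u (x + h))\<^sup>2 + (u x)\<^sup>2" by (simp add: power2_diff)
    then show ?case by (simp add: ennreal_plus)
  qed
  also have "\<dots> = nrm_sq u + nrm_sq u"
    unfolding nrm_sq_def using nn_integral_shift[of "\<lambda>x. ennreal ((u x)\<^sup>2)" h] by (simp add: nn_integral_add)
  finally show ?thesis by (simp add: mult_2)
qed

definition near :: "real \<Rightarrow> ('a \<Rightarrow> real) \<Rightarrow> ennreal" where
  "near s u = (\<integral>\<^sup>+h. indicator (ball 0 R) h * (kern s h * shift_diff u h) \<partial>lborel)"

lemma Rpos: "R > 0" using R1 by simp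

lemma near_integrand_measurable:
  fixes u :: "'a \<Rightarrow> real"
  assumes [measurable]: "u \<in> borel_measurable borel"
  shows "(\<lambda>h. indicator (ball 0 R) h * (kern s h * shift_diff u h)) \<in> borel_measurable borel"
proof -
  have [measurable]: "ball (0::'a) R \<in> sets borel" by simp
  show ?thesis by measurable
qed

lemma seminorm_split:
  assumes s: "0 < s" "s < 1" and u: "supp u"
  shows "seminorm_sq s u = ennreal (c_const DIM('a) s) * near s u
    + ennreal (gam_const DIM('a) s * (1 - s) * sphere_area DIM('a) * R powr (- 2 * s)) * nrm_sq u"
proof -
  note [measurable] = supp_measurable[OF u]
  let ?c = "c_const DIM('a) s" and ?S = "sphere_area DIM('a)"
  have c: "?c \<ge> 0" using gam_const_pos[of "DIM('a)" s] s by (simp add: c_const_eq)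
  have S: "?S > 0" by (rule sphere_area_pos) simp
  have "(\<integral>\<^sup>+h. kern s h * shift_diff u h \<partial>lborel)
    = (\<integral>\<^sup>+h. indicator (ball 0 R) h * (kern s h * shift_diff u h)
        + (indicator {h. R \<le> norm h} h * kern s h) * (2 * nrm_sq u) \<partial>lborel)"
    by (rule nn_integral_cong) (auto simp: indicator_def shift_diff_far[OF u])
  also have "\<dots> = near s u + (\<integral>\<^sup>+h. indicator {h. R \<le> norm h} h * kern s (h::'a) \<partial>lborel) * (2 * nrm_sq u)"
    unfolding near_def by (subst nn_integral_add) (use near_integrand_measurable[OF supp_measurable[OF u]] in \<open>simp_all add: nn_integral_multc\<close>)
  also have "(\<integral>\<^sup>+h. indicator {h. R \<le> norm h} h * kern s (h::'a) \<partial>lborel) = ennreal (?S * R powr (- (2 * s)) / (2 * s))"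
    unfolding kern_def by (rule nn_integral_tail) (use s Rpos in auto)
  finally have "seminorm_sq s u = ennreal ?c * (near s u + ennreal (?S * R powr (- (2 * s)) / (2 * s)) * (2 * nrm_sq u))"
    using seminorm_sq_frac[OF s, of u] by simp
  also have "\<dots> = ennreal ?c * near s u + (ennreal ?c * ennreal (?S * R powr (- (2 * s)) / (2 * s)) * ennreal 2) * nrm_sq u"
    by (simp add: distrib_left mult.assoc)
  also have "ennreal ?c * ennreal (?S * R powr (- (2 * s)) / (2 * s)) * ennreal 2 = ennreal (?c * (?S * R powr (- (2 * s)) / (2 * s)) * 2)"
    using c S s by (simp only: ennreal_mult[symmetric] ennreal_mult'[symmetric] mult_nonneg_nonneg divide_nonneg_pos powr_ge_zero less_imp_le zero_le_numeral)
  \<comment> \<open>The 2 from the disjoint supports and the s in \<open>c_const\<close> cancel the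
    1/(2s) of the tail integral. This is why the far part keeps a finite nonzero weight as s ->
    0.\<close>
  also have "?c * (?S * R powr (- (2 * s)) / (2 * s)) * 2 = gam_const DIM('a) s * (1 - s) * ?S * R powr (- 2 * s)"
    using s by (simp add: c_const_eq field_simps)
  finally show ?thesis .
qed

text \<open>Within distance \<open>R\<close> the kernels of the two orders differ by the factor
  |h|^(2(s' - s)), which is at most its value at |h| = R.\<close>

lemma near_mono:
  assumes "s \<le> s'" and u: "supp u"
  shows "near s u \<le> ennreal (R powr (2 * (s' - s))) * near s' u"
proof -
  note [measurable] = supp_measurable[OF u]
  have "near s u \<le> (\<integral>\<^sup>+h. ennreal (R powr (2 * (s' - s))) * (indicator (ball 0 R) h * (kern s' h * shift_diff u h)) \<partial>lborel)"
    unfolding near_def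
  proof (rule nn_integral_mono)
    fix h :: 'a
    have "kern s h \<le> ennreal (R powr (2 * (s' - s))) * kern s' h" if "norm h < R"
    proof (cases "h = 0")
      case False
      then have n: "norm h > 0" by simp
      have "1 / norm h powr (real DIM('a) + 2 * s) = norm h powr (2 * (s' - s)) * (1 / norm h powr (real DIM('a) + 2 * s'))"
        using n by (simp add: powr_diff[symmetric] powr_minus_divide[symmetric] powr_add[symmetric] algebra_simps)
      also have "\<dots> \<le> R powr (2 * (s' - s)) * (1 / norm h powr (real DIM('a) + 2 * s'))"
        using that assms(1) by (intro mult_right_mono powr_mono2) auto
      finally show ?thesis unfolding kern_def by (simp add: ennreal_mult[symmetric] ennreal_leI)
    qed (simp add: kern_def)
    then have "kern s h * shift_diff u h \<le> ennreal (R powr (2 * (s' - s))) * kern s' h * shift_diff u h" if "norm h < R"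
      using that by (intro mult_right_mono) auto
    then show "indicator (ball 0 R) h * (kern s h * shift_diff u h)
        \<le> ennreal (R powr (2 * (s' - s))) * (indicator (ball 0 R) h * (kern s' h * shift_diff u h))"
      by (cases "norm h < R") (simp_all add: mult.assoc)
  qed
  also have "\<dots> = ennreal (R powr (2 * (s' - s))) * near s' u"
    unfolding near_def
    by (rule nn_integral_cmult) (use near_integrand_measurable[OF supp_measurable[OF u]] in simp)
  finally show ?thesis .
qed

text \<open>For \<open>norm h \<ge> R\<close> the supports of \<open>u\<close> and its translate are disjoint, so this part of the kernel
  integral is an explicit multiple of the squared \<open>L\<^sup>2\<close> norm; the multiple \<open>lo s\<close> tends to \<open>1\<close> as
  \<open>s \<rightarrow> 0\<close>, while the rest is bounded by \<open>up s' s\<close> times the seminorm of order \<open>s'\<close>, with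
  \<open>up s' s \<rightarrow> 0\<close>.\<close>

definition lo :: "real \<Rightarrow> real" where
  "lo s = gam_const DIM('a) s * (1 - s) * sphere_area DIM('a) * R powr (- 2 * s)"

lemma lo_0: "lo 0 = 1"
  using gam_const_0[of "DIM('a)"] Rpos by (simp add: lo_def)

lemma lo_continuous: "continuous_on {0..1} lo"
  unfolding lo_def[abs_def] using Rpos by (intro continuous_intros gam_const_continuous) auto

lemma lo_nonneg: "0 \<le> s \<Longrightarrow> s \<le> 1 \<Longrightarrow> 0 \<le> lo s"
  using gam_const_pos[of "DIM('a)" s] sphere_area_pos[of "DIM('a)"] by (simp add: lo_def)

lemma lo_pos: "0 \<le> s \<Longrightarrow> s < 1 \<Longrightarrow> 0 < lo s"
  using gam_const_pos[of "DIM('a)" s] sphere_area_pos[of "DIM('a)"] Rpos by (simp add: lo_def)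

lemma seminorm_lower:
  assumes "0 \<le> s" "s < 1" and u: "supp u" shows "ennreal (lo s) * nrm_sq u \<le> seminorm_sq s u"
proof (cases "s = 0")
  case False
  then show ?thesis using seminorm_split[of s u] assms by (simp add: lo_def)
qed (simp add: lo_0 seminorm_sq_0)

lemma c_const_nonneg: "0 \<le> s \<Longrightarrow> s \<le> 1 \<Longrightarrow> 0 \<le> c_const DIM('a) s"
  using gam_const_pos[of "DIM('a)" s] by (simp add: c_const_eq)

lemma c_const_pos: "0 < s \<Longrightarrow> s < 1 \<Longrightarrow> 0 < c_const DIM('a) s"
  using gam_const_pos[of "DIM('a)" s] by (simp add: c_const_eq)

lemma near_le_seminorm:
  assumes s: "0 < s" "s < 1" and u: "supp u"
  shows "near s u \<le> ennreal (1 / c_const DIM('a) s) * seminorm_sq s u"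
proof -
  have c: "c_const DIM('a) s > 0" by (rule c_const_pos[OF s])
  have "ennreal (c_const DIM('a) s) * near s u \<le> seminorm_sq s u"
    using seminorm_split[OF s u] by simp
  then have "ennreal (1 / c_const DIM('a) s) * (ennreal (c_const DIM('a) s) * near s u) \<le> ennreal (1 / c_const DIM('a) s) * seminorm_sq s u"
    by (rule mult_left_mono) simp
  moreover have "ennreal (1 / c_const DIM('a) s) * ennreal (c_const DIM('a) s) = 1"
    using c by (simp add: ennreal_mult[symmetric])
  ultimately show ?thesis by (simp add: mult.assoc[symmetric])
qed

definition up :: "real \<Rightarrow> real \<Rightarrow> real" where
  "up s' s = c_const DIM('a) s * R powr (2 * (s' - s)) / c_const DIM('a) s'"

text \<open>Only the near part is transferred to order \<open>s'\<close>. The far part is kept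
  exact, so the weight of the L2 norm is the same \<open>lo s\<close> as in the lower bound.\<close>

lemma seminorm_upper:
  assumes s: "0 \<le> s" "s \<le> s'" "0 < s'" "s' < 1" and u: "supp u"
  shows "seminorm_sq s u \<le> ennreal (lo s) * nrm_sq u + ennreal (up s' s) * seminorm_sq s' u"
proof (cases "s = 0")
  case False
  then have s0: "0 < s" "s < 1" using s by auto
  have c: "c_const DIM('a) s \<ge> 0" using c_const_nonneg s0 by simp
  have c': "c_const DIM('a) s' > 0" by (rule c_const_pos) (use s in auto)
  have "near s u \<le> ennreal (R powr (2 * (s' - s))) * near s' u" by (rule near_mono[OF s(2) u])
  also have "\<dots> \<le> ennreal (R powr (2 * (s' - s))) * (ennreal (1 / c_const DIM('a) s') * seminorm_sq s' u)"
    by (rule mult_left_mono[OF near_le_seminorm[OF s(3,4) u]]) simp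
  finally have "ennreal (c_const DIM('a) s) * near s u \<le>
     ennreal (c_const DIM('a) s) * (ennreal (R powr (2 * (s' - s))) * (ennreal (1 / c_const DIM('a) s') * seminorm_sq s' u))"
    by (rule mult_left_mono) simp
  also have "\<dots> = ennreal (c_const DIM('a) s) * ennreal (R powr (2 * (s' - s))) * ennreal (1 / c_const DIM('a) s') * seminorm_sq s' u"
    by (simp add: mult.assoc)
  also have "ennreal (c_const DIM('a) s) * ennreal (R powr (2 * (s' - s))) * ennreal (1 / c_const DIM('a) s') = ennreal (up s' s)"
    using c c' by (simp add: ennreal_mult[symmetric] up_def)
  finally have "ennreal (c_const DIM('a) s) * near s u \<le> ennreal (up s' s) * seminorm_sq s' u" .
  then show ?thesis
    unfolding seminorm_split[OF s0 u] lo_def[symmetric] by (simp add: add.commute add_left_mono)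
qed (simp add: lo_0 seminorm_sq_0)

lemma up_0: "up s' 0 = 0" by (simp add: up_def c_const_eq)

lemma up_continuous: "0 < s' \<Longrightarrow> s' < 1 \<Longrightarrow> continuous_on {0..1} (up s')"
  unfolding up_def[abs_def] c_const_eq[abs_def] using Rpos gam_const_pos[of "DIM('a)" s']
  by (intro continuous_intros gam_const_continuous) auto

lemma up_nonneg: "0 \<le> s \<Longrightarrow> s \<le> 1 \<Longrightarrow> 0 < s' \<Longrightarrow> s' < 1 \<Longrightarrow> 0 \<le> up s' s"
  using c_const_nonneg[of s] c_const_pos[of s'] by (simp add: up_def)

end

text \<open>The point is the uniformity in the order, endpoints included: the factors s and 1 - s of
  \<open>c_const\<close> cancel the blow-up of the far and of the near integral. Hence test
  functions have finite energy for every finite measure on the orders.\<close>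

lemma seminorm_smooth_bound:
  obtains B where "B > 0" "\<And>(u :: 'a::euclidean_space \<Rightarrow> real) G s. has_weak_grad u G \<Longrightarrow> sqint lborel u \<Longrightarrow> sqint lborel G \<Longrightarrow> 0 \<le> s \<Longrightarrow> s \<le> 1 \<Longrightarrow>
    seminorm_sq s u \<le> ennreal B * (nrm_sq u + (\<integral>\<^sup>+x. ennreal ((norm (G x))\<^sup>2) \<partial>lborel))"
proof -
  let ?N = "DIM('a)" and ?S = "sphere_area DIM('a)"
  have S: "?S > 0" by (rule sphere_area_pos) simp
  have "bounded (gam_const ?N ` {0..1})"
    by (intro compact_imp_bounded compact_continuous_image gam_const_continuous) auto
  then obtain b where "\<forall>x\<in>gam_const ?N ` {0..1}. norm x \<le> b" unfolding bounded_iff by blast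
  then have b: "\<And>s. 0 \<le> s \<Longrightarrow> s \<le> 1 \<Longrightarrow> \<bar>gam_const ?N s\<bar> \<le> b" by auto
  \<comment> \<open>The 1 covers the endpoint orders; 2 b times the sphere area covers the far
    integral, and a quarter of that would do for the near one.\<close>
  define B where "B = 1 + 2 * b * ?S"
  have b0: "b \<ge> 0" using b[of 0] by simp
  have B: "B > 0" "B \<ge> 1" using b0 S by (auto simp: B_def add_pos_nonneg)
  have main: "seminorm_sq s u \<le> ennreal B * (nrm_sq u + (\<integral>\<^sup>+x. ennreal ((norm (G x))\<^sup>2) \<partial>lborel))"
    if W: "has_weak_grad u G" and u: "sqint lborel u" and G: "sqint lborel G" and s: "0 \<le> s" "s \<le> 1" for u :: "'a \<Rightarrow> real" and G s
  proof -
    let ?D = "\<integral>\<^sup>+x. ennreal ((norm (G x))\<^sup>2) \<partial>lborel"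
    note [measurable] = sqint_measurable[OF u]
    have um [measurable]: "u \<in> borel_measurable borel" using u by (simp add: sqint_def)
    consider "s = 0" | "s = 1" | "0 < s" "s < 1" using s by linarith
    then show ?thesis
    proof cases
      case 1
      have "nrm_sq u \<le> 1 * (nrm_sq u + ?D)" by simp
      also have "\<dots> \<le> ennreal B * (nrm_sq u + ?D)" using B by (intro mult_right_mono) (simp_all add: ennreal_leI flip: ennreal_1)
      finally show ?thesis by (simp add: 1 seminorm_sq_0)
    next
      case 2
      have "?D \<le> 1 * (nrm_sq u + ?D)" by simp
      also have "\<dots> \<le> ennreal B * (nrm_sq u + ?D)" using B by (intro mult_right_mono) (simp_all add: ennreal_leI flip: ennreal_1)
      finally show ?thesis by (simp add: 2 seminorm_sq_1[OF W])
    next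
      case 3
      let ?c = "c_const ?N s"
      have c: "?c > 0" using gam_const_pos[of ?N s] 3 by (simp add: c_const_eq)
      have "(\<integral>\<^sup>+h. kern s h * shift_diff u h \<partial>lborel)
        \<le> (\<integral>\<^sup>+h. (indicator (ball 0 1) h * ennreal ((norm h)\<^sup>2 / norm (h::'a) powr (real ?N + 2 * s))) * ?D
            + (indicator {h. 1 \<le> norm h} h * kern s h) * (4 * nrm_sq u) \<partial>lborel)"
      proof (rule nn_integral_mono)
        fix h :: 'a
        show "kern s h * shift_diff u h \<le> (indicator (ball 0 1) h * ennreal ((norm h)\<^sup>2 / norm h powr (real ?N + 2 * s))) * ?D
            + (indicator {h. 1 \<le> norm h} h * kern s h) * (4 * nrm_sq u)"
        proof (cases "norm h < 1")
          case True
          have "kern s h * shift_diff u h \<le> kern s h * (ennreal ((norm h)\<^sup>2) * ?D)"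
            unfolding shift_diff_def by (rule mult_left_mono[OF difference_norm_le_weak_grad[OF W u G]]) simp
          also have "\<dots> = ennreal ((norm h)\<^sup>2 / norm h powr (real ?N + 2 * s)) * ?D"
            unfolding kern_def mult.assoc[symmetric] by (simp add: ennreal_mult[symmetric])
          finally show ?thesis using True by simp
        next
          case False
          then show ?thesis using mult_left_mono[OF shift_diff_le[OF um, of h], of "kern s h"] by simp
        qed
      qed
      also have "\<dots> = (\<integral>\<^sup>+h. indicator (ball 0 1) h * ennreal ((norm h)\<^sup>2 / norm (h::'a) powr (real ?N + 2 * s)) \<partial>lborel) * ?D
          + (\<integral>\<^sup>+h. indicator {h. 1 \<le> norm h} h * kern s (h::'a) \<partial>lborel) * (4 * nrm_sq u)"
      proof -
        have [measurable]: "ball (0::'a) 1 \<in> sets borel" by simp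
        have [measurable]: "(\<lambda>h::'a. indicator (ball 0 1) h * ennreal ((norm h)\<^sup>2 / norm h powr (real ?N + 2 * s))) \<in> borel_measurable borel"
          by measurable
        show ?thesis by (subst nn_integral_add) (simp_all add: nn_integral_multc)
      qed
      also have "\<dots> \<le> ennreal (?S / (2 - 2 * s)) * ?D + ennreal (?S / (2 * s)) * (4 * nrm_sq u)"
      proof (intro add_mono mult_right_mono)
        show "(\<integral>\<^sup>+h. indicator (ball 0 1) h * ennreal ((norm h)\<^sup>2 / norm (h::'a) powr (real ?N + 2 * s)) \<partial>lborel) \<le> ennreal (?S / (2 - 2 * s))"
          by (rule nn_integral_near) (use 3 in auto)
        show "(\<integral>\<^sup>+h. indicator {h. 1 \<le> norm h} h * kern s (h::'a) \<partial>lborel) \<le> ennreal (?S / (2 * s))"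
          using nn_integral_tail[of 1 "2 * s", where 'a='a] 3 by (simp add: kern_def)
      qed simp_all
      finally have "seminorm_sq s u \<le> ennreal ?c * (ennreal (?S / (2 - 2 * s)) * ?D + ennreal (?S / (2 * s)) * (4 * nrm_sq u))"
        unfolding seminorm_sq_frac[OF 3 um] by (rule mult_left_mono) simp
      also have "\<dots> = ennreal ?c * ennreal (?S / (2 - 2 * s)) * ?D + ennreal ?c * ennreal (?S / (2 * s)) * ennreal 4 * nrm_sq u"
        by (simp add: distrib_left mult.assoc)
      also have "\<dots> = ennreal (?c * (?S / (2 - 2 * s))) * ?D + ennreal (?c * (?S / (2 * s)) * 4) * nrm_sq u"
        using c S 3 by (simp only: ennreal_mult[symmetric] mult_nonneg_nonneg divide_nonneg_pos less_imp_le zero_le_numeral)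
      also have "\<dots> \<le> ennreal B * ?D + ennreal B * nrm_sq u"
      proof (intro add_mono mult_right_mono ennreal_leI)
        have g: "0 \<le> gam_const ?N s" "gam_const ?N s \<le> b" using b[of s] gam_const_pos[of ?N s] 3 by auto
        have "?c * (?S / (2 - 2 * s)) = gam_const ?N s * s * ?S / 2" using 3 by (simp add: c_const_eq field_simps)
        also have "\<dots> \<le> b * 1 * ?S / 2" using g 3 S b0 by (intro divide_right_mono mult_mono) auto
        also have "\<dots> \<le> B" using b0 S by (simp add: B_def)
        finally show "?c * (?S / (2 - 2 * s)) \<le> B" .
        have "?c * (?S / (2 * s)) * 4 = 2 * (gam_const ?N s * (1 - s) * ?S)" using 3 by (simp add: c_const_eq field_simps)
        also have "\<dots> \<le> 2 * (b * 1 * ?S)" using g 3 S b0 by (intro mult_left_mono mult_mono) auto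
        also have "\<dots> \<le> B" by (simp add: B_def)
        finally show "?c * (?S / (2 * s)) * 4 \<le> B" .
      qed simp_all
      finally show ?thesis by (simp add: distrib_left add.commute)
    qed
  qed
  from that[OF B(1) main] show thesis .
qed

section \<open>The energy of a measure on the orders\<close>

lemma measurable_three_cases:
  assumes [measurable]: "h \<in> measurable (restrict_space borel {0..1::real}) N" and "a \<in> space N" "b \<in> space N"
  shows "(\<lambda>s. if s = 0 then a else if s = 1 then b else h s) \<in> measurable (restrict_space borel {0..1}) N"
proof -
  have "Measurable.pred (restrict_space borel {0..1::real}) (\<lambda>s. s = c)" for c
    by (rule measurable_restrict_space1) measurable
  then have p: "{s \<in> space (restrict_space borel {0..1::real}). s = c} \<in> sets (restrict_space borel {0..1})" for c
    by (simp only: pred_def)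
  show ?thesis by (intro measurable_If p measurable_const assms)
qed

lemma c_const_measurable:
  assumes "N > 0" shows "c_const N \<in> borel_measurable (restrict_space borel {0..1})"
  unfolding c_const_eq[abs_def]
  by (intro borel_measurable_continuous_on_restrict continuous_intros gam_const_continuous assms)

lemma seminorm_sq_measurable:
  fixes u :: "'a::euclidean_space \<Rightarrow> real"
  assumes [measurable]: "u \<in> borel_measurable borel"
  shows "(\<lambda>s. seminorm_sq s u) \<in> borel_measurable (restrict_space borel {0..1})"
proof -
  let ?I = "\<lambda>s. \<integral>\<^sup>+ p. ennreal ((u (fst p) - u (snd p))\<^sup>2 / norm (fst p - snd p) powr (real DIM('a) + 2 * s)) \<partial>(lborel \<Otimes>\<^sub>M lborel)"
  interpret P: sigma_finite_measure "lborel \<Otimes>\<^sub>M lborel :: ('a \<times> 'a) measure"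
    unfolding lborel_prod by (rule sigma_finite_lborel)
  have "?I \<in> borel_measurable borel" by measurable
  then have [measurable]: "?I \<in> borel_measurable (restrict_space borel {0..1})" by (rule measurable_restrict_space1)
  note [measurable] = c_const_measurable[OF DIM_positive]
  show ?thesis unfolding seminorm_sq_def
    by (rule measurable_three_cases) simp_all
qed

text \<open>Genuine (not just almost everywhere) measurability is needed here, since the Bochner integral
  in \<open>Xinner\<close> is the junk value \<open>0\<close> for non-measurable integrands.\<close>

lemma form_measurable:
  fixes u v :: "'a::euclidean_space \<Rightarrow> real"
  assumes [measurable]: "u \<in> borel_measurable borel" "v \<in> borel_measurable borel"
  shows "(\<lambda>s. form s u v) \<in> borel_measurable (restrict_space borel {0..1})"
proof -
  let ?I = "\<lambda>s. \<integral> p. (u (fst p) - u (snd p)) * (v (fst p) - v (snd p)) / norm (fst p - snd p) powr (real DIM('a) + 2 * s) \<partial>(lborel \<Otimes>\<^sub>M lborel)"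
  interpret P: sigma_finite_measure "lborel \<Otimes>\<^sub>M lborel :: ('a \<times> 'a) measure"
    unfolding lborel_prod by (rule sigma_finite_lborel)
  have "?I \<in> borel_measurable borel" by measurable
  then have [measurable]: "?I \<in> borel_measurable (restrict_space borel {0..1})" by (rule measurable_restrict_space1)
  note [measurable] = c_const_measurable[OF DIM_positive]
  show ?thesis unfolding form_def
    by (rule measurable_three_cases) simp_all
qed

lemma nn_norm_sq_add_scaled_nonneg:
  assumes "sqint M f" "sqint M g"
  shows "0 \<le> enn2real (\<integral>\<^sup>+x. ennreal ((norm (f x))\<^sup>2) \<partial>M) + 2*t*(\<integral>x. f x \<bullet> g x \<partial>M)
        + t\<^sup>2 * enn2real (\<integral>\<^sup>+x. ennreal ((norm (g x))\<^sup>2) \<partial>M)"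
proof -
  have n: "0 \<le> (\<integral>x. (norm (f x))\<^sup>2 \<partial>M)" "0 \<le> (\<integral>x. (norm (g x))\<^sup>2 \<partial>M)" by (simp_all add: integral_nonneg_AE)
  have "0 \<le> (\<integral>x. (norm (f x + t *\<^sub>R g x))\<^sup>2 \<partial>M)" by (simp add: integral_nonneg_AE)
  then show ?thesis
    unfolding sqint_nn_eq[OF assms(1)] sqint_nn_eq[OF assms(2)] integral_norm_sq_add_scaled[OF assms] using n by simp
qed

text \<open>At every order the seminorm is the squared L2 norm of something linear in the function:
  the function itself, its weak gradient, or a difference quotient. Nonnegativity is a separate
  conclusion because \<open>ennreal\<close> truncates negative numbers to 0 and would hide a wrong
  sign.\<close>

lemma seminorm_quadratic:
  fixes u v :: "'a::euclidean_space \<Rightarrow> real"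
  assumes s: "0 \<le> s" "s \<le> 1" and [measurable]: "u \<in> borel_measurable borel" "v \<in> borel_measurable borel"
    and fin: "seminorm_sq s u < \<infinity>" "seminorm_sq s v < \<infinity>"
  shows "seminorm_sq s (\<lambda>x. u x + t * v x)
      = ennreal (enn2real (seminorm_sq s u) + 2*t*form s u v + t\<^sup>2 * enn2real (seminorm_sq s v))
    \<and> 0 \<le> enn2real (seminorm_sq s u) + 2*t*form s u v + t\<^sup>2 * enn2real (seminorm_sq s v)"
proof -
  consider "s = 0" | "s = 1" | "0 < s" "s < 1" using s by linarith
  then show ?thesis
  proof cases
    case 1
    have u: "sqint lborel u" and v: "sqint lborel v"
      using fin by (auto simp: sqint_iff_nn 1 seminorm_sq_def)
    show ?thesis
      using nn_norm_sq_add_scaled[OF u v, of t] nn_norm_sq_add_scaled_nonneg[OF u v, of t]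
      by (simp add: 1 seminorm_sq_def form_def)
  next
    case 2
    obtain G where G: "has_weak_grad u G" "sqint lborel G" using seminorm_sq_1_finite fin(1) 2 by blast
    obtain H where H: "has_weak_grad v H" "sqint lborel H" using seminorm_sq_1_finite fin(2) 2 by blast
    note wu = weak_grad_works[OF G(1)] and wv = weak_grad_works[OF H(1)]
    have u: "sqint lborel (weak_grad u)"
      using has_weak_grad_measurable[OF wu] fin(1) seminorm_sq_1[OF wu] 2 by (subst sqint_iff_nn) auto
    have v: "sqint lborel (weak_grad v)"
      using has_weak_grad_measurable[OF wv] fin(2) seminorm_sq_1[OF wv] 2 by (subst sqint_iff_nn) auto
    show ?thesis
      using nn_norm_sq_add_scaled[OF u v, of t] nn_norm_sq_add_scaled_nonneg[OF u v, of t]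
      unfolding 2 seminorm_sq_1[OF wu] seminorm_sq_1[OF wv] seminorm_sq_1[OF has_weak_grad_add_scaled[OF wu wv]]
      by (simp add: form_def)
  next
    case 3
    let ?M = "lborel \<Otimes>\<^sub>M lborel :: ('a \<times> 'a) measure" and ?c = "c_const DIM('a) s"
    \<comment> \<open>The kernel enters with half its exponent, so that the square of
      \<open>D\<close> is the Gagliardo integrand and products of two such quotients give the
      integrand of \<open>form\<close>.\<close>
    define D where "D w p = (w (fst p) - w (snd p)) / norm (fst p - snd p) powr ((real DIM('a) + 2 * s) / 2)" for w :: "'a \<Rightarrow> real" and p
    have c: "?c > 0" using gam_const_pos[of "DIM('a)" s] 3 by (simp add: c_const_eq)
    have hh: "norm x powr ((real DIM('a) + 2 * s) / 2) * norm x powr ((real DIM('a) + 2 * s) / 2) = norm x powr (real DIM('a) + 2 * s)" for x :: 'a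
      by (simp add: powr_add[symmetric])
    have S: "seminorm_sq s w = ennreal ?c * (\<integral>\<^sup>+p. ennreal ((norm (D w p))\<^sup>2) \<partial>?M)" for w :: "'a \<Rightarrow> real"
      using 3 by (simp add: seminorm_sq_def D_def power2_eq_square hh)
    have Dm: "D w \<in> borel_measurable ?M" if [measurable]: "w \<in> borel_measurable borel" for w
      unfolding D_def by measurable
    have sq: "sqint ?M (D w)" if "w \<in> borel_measurable borel" "seminorm_sq s w < \<infinity>" for w
    proof (subst sqint_iff_nn[OF Dm[OF that(1)]], rule ccontr)
      assume "\<not> (\<integral>\<^sup>+p. ennreal ((norm (D w p))\<^sup>2) \<partial>?M) < \<infinity>"
      then have "(\<integral>\<^sup>+p. ennreal ((norm (D w p))\<^sup>2) \<partial>?M) = \<infinity>" by (simp add: not_less top_unique)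
      then show False using that(2) c unfolding S by (simp add: ennreal_mult_top)
    qed
    note u = sq[OF assms(3) fin(1)] and v = sq[OF assms(4) fin(2)]
    have f: "form s u v = ?c * (\<integral>p. D u p \<bullet> D v p \<partial>?M)"
      using 3 by (simp add: form_def D_def hh)
    have lin: "D (\<lambda>x. u x + t * v x) p = D u p + t *\<^sub>R D v p" for p
      by (simp add: D_def add_divide_distrib[symmetric] algebra_simps)
    define a where "a = enn2real (\<integral>\<^sup>+p. ennreal ((norm (D u p))\<^sup>2) \<partial>?M)"
    define d where "d = enn2real (\<integral>\<^sup>+p. ennreal ((norm (D v p))\<^sup>2) \<partial>?M)"
    define b where "b = (\<integral>p. D u p \<bullet> D v p \<partial>?M)"
    have nn: "0 \<le> a + 2*t*b + t\<^sup>2*d"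
      using nn_norm_sq_add_scaled_nonneg[OF u v, of t] by (simp only: a_def b_def d_def)
    have eq: "enn2real (seminorm_sq s u) + 2*t*form s u v + t\<^sup>2 * enn2real (seminorm_sq s v) = ?c * (a + 2*t*b + t\<^sup>2*d)"
      unfolding S f using c by (simp add: enn2real_mult a_def b_def d_def algebra_simps)
    have "seminorm_sq s (\<lambda>x. u x + t * v x) = ennreal ?c * ennreal (a + 2*t*b + t\<^sup>2*d)"
      unfolding S lin nn_norm_sq_add_scaled[OF u v] a_def b_def d_def ..
    then show ?thesis unfolding eq using c nn by (simp add: ennreal_mult)
  qed
qed

section \<open>The energy as a quadratic form, and the space \<open>Xplus\<close>\<close>

locale frac_measure =
  fixes M :: "real measure"
  assumes setsM: "sets M = sets (restrict_space borel {0..1})" and finM: "finite_measure M"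
begin

lemma spaceM: "space M = {0..1}"
  using sets_eq_imp_space_eq[OF setsM] by (simp add: space_restrict_space)

lemma seminorm_sq_measurable_M [measurable]: "u \<in> borel_measurable borel \<Longrightarrow> (\<lambda>s. seminorm_sq s u) \<in> borel_measurable M"
  using seminorm_sq_measurable measurable_cong_sets[OF setsM refl] by blast

lemma form_measurable_M: "u \<in> borel_measurable borel \<Longrightarrow> v \<in> borel_measurable borel \<Longrightarrow> (\<lambda>s. form s u v) \<in> borel_measurable M"
  using form_measurable measurable_cong_sets[OF setsM refl] by blast

definition fin :: "('a::euclidean_space \<Rightarrow> real) \<Rightarrow> bool" where
  "fin u \<longleftrightarrow> u \<in> borel_measurable borel \<and> Xnorm_sq M u < \<infinity>"

abbreviation "Q u \<equiv> enn2real (Xnorm_sq M u)"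

lemma fin_AE: "fin u \<Longrightarrow> AE s in M. seminorm_sq s u < \<infinity>"
proof -
  assume u: "fin u"
  have "AE s in M. seminorm_sq s u \<noteq> \<infinity>"
  proof (rule nn_integral_PInf_AE)
    show "(\<lambda>s. seminorm_sq s u) \<in> borel_measurable M" using u by (simp add: fin_def seminorm_sq_measurable_M)
    show "(\<integral>\<^sup>+s. seminorm_sq s u \<partial>M) \<noteq> \<infinity>" using u by (auto simp: fin_def Xnorm_sq_def)
  qed
  then show ?thesis by eventually_elim (simp add: less_top[symmetric])
qed

lemma fin_integrable:
  assumes u: "fin u"
  shows "integrable M (\<lambda>s. enn2real (seminorm_sq s u))" and "(\<integral>s. enn2real (seminorm_sq s u) \<partial>M) = Q u"
proof -
  have m: "(\<lambda>s. seminorm_sq s u) \<in> borel_measurable M" using u by (simp add: fin_def seminorm_sq_measurable_M)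
  have e: "(\<integral>\<^sup>+s. ennreal (enn2real (seminorm_sq s u)) \<partial>M) = Xnorm_sq M u"
    unfolding Xnorm_sq_def by (rule nn_integral_cong_AE) (use fin_AE[OF u] in eventually_elim, simp)
  show "integrable M (\<lambda>s. enn2real (seminorm_sq s u))"
  proof (rule integrableI_nonneg)
    show "(\<lambda>s. enn2real (seminorm_sq s u)) \<in> borel_measurable M" using m by measurable
    show "(\<integral>\<^sup>+s. ennreal (enn2real (seminorm_sq s u)) \<partial>M) < \<infinity>" unfolding e using u by (simp add: fin_def)
  qed simp
  then have "(\<integral>\<^sup>+s. ennreal (enn2real (seminorm_sq s u)) \<partial>M) = ennreal (\<integral>s. enn2real (seminorm_sq s u) \<partial>M)"
    by (rule nn_integral_eq_integral) simp
  then show "(\<integral>s. enn2real (seminorm_sq s u) \<partial>M) = Q u"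
    unfolding e by (simp add: integral_nonneg_AE)
qed

lemma Xnorm_quadratic:
  assumes u: "fin u" and v: "fin v"
  shows "Xnorm_sq M (\<lambda>x. u x + t * v x) = ennreal (Q u + 2*t*Xinner M u v + t\<^sup>2 * Q v)"
    and "0 \<le> Q u + 2*t*Xinner M u v + t\<^sup>2 * Q v"
proof -
  have um: "u \<in> borel_measurable borel" and vm: "v \<in> borel_measurable borel" using u v by (auto simp: fin_def)
  let ?a = "\<lambda>s. enn2real (seminorm_sq s u)" and ?d = "\<lambda>s. enn2real (seminorm_sq s v)" and ?b = "\<lambda>s. form s u v"
  \<comment> \<open>The exceptional null set of orders is the same for all \<open>t\<close>, so t =
    1 and t = -1 can be compared at one order.\<close>
  have q: "AE s in M. \<forall>t. seminorm_sq s (\<lambda>x. u x + t * v x) = ennreal (?a s + 2*t*?b s + t\<^sup>2 * ?d s)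
      \<and> 0 \<le> ?a s + 2*t*?b s + t\<^sup>2 * ?d s"
    using fin_AE[OF u] fin_AE[OF v] AE_space
  proof eventually_elim
    case (elim s)
    then have "0 \<le> s" "s \<le> 1" by (auto simp: spaceM)
    then show ?case using seminorm_quadratic[OF _ _ um vm elim(1,2)] by blast
  qed
  have ib: "integrable M ?b"
  proof (rule Bochner_Integration.integrable_bound)
    show "integrable M (\<lambda>s. ?a s + ?d s)" using fin_integrable(1)[OF u] fin_integrable(1)[OF v] by simp
    show "?b \<in> borel_measurable M" by (rule form_measurable_M[OF um vm])
    show "AE s in M. norm (?b s) \<le> norm (?a s + ?d s)"
      using q
    proof eventually_elim
      case (elim s)
      \<comment> \<open>The values at t = 1 and t = -1 dominate the form by the sum of the two
        seminorms, which makes it integrable over the orders.\<close>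
      have "0 \<le> ?a s + 2 * ?b s + ?d s" "0 \<le> ?a s - 2 * ?b s + ?d s"
        using elim[rule_format, of 1] elim[rule_format, of "-1"] by simp_all
      moreover have "0 \<le> ?a s" "0 \<le> ?d s" by simp_all
      ultimately show ?case unfolding real_norm_def by linarith
    qed
  qed
  have ii: "integrable M (\<lambda>s. ?a s + 2*t*?b s + t\<^sup>2 * ?d s)"
    using fin_integrable(1)[OF u] fin_integrable(1)[OF v] ib by simp
  have val: "(\<integral>s. ?a s + 2*t*?b s + t\<^sup>2 * ?d s \<partial>M) = Q u + 2*t*Xinner M u v + t\<^sup>2 * Q v"
    using fin_integrable[OF u] fin_integrable[OF v] ib by (simp add: Xinner_def)
  have nn: "AE s in M. 0 \<le> ?a s + 2*t*?b s + t\<^sup>2 * ?d s" using q by eventually_elim blast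
  have "Xnorm_sq M (\<lambda>x. u x + t * v x) = (\<integral>\<^sup>+s. ennreal (?a s + 2*t*?b s + t\<^sup>2 * ?d s) \<partial>M)"
    unfolding Xnorm_sq_def by (rule nn_integral_cong_AE) (use q in eventually_elim, blast)
  also have "\<dots> = ennreal (\<integral>s. ?a s + 2*t*?b s + t\<^sup>2 * ?d s \<partial>M)" by (rule nn_integral_eq_integral[OF ii nn])
  finally show "Xnorm_sq M (\<lambda>x. u x + t * v x) = ennreal (Q u + 2*t*Xinner M u v + t\<^sup>2 * Q v)" unfolding val .
  show "0 \<le> Q u + 2*t*Xinner M u v + t\<^sup>2 * Q v"
    unfolding val[symmetric] by (rule integral_nonneg_AE[OF nn])
qed

lemma Q_add_scaled: "fin u \<Longrightarrow> fin v \<Longrightarrow> Q (\<lambda>x. u x + t * v x) = Q u + 2*t*Xinner M u v + t\<^sup>2 * Q v"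
  using Xnorm_quadratic[of u v t] by simp

lemma fin_add_scaled: "fin u \<Longrightarrow> fin v \<Longrightarrow> fin (\<lambda>x. u x + t * v x)"
  using Xnorm_quadratic(1)[of u v t] by (auto simp: fin_def)

lemma fin_diff: "fin u \<Longrightarrow> fin v \<Longrightarrow> fin (\<lambda>x. u x - v x)"
  using fin_add_scaled[of u v "-1"] by simp

lemma Q_diff: "fin u \<Longrightarrow> fin v \<Longrightarrow> Q (\<lambda>x. u x - v x) = Q u - 2*Xinner M u v + Q v"
  using Q_add_scaled[of u v "-1"] by simp

lemma fin_Xnorm: "fin u \<Longrightarrow> Xnorm_sq M u = ennreal (Q u)"
  by (simp add: fin_def)

lemma Xinner_Cauchy_Schwarz: "fin u \<Longrightarrow> fin v \<Longrightarrow> (Xinner M u v)\<^sup>2 \<le> Q u * Q v"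
  by (rule quadratic_discriminant) (rule Xnorm_quadratic(2))

lemma Xinner_commute: "Xinner M u v = Xinner M v u"
proof -
  have "form s u v = form s v u" for s
  proof -
    have 1: "(\<lambda>x. u x * v x) = (\<lambda>x. v x * u x)" by (rule ext) (rule mult.commute)
    have 2: "(\<lambda>x. weak_grad u x \<bullet> weak_grad v x) = (\<lambda>x. weak_grad v x \<bullet> weak_grad u x)" by (rule ext) (rule inner_commute)
    have 3: "(u a - u b) * (v a - v b) = (v a - v b) * (u a - u b)" for a b by (rule mult.commute)
    show ?thesis unfolding form_def 1 2 by (subst 3) (rule refl)
  qed
  then show ?thesis by (simp add: Xinner_def)
qed

lemma seminorm_zero: "seminorm_sq s (\<lambda>x::'a::euclidean_space. 0) = 0"
proof (cases "s = 1")
  case True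
  have "has_weak_grad (\<lambda>x::'a. 0) (\<lambda>x. 0)" by (auto simp: has_weak_grad_def set_integrable_def)
  from seminorm_sq_1[OF this] show ?thesis using True by simp
qed (simp add: seminorm_sq_def)

lemma Xnorm_zero: "Xnorm_sq M (\<lambda>x::'a::euclidean_space. 0) = 0"
  by (simp add: Xnorm_sq_def seminorm_zero)

text \<open>Read off from the expansion of the energy of \<open>u - u\<close>, which is 0.\<close>

lemma Xinner_self: "fin u \<Longrightarrow> Xinner M u u = Q u"
  using Q_diff[of u u] by (simp add: Xnorm_zero)

lemma Q_add_le: "fin u \<Longrightarrow> fin v \<Longrightarrow> Q (\<lambda>x. u x + v x) \<le> 2 * Q u + 2 * Q v"
  using Q_add_scaled[of u v 1] Xnorm_quadratic(2)[of u v "-1"] by simp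

lemma Q_tendsto:
  assumes f: "\<And>n. fin (f n)" "fin g" and z: "(\<lambda>n. Q (\<lambda>x. f n x - g x)) \<longlonglongrightarrow> 0"
  shows "(\<lambda>n. Q (f n)) \<longlonglongrightarrow> Q g"
proof -
  have d: "fin (\<lambda>x. f n x - g x)" for n by (rule fin_diff[OF f])
  have e: "Q (f n) = Q g + 2 * Xinner M g (\<lambda>x. f n x - g x) + Q (\<lambda>x. f n x - g x)" for n
    using Q_add_scaled[OF f(2) d[of n], of 1] by simp
  have "(\<lambda>n. Xinner M g (\<lambda>x. f n x - g x)) \<longlonglongrightarrow> 0"
  proof (rule Lim_null_comparison)
    show "(\<lambda>n. sqrt (Q g * Q (\<lambda>x. f n x - g x))) \<longlonglongrightarrow> 0"
      using tendsto_real_sqrt[OF tendsto_mult_right_zero[OF z]] by simp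
    show "\<forall>\<^sub>F n in sequentially. norm (Xinner M g (\<lambda>x. f n x - g x)) \<le> sqrt (Q g * Q (\<lambda>x. f n x - g x))"
      using Xinner_Cauchy_Schwarz[OF f(2) d] by (auto intro!: always_eventually real_le_rsqrt)
  qed
  then have "(\<lambda>n. Q g + 2 * Xinner M g (\<lambda>x. f n x - g x) + Q (\<lambda>x. f n x - g x)) \<longlonglongrightarrow> Q g + 2 * 0 + 0"
    by (rule tendsto_add[OF tendsto_add[OF tendsto_const tendsto_mult[OF tendsto_const]] z])
  then show ?thesis unfolding e by simp
qed

lemma Xinner_tendsto:
  assumes f: "\<And>n. fin (f n)" "fin g" "fin v" and z: "(\<lambda>n. Q (\<lambda>x. f n x - g x)) \<longlonglongrightarrow> 0"
  shows "(\<lambda>n. Xinner M (f n) v) \<longlonglongrightarrow> Xinner M g v"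
proof -
  \<comment> \<open>Polarisation reduces convergence of inner products to convergence of
    energies.\<close>
  have x: "Xinner M w v = (Q w + Q v - Q (\<lambda>x. w x - v x)) / 2" if "fin w" for w
    using Q_diff[OF that f(3)] by simp
  have "(\<lambda>n. Q (\<lambda>x. f n x - v x)) \<longlonglongrightarrow> Q (\<lambda>x. g x - v x)"
    by (rule Q_tendsto[OF fin_diff[OF f(1) f(3)] fin_diff[OF f(2) f(3)]]) (use z in simp)
  then have "(\<lambda>n. (Q (f n) + Q v - Q (\<lambda>x. f n x - v x)) / 2) \<longlonglongrightarrow> (Q g + Q v - Q (\<lambda>x. g x - v x)) / 2"
    by (rule tendsto_divide[OF tendsto_diff[OF tendsto_add[OF Q_tendsto[OF f(1,2) z] tendsto_const]] tendsto_const]) simp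
  then show ?thesis unfolding x[OF f(1)] x[OF f(2)] .
qed

lemma Cc_inf_fin: assumes \<phi>: "\<phi> \<in> Cc_inf (\<Omega> :: 'a::euclidean_space set)" shows "fin \<phi>"
proof -
  obtain B where B: "\<And>(u :: 'a \<Rightarrow> real) G s. has_weak_grad u G \<Longrightarrow> sqint lborel u \<Longrightarrow> sqint lborel G \<Longrightarrow> 0 \<le> s \<Longrightarrow> s \<le> 1 \<Longrightarrow>
    seminorm_sq s u \<le> ennreal B * (nrm_sq u + (\<integral>\<^sup>+x. ennreal ((norm (G x))\<^sup>2) \<partial>lborel))"
    by (rule seminorm_smooth_bound) blast
  let ?K = "ennreal B * (nrm_sq \<phi> + (\<integral>\<^sup>+x. ennreal ((norm (grad \<phi> x))\<^sup>2) \<partial>lborel))"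
  have "nrm_sq \<phi> < \<infinity>" unfolding nrm_sq_def using sqint_nn_eq[OF Cc_inf_sqint[OF \<phi>]] by simp
  moreover have "(\<integral>\<^sup>+x. ennreal ((norm (grad \<phi> x))\<^sup>2) \<partial>lborel) < \<infinity>"
    using sqint_nn_eq[OF Cc_inf_grad_sqint[OF \<phi>]] by simp
  ultimately have K: "?K < \<infinity>" by (simp add: ennreal_mult_less_top)
  have "Xnorm_sq M \<phi> \<le> (\<integral>\<^sup>+s. ?K \<partial>M)"
    unfolding Xnorm_sq_def
    by (rule nn_integral_mono) (auto simp: spaceM intro!: B Cc_inf_has_weak_grad[OF \<phi>] Cc_inf_sqint[OF \<phi>] Cc_inf_grad_sqint[OF \<phi>])
  also have "\<dots> = ?K * emeasure M (space M)" by simp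
  also have "\<dots> < \<infinity>"
    using K finite_measure.emeasure_finite[OF finM, of "space M"]
    unfolding infinity_ennreal_def ennreal_mult_less_top less_top by blast
  finally show ?thesis using Cc_inf_measurable[OF \<phi>] by (simp add: fin_def)
qed

text \<open>Convergence of the energy distances to 0 in \<open>ennreal\<close> forces one
  approximant to lie at finite distance; as test functions have finite energy, so does the
  limit.\<close>

lemma Xplus_fin: assumes u: "u \<in> Xplus M \<Omega>" shows "fin u"
proof -
  obtain \<phi> where \<phi>: "\<And>k. \<phi> k \<in> Cc_inf \<Omega>" and l: "(\<lambda>k. Xnorm_sq M (\<lambda>x. u x - \<phi> k x)) \<longlonglongrightarrow> 0"
    using u unfolding Xplus_def by blast
  have um: "u \<in> borel_measurable borel" using u by (simp add: Xplus_def)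
  have "\<forall>\<^sub>F k in sequentially. Xnorm_sq M (\<lambda>x. u x - \<phi> k x) < \<infinity>"
    using order_tendstoD(2)[OF l, of \<infinity>] by simp
  then obtain k where "Xnorm_sq M (\<lambda>x. u x - \<phi> k x) < \<infinity>" using eventually_happens'[OF sequentially_bot] by blast
  then have "fin (\<lambda>x. u x - \<phi> k x)" using um Cc_inf_measurable[OF \<phi>] by (simp add: fin_def)
  from fin_add_scaled[OF this Cc_inf_fin[OF \<phi>, of k], of 1] show ?thesis by simp
qed

lemma Xplus_approx:
  assumes u: "u \<in> Xplus M \<Omega>"
  obtains \<phi> where "\<And>k. \<phi> k \<in> Cc_inf \<Omega>" "(\<lambda>k. Q (\<lambda>x. \<phi> k x - u x)) \<longlonglongrightarrow> 0"
proof -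
  obtain \<phi> where \<phi>: "\<And>k. \<phi> k \<in> Cc_inf \<Omega>" and l: "(\<lambda>k. Xnorm_sq M (\<lambda>x. u x - \<phi> k x)) \<longlonglongrightarrow> 0"
    using u unfolding Xplus_def by blast
  note fu = Xplus_fin[OF u] and f\<phi> = Cc_inf_fin[OF \<phi>]
  have sw: "Q (\<lambda>x. \<phi> k x - u x) = Q (\<lambda>x. u x - \<phi> k x)" for k
    unfolding Q_diff[OF f\<phi> fu] Q_diff[OF fu f\<phi>] by (simp add: Xinner_commute[of u])
  have "(\<lambda>k. Q (\<lambda>x. u x - \<phi> k x)) \<longlonglongrightarrow> 0"
    using tendsto_enn2real[of "\<lambda>k. Xnorm_sq M (\<lambda>x. u x - \<phi> k x)" 0 sequentially] l by simp
  then show thesis by (intro that[of \<phi>] \<phi>) (simp add: sw)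
qed

lemma XplusI:
  assumes "sqint lborel u" "AE x in lborel. x \<notin> \<Omega> \<longrightarrow> u x = 0" "fin u"
    and \<phi>: "\<And>k. \<phi> k \<in> Cc_inf \<Omega>" and l: "(\<lambda>k. Q (\<lambda>x. u x - \<phi> k x)) \<longlonglongrightarrow> 0"
  shows "u \<in> Xplus M \<Omega>"
proof -
  have "Xnorm_sq M (\<lambda>x. u x - \<phi> k x) = ennreal (Q (\<lambda>x. u x - \<phi> k x))" for k
    by (rule fin_Xnorm[OF fin_diff[OF assms(3) Cc_inf_fin[OF \<phi>]]])
  then have "(\<lambda>k. Xnorm_sq M (\<lambda>x. u x - \<phi> k x)) \<longlonglongrightarrow> 0"
    using tendsto_ennrealI[OF l] by simp
  then show ?thesis using assms unfolding Xplus_def sqint_def by auto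
qed

lemma Xplus_sqint: "u \<in> Xplus M \<Omega> \<Longrightarrow> sqint lborel u"
  by (simp add: Xplus_def sqint_def)

lemma Xplus_add_scaled:
  assumes u: "u \<in> Xplus M \<Omega>" and v: "v \<in> Xplus M \<Omega>" shows "(\<lambda>x. u x + t * v x) \<in> Xplus M \<Omega>"
proof -
  obtain \<phi> where \<phi>: "\<And>k. \<phi> k \<in> Cc_inf \<Omega>" "(\<lambda>k. Q (\<lambda>x. \<phi> k x - u x)) \<longlonglongrightarrow> 0" by (rule Xplus_approx[OF u]) blast
  obtain \<psi> where \<psi>: "\<And>k. \<psi> k \<in> Cc_inf \<Omega>" "(\<lambda>k. Q (\<lambda>x. \<psi> k x - v x)) \<longlonglongrightarrow> 0" by (rule Xplus_approx[OF v]) blast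
  note fu = Xplus_fin[OF u] and fv = Xplus_fin[OF v]
  show ?thesis
  proof (rule XplusI)
    show "sqint lborel (\<lambda>x. u x + t * v x)"
      using sqint_add_scaled[OF Xplus_sqint[OF u] Xplus_sqint[OF v], of t] by simp
    have "AE x in lborel. x \<notin> \<Omega> \<longrightarrow> u x = 0" "AE x in lborel. x \<notin> \<Omega> \<longrightarrow> v x = 0" using u v by (auto simp: Xplus_def)
    then show "AE x in lborel. x \<notin> \<Omega> \<longrightarrow> u x + t * v x = 0" by eventually_elim auto
    show "fin (\<lambda>x. u x + t * v x)" by (rule fin_add_scaled[OF fu fv])
    show "(\<lambda>x. \<phi> k x + t * \<psi> k x) \<in> Cc_inf \<Omega>" for k by (rule Cc_inf_add_scaled[OF \<phi>(1) \<psi>(1)])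
    have fd: "fin (\<lambda>x. \<phi> k x - u x)" "fin (\<lambda>x. \<psi> k x - v x)" for k
      by (rule fin_diff[OF Cc_inf_fin[OF \<phi>(1)] fu], rule fin_diff[OF Cc_inf_fin[OF \<psi>(1)] fv])
    have b: "Q (\<lambda>x. (u x + t * v x) - (\<phi> k x + t * \<psi> k x)) \<le> 2 * Q (\<lambda>x. \<phi> k x - u x) + 2 * (t\<^sup>2 * Q (\<lambda>x. \<psi> k x - v x))" for k
    proof -
      \<comment> \<open>The scaling rules come from expanding about the zero function: its energy is
        0, so Cauchy-Schwarz removes the cross term.\<close>
      have z: "fin (\<lambda>x. 0 :: real)" by (simp add: fin_def Xnorm_zero)
      have n1: "Q (\<lambda>x. (-1) * \<phi>' x) = Q \<phi>'" if "fin \<phi>'" for \<phi>' :: "'a \<Rightarrow> real"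
        using Q_add_scaled[OF z that, of "-1"] Q_add_scaled[OF that z, of 0] Xinner_Cauchy_Schwarz[OF z that] by (simp add: Xnorm_zero)
      have n2: "Q (\<lambda>x. t * \<phi>' x) = t\<^sup>2 * Q \<phi>'" if "fin \<phi>'" for \<phi>' :: "'a \<Rightarrow> real"
        using Q_add_scaled[OF z that, of t] Xinner_Cauchy_Schwarz[OF z that] by (simp add: Xnorm_zero)
      have f2: "fin (\<lambda>x. t * (\<psi> k x - v x))" using fin_add_scaled[OF z fd(2)[of k], of t] by simp
      have f3: "fin (\<lambda>x. (\<phi> k x - u x) + t * (\<psi> k x - v x))" by (rule fin_add_scaled[OF fd(1) fd(2)])
      have "(\<lambda>x. (u x + t * v x) - (\<phi> k x + t * \<psi> k x)) = (\<lambda>x. (-1) * ((\<phi> k x - u x) + t * (\<psi> k x - v x)))"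
        by (simp add: fun_eq_iff algebra_simps)
      then have "Q (\<lambda>x. (u x + t * v x) - (\<phi> k x + t * \<psi> k x)) = Q (\<lambda>x. (\<phi> k x - u x) + t * (\<psi> k x - v x))"
        using n1[OF f3] by simp
      also have "\<dots> \<le> 2 * Q (\<lambda>x. \<phi> k x - u x) + 2 * Q (\<lambda>x. t * (\<psi> k x - v x))" by (rule Q_add_le[OF fd(1) f2])
      finally show ?thesis unfolding n2[OF fd(2)] .
    qed
    show "(\<lambda>k. Q (\<lambda>x. (u x + t * v x) - (\<phi> k x + t * \<psi> k x))) \<longlonglongrightarrow> 0"
    proof (rule Lim_null_comparison)
      show "\<forall>\<^sub>F k in sequentially. norm (Q (\<lambda>x. (u x + t * v x) - (\<phi> k x + t * \<psi> k x)))
        \<le> 2 * Q (\<lambda>x. \<phi> k x - u x) + 2 * (t\<^sup>2 * Q (\<lambda>x. \<psi> k x - v x))"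
        using b by (auto intro!: always_eventually)
      have "(\<lambda>k. 2 * Q (\<lambda>x. \<phi> k x - u x) + 2 * (t\<^sup>2 * Q (\<lambda>x. \<psi> k x - v x))) \<longlonglongrightarrow> 2 * 0 + 2 * (t\<^sup>2 * 0)"
        by (intro tendsto_intros \<phi> \<psi>)
      then show "(\<lambda>k. 2 * Q (\<lambda>x. \<phi> k x - u x) + 2 * (t\<^sup>2 * Q (\<lambda>x. \<psi> k x - v x))) \<longlonglongrightarrow> 0" by simp
    qed
  qed
qed

lemma Cc_inf_Xplus: assumes \<phi>: "\<phi> \<in> Cc_inf \<Omega>" shows "\<phi> \<in> Xplus M \<Omega>"
proof (rule XplusI[OF Cc_inf_sqint[OF \<phi>] _ Cc_inf_fin[OF \<phi>] \<phi>])
  obtain K where "K \<subseteq> \<Omega>" "\<And>x. x \<notin> K \<Longrightarrow> \<phi> x = 0" by (rule Cc_inf_support[OF \<phi>]) blast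
  then show "AE x in lborel. x \<notin> \<Omega> \<longrightarrow> \<phi> x = 0" by (intro AE_I2) auto
qed (simp add: Xnorm_zero)

end

section \<open>Compactness\<close>

text \<open>Nonnegativity of the expansion at t = 1 bounds the cross term that appears at t = -1. If
  one of the seminorms is infinite, so is the right-hand side.\<close>

lemma seminorm_sq_diff_le:
  fixes u v :: "'a::euclidean_space \<Rightarrow> real"
  assumes s: "0 \<le> s" "s \<le> 1" and m: "u \<in> borel_measurable borel" "v \<in> borel_measurable borel"
  shows "seminorm_sq s (\<lambda>x. u x - v x) \<le> 2 * seminorm_sq s u + 2 * seminorm_sq s v"
proof (cases "seminorm_sq s u < \<infinity> \<and> seminorm_sq s v < \<infinity>")
  case True
  let ?a = "enn2real (seminorm_sq s u)" and ?d = "enn2real (seminorm_sq s v)"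
  note q = seminorm_quadratic[OF s m True[THEN conjunct1] True[THEN conjunct2]]
  have "seminorm_sq s (\<lambda>x. u x - v x) = ennreal (?a - 2 * form s u v + ?d)" using q[of "-1"] by simp
  also have "\<dots> \<le> ennreal (2 * ?a + 2 * ?d)" using q[of 1] by (intro ennreal_leI) simp
  also have "\<dots> = 2 * ennreal ?a + 2 * ennreal ?d" by (simp add: ennreal_plus ennreal_mult)
  also have "\<dots> = 2 * seminorm_sq s u + 2 * seminorm_sq s v" using True by simp
  finally show ?thesis .
next
  case False
  then have "seminorm_sq s u = \<infinity> \<or> seminorm_sq s v = \<infinity>" by (auto simp: less_top[symmetric])
  then show ?thesis by (auto simp: ennreal_mult_top)
qed

text \<open>Points are labelled by their rescaled coordinates rounded down, collected into a vector
  of the space itself. For positive \<open>\<delta>\<close> the fibres are half-open cubes of side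
  \<open>\<delta>\<close>, which partition the space exactly.\<close>

definition cell_idx :: "real \<Rightarrow> 'a::euclidean_space \<Rightarrow> 'a" where
  "cell_idx \<delta> x = (\<Sum>b\<in>Basis. of_int \<lfloor>(x \<bullet> b) / \<delta>\<rfloor> *\<^sub>R b)"

definition cell :: "real \<Rightarrow> 'a::euclidean_space \<Rightarrow> 'a set" where
  "cell \<delta> z = {x. cell_idx \<delta> x = z}"

lemma cell_idx_inner: "b \<in> Basis \<Longrightarrow> cell_idx \<delta> x \<bullet> b = of_int \<lfloor>(x \<bullet> b) / \<delta>\<rfloor>"
  by (simp add: cell_idx_def inner_sum_left inner_Basis if_distrib[of "\<lambda>z. _ * z"] cong: if_cong)

lemma cell_measurable [measurable]: "cell \<delta> z \<in> sets borel"
proof -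
  have [measurable]: "cell_idx \<delta> \<in> borel_measurable borel" unfolding cell_idx_def[abs_def] by measurable
  show ?thesis unfolding cell_def by measurable
qed

lemma cell_coord:
  assumes "\<delta> > 0" "x \<in> cell \<delta> z" "b \<in> Basis"
  shows "\<delta> * (z \<bullet> b) \<le> x \<bullet> b" "x \<bullet> b < \<delta> * (z \<bullet> b + 1)"
proof -
  have z: "z \<bullet> b = of_int \<lfloor>(x \<bullet> b) / \<delta>\<rfloor>" using assms(2,3) cell_idx_inner by (auto simp: cell_def)
  have "of_int \<lfloor>(x \<bullet> b) / \<delta>\<rfloor> \<le> (x \<bullet> b) / \<delta>" "(x \<bullet> b) / \<delta> < of_int \<lfloor>(x \<bullet> b) / \<delta>\<rfloor> + 1" by linarith+
  then show "\<delta> * (z \<bullet> b) \<le> x \<bullet> b" "x \<bullet> b < \<delta> * (z \<bullet> b + 1)"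
    unfolding z using assms(1) by (simp_all only: pos_le_divide_eq pos_divide_less_eq mult.commute)
qed

text \<open>The cell lies between an open and a closed box of side \<open>\<delta>\<close>, which
  have equal volume. Labels are taken of the form \<open>cell_idx \<delta> x0\<close>, since a
  vector with non-integer coordinates has an empty cell.\<close>

lemma emeasure_cell:
  assumes \<delta>: "\<delta> > 0" shows "emeasure lborel (cell \<delta> (cell_idx \<delta> (x0::'a::euclidean_space))) = ennreal (\<delta> ^ DIM('a))"
proof (rule antisym)
  let ?z = "cell_idx \<delta> x0"
  let ?l = "\<delta> *\<^sub>R ?z" and ?u = "\<delta> *\<^sub>R (?z + One)"
  have d: "(?u - ?l) \<bullet> b = \<delta>" if "b \<in> Basis" for b
    using that by (simp add: algebra_simps)
  have le: "?l \<bullet> b \<le> ?u \<bullet> b" if "b \<in> Basis" for b using that \<delta> by (simp add: algebra_simps)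
  have p: "(\<Prod>b\<in>Basis. (?u - ?l) \<bullet> b) = \<delta> ^ DIM('a)" using d by simp
  have sub1: "cell \<delta> ?z \<subseteq> cbox ?l ?u"
  proof
    fix x assume x: "x \<in> cell \<delta> ?z"
    show "x \<in> cbox ?l ?u" unfolding mem_box
      using cell_coord(1)[OF \<delta> x] less_imp_le[OF cell_coord(2)[OF \<delta> x]] by (simp add: inner_add_left)
  qed
  have sub2: "box ?l ?u \<subseteq> cell \<delta> ?z"
  proof
    fix x assume x: "x \<in> box ?l ?u"
    have "\<lfloor>(x \<bullet> b) / \<delta>\<rfloor> = \<lfloor>(x0 \<bullet> b) / \<delta>\<rfloor>" if b: "b \<in> Basis" for b
    proof (rule floor_unique)
      have "?l \<bullet> b < x \<bullet> b" "x \<bullet> b < ?u \<bullet> b" using x b by (auto simp: mem_box)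
      then have "\<delta> * of_int \<lfloor>(x0 \<bullet> b) / \<delta>\<rfloor> < x \<bullet> b" "x \<bullet> b < \<delta> * (of_int \<lfloor>(x0 \<bullet> b) / \<delta>\<rfloor> + 1)"
        using b by (simp_all add: cell_idx_inner inner_add_left)
      then show "of_int \<lfloor>(x0 \<bullet> b) / \<delta>\<rfloor> \<le> (x \<bullet> b) / \<delta>" "(x \<bullet> b) / \<delta> < of_int \<lfloor>(x0 \<bullet> b) / \<delta>\<rfloor> + 1"
        using \<delta> by (simp_all add: field_simps)
    qed
    then show "x \<in> cell \<delta> ?z" by (simp add: cell_def cell_idx_def)
  qed
  have "emeasure lborel (cell \<delta> ?z) \<le> emeasure lborel (cbox ?l ?u)" by (rule emeasure_mono[OF sub1]) simp
  also have "\<dots> = ennreal (\<delta> ^ DIM('a))" using emeasure_lborel_cbox[OF le] unfolding p by simp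
  finally show "emeasure lborel (cell \<delta> ?z) \<le> ennreal (\<delta> ^ DIM('a))" .
  have "ennreal (\<delta> ^ DIM('a)) = emeasure lborel (box ?l ?u)" using emeasure_lborel_box[OF le] unfolding p by simp
  also have "\<dots> \<le> emeasure lborel (cell \<delta> ?z)" by (rule emeasure_mono[OF sub2]) simp
  finally show "ennreal (\<delta> ^ DIM('a)) \<le> emeasure lborel (cell \<delta> ?z)" .
qed

lemma cell_diam:
  assumes \<delta>: "\<delta> > 0" and x: "x \<in> cell \<delta> z" and y: "y \<in> cell \<delta> (z::'a::euclidean_space)"
  shows "norm (x - y) \<le> real DIM('a) * \<delta>"
proof -
  have "norm (x - y) \<le> (\<Sum>b\<in>Basis. \<bar>(x - y) \<bullet> b\<bar>)" by (rule norm_le_l1)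
  also have "\<dots> \<le> (\<Sum>b\<in>(Basis::'a set). \<delta>)"
  proof (rule sum_mono)
    fix b :: 'a assume b: "b \<in> Basis"
    have "\<delta> * (z \<bullet> b + 1) = \<delta> * (z \<bullet> b) + \<delta>" by (simp add: algebra_simps)
    then show "\<bar>(x - y) \<bullet> b\<bar> \<le> \<delta>"
      using cell_coord[OF \<delta> x b] cell_coord[OF \<delta> y b] by (simp add: inner_diff_left)
  qed
  finally show ?thesis by simp
qed

lemma finite_cell_idx:
  assumes \<delta>: "\<delta> > 0" and "bounded S" shows "finite (cell_idx \<delta> ` (S::'a::euclidean_space set))"
proof -
  obtain B where B: "\<And>x. x \<in> S \<Longrightarrow> norm x \<le> B" using assms(2) by (auto simp: bounded_iff)
  define L where "L = \<lceil>B / \<delta>\<rceil> + 1"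
  let ?T = "(\<lambda>f. \<Sum>b\<in>Basis. of_int (f b) *\<^sub>R b) ` (PiE (Basis::'a set) (\<lambda>_. {-L..L}))"
  have "cell_idx \<delta> x \<in> ?T" if x: "x \<in> S" for x
  proof
    let ?f = "restrict (\<lambda>b. \<lfloor>(x \<bullet> b) / \<delta>\<rfloor>) Basis"
    show "cell_idx \<delta> x = (\<Sum>b\<in>Basis. of_int (?f b) *\<^sub>R b)" by (simp add: cell_idx_def)
    have "\<lfloor>(x \<bullet> b) / \<delta>\<rfloor> \<in> {-L..L}" if "b \<in> Basis" for b
    proof -
      have "\<bar>x \<bullet> b\<bar> \<le> B" using Basis_le_norm[OF that, of x] B[OF x] by linarith
      then have "\<bar>(x \<bullet> b) / \<delta>\<bar> \<le> B / \<delta>" using \<delta> by (simp add: divide_right_mono)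
      then show ?thesis unfolding L_def by (simp; linarith)
    qed
    then show "?f \<in> PiE Basis (\<lambda>_. {-L..L})" by (simp add: restrict_PiE_iff)
  qed
  moreover have "finite ?T" by (intro finite_imageI finite_PiE) auto
  ultimately show ?thesis by (meson finite_subset image_subsetI)
qed

text \<open>The variance identity on a single cell: a function with small differences is controlled by
  its cell averages, which are finitely many numbers.\<close>

lemma mean_square_deviation:
  fixes w :: "'a::euclidean_space \<Rightarrow> real"
  assumes w: "sqint lborel w" and Q [measurable]: "Q \<in> sets borel" and c: "emeasure lborel Q = ennreal c" "c > 0"
  shows "(\<integral>\<^sup>+x. indicator Q x * ennreal ((w x)\<^sup>2) \<partial>lborel)
    = ennreal ((\<integral>x. indicator Q x * w x \<partial>lborel)\<^sup>2 / c)
      + ennreal (1 / (2 * c)) * (\<integral>\<^sup>+x. \<integral>\<^sup>+y. indicator Q x * indicator Q y * ennreal ((w x - w y)\<^sup>2) \<partial>lborel \<partial>lborel)"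
proof -
  have [measurable]: "w \<in> borel_measurable borel" using w by (simp add: sqint_def)
  define q where "q = indicat_real Q"
  have qq: "q x * q x = q x" for x by (simp add: q_def indicator_def)
  have [measurable]: "q \<in> borel_measurable borel" unfolding q_def by measurable
  have iq: "integrable lborel q" unfolding q_def using c by (intro integrable_real_indicator) auto
  have vq: "(\<integral>x. q x \<partial>lborel) = c" unfolding q_def using c by (simp add: measure_def)
  have sq: "sqint lborel q" using iq by (simp add: sqint_def power2_eq_square qq)
  have ig: "integrable lborel (\<lambda>x. q x * w x)" using sqint_inner_integrable[OF sq w] by simp
  have ig2: "integrable lborel (\<lambda>x. q x * (w x)\<^sup>2)"
    using integrable_real_mult_indicator[of Q lborel "\<lambda>x. (w x)\<^sup>2"] sqint_integrable[OF w] by (simp add: q_def mult.commute)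
  define I where "I = (\<integral>x. q x * w x \<partial>lborel)"
  define J where "J = (\<integral>x. q x * (w x)\<^sup>2 \<partial>lborel)"
  have inner: "(\<integral>\<^sup>+y. indicator Q x * indicator Q y * ennreal ((w x - w y)\<^sup>2) \<partial>lborel) = ennreal (q x * (c * (w x)\<^sup>2 - 2 * w x * I + J))"
    and pos: "0 \<le> c * (w x)\<^sup>2 - 2 * w x * I + J" for x
  proof -
    have e: "q y * (w x - w y)\<^sup>2 = (w x)\<^sup>2 * q y - 2 * w x * (q y * w y) + q y * (w y)\<^sup>2" for y
      by (simp add: power2_eq_square algebra_simps)
    have i: "integrable lborel (\<lambda>y. q y * (w x - w y)\<^sup>2)" unfolding e using iq ig ig2 by simp
    have v: "(\<integral>y. q y * (w x - w y)\<^sup>2 \<partial>lborel) = c * (w x)\<^sup>2 - 2 * w x * I + J"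
      unfolding e using iq ig ig2 by (simp add: vq I_def J_def)
    show "0 \<le> c * (w x)\<^sup>2 - 2 * w x * I + J" unfolding v[symmetric]
      by (intro integral_nonneg_AE AE_I2) (simp add: q_def)
    have "(\<integral>\<^sup>+y. indicator Q x * indicator Q y * ennreal ((w x - w y)\<^sup>2) \<partial>lborel) = (\<integral>\<^sup>+y. indicator Q x * ennreal (q y * (w x - w y)\<^sup>2) \<partial>lborel)"
      by (intro nn_integral_cong) (simp add: q_def indicator_def)
    also have "\<dots> = indicator Q x * (\<integral>\<^sup>+y. ennreal (q y * (w x - w y)\<^sup>2) \<partial>lborel)" by (rule nn_integral_cmult) measurable
    also have "(\<integral>\<^sup>+y. ennreal (q y * (w x - w y)\<^sup>2) \<partial>lborel) = ennreal (c * (w x)\<^sup>2 - 2 * w x * I + J)"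
      unfolding v[symmetric] by (rule nn_integral_eq_integral[OF i]) (simp add: q_def)
    finally show "(\<integral>\<^sup>+y. indicator Q x * indicator Q y * ennreal ((w x - w y)\<^sup>2) \<partial>lborel) = ennreal (q x * (c * (w x)\<^sup>2 - 2 * w x * I + J))"
      by (simp add: q_def indicator_def)
  qed
  have e2: "q x * (c * (w x)\<^sup>2 - 2 * w x * I + J) = c * (q x * (w x)\<^sup>2) - 2 * I * (q x * w x) + J * q x" for x
    by (simp add: algebra_simps)
  have i2: "integrable lborel (\<lambda>x. q x * (c * (w x)\<^sup>2 - 2 * w x * I + J))" unfolding e2 using iq ig ig2 by simp
  have v2: "(\<integral>x. q x * (c * (w x)\<^sup>2 - 2 * w x * I + J) \<partial>lborel) = 2 * (c * J - I\<^sup>2)"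
  proof -
    have "(\<integral>x. c * (q x * (w x)\<^sup>2) - 2 * I * (q x * w x) + J * q x \<partial>lborel) = c * J - 2 * I * I + J * c"
      using iq ig ig2 by (simp add: vq I_def[symmetric] J_def[symmetric])
    then show ?thesis unfolding e2 by (simp add: power2_eq_square)
  qed
  have dd: "(\<integral>\<^sup>+x. \<integral>\<^sup>+y. indicator Q x * indicator Q y * ennreal ((w x - w y)\<^sup>2) \<partial>lborel \<partial>lborel) = ennreal (2 * (c * J - I\<^sup>2))"
    unfolding inner v2[symmetric] by (rule nn_integral_eq_integral[OF i2]) (use pos in \<open>simp add: q_def\<close>)
  have dp: "0 \<le> c * J - I\<^sup>2"
  proof -
    have "0 \<le> (\<integral>x. q x * (c * (w x)\<^sup>2 - 2 * w x * I + J) \<partial>lborel)"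
      by (intro integral_nonneg_AE AE_I2 mult_nonneg_nonneg pos) (simp add: q_def)
    then show ?thesis unfolding v2 by simp
  qed
  have "(\<integral>\<^sup>+x. indicator Q x * ennreal ((w x)\<^sup>2) \<partial>lborel) = (\<integral>\<^sup>+x. ennreal (q x * (w x)\<^sup>2) \<partial>lborel)"
    by (intro nn_integral_cong) (simp add: q_def indicator_def)
  also have "\<dots> = ennreal J" unfolding J_def by (rule nn_integral_eq_integral[OF ig2]) (simp add: q_def)
  also have "J = I\<^sup>2 / c + 1 / (2 * c) * (2 * (c * J - I\<^sup>2))" using c(2) by (simp add: field_simps)
  also have "ennreal \<dots> = ennreal (I\<^sup>2 / c) + ennreal (1 / (2 * c)) * ennreal (2 * (c * J - I\<^sup>2))"
    using c(2) dp by (simp add: ennreal_plus ennreal_mult[symmetric])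
  finally show ?thesis unfolding dd I_def q_def .
qed

section \<open>Compactness from cell averages\<close>

context domain begin

lemma supp_diff: "supp u \<Longrightarrow> supp v \<Longrightarrow> supp (\<lambda>x. u x - v x)"
  unfolding supp_def by (auto intro!: sqint_diff)

lemma bounded_domain: "bounded \<Omega>"
proof (cases "\<Omega> = {}")
  case False
  then obtain y where y: "y \<in> \<Omega>" by blast
  show ?thesis unfolding bounded_iff
  proof (intro exI ballI)
    fix x assume "x \<in> \<Omega>"
    from diam[OF this y] show "norm x \<le> R + norm y" using norm_triangle_ineq[of "x - y" y] by simp
  qed
qed simp

text \<open>Collects three factors: 1/(2 \<delta>^N) from the variance identity, a bound for |x -
  y|^(N + 2s) on a cell of diameter at most N \<delta>, and 1/\<open>c_const\<close> to pass from
  the kernel integral to the seminorm. The net power of \<delta> is 2s, so the constant tends to 0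
  with \<delta>.\<close>

definition cell_const :: "real \<Rightarrow> real \<Rightarrow> real" where
  "cell_const s \<delta> = 1 / (2 * \<delta> ^ DIM('a)) * (real DIM('a) * \<delta>) powr (real DIM('a) + 2 * s) / c_const DIM('a) s"

lemma cell_const_eq:
  "\<delta> > 0 \<Longrightarrow> cell_const s \<delta> = real DIM('a) powr (real DIM('a) + 2 * s) / (2 * c_const DIM('a) s) * \<delta> powr (2 * s)"
  by (simp add: cell_const_def powr_mult powr_add powr_realpow)

text \<open>The variance identity is summed over the cells that meet the domain. The squares of
  distinct cells are disjoint in the product space, so the double integrals add up to at most the
  full Gagliardo integral.\<close>

lemma cell_bound:
  assumes \<delta>: "\<delta> > 0" and s: "0 < s" "s < 1" and w: "supp w"
  shows "nrm_sq w \<le> (\<Sum>z\<in>cell_idx \<delta> ` \<Omega>. ennreal ((\<integral>x. indicator (cell \<delta> z) x * w x \<partial>lborel)\<^sup>2 / \<delta> ^ DIM('a)))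
    + ennreal (cell_const s \<delta>) * seminorm_sq s w"
proof -
  let ?N = "DIM('a)" and ?Z = "cell_idx \<delta> ` \<Omega>"
  let ?c = "c_const ?N s" and ?\<rho> = "(real ?N * \<delta>) powr (real ?N + 2 * s)"
  have fin: "finite ?Z" by (rule finite_cell_idx[OF \<delta> bounded_domain])
  note sw = supp_sqint[OF w] and [measurable] = supp_measurable[OF w]
  have c: "?c > 0" by (rule c_const_pos[OF s])
  let ?D = "\<lambda>x y. ennreal ((w x - w y)\<^sup>2)"
  let ?K = "\<lambda>x y. ennreal ((w x - w y)\<^sup>2 / norm (x - y) powr (real ?N + 2 * s))"
  have [measurable]: "(\<lambda>(x, y). ?K x y) \<in> borel_measurable (lborel \<Otimes>\<^sub>M lborel)" by measurable
  have "nrm_sq w \<le> (\<integral>\<^sup>+x. (\<Sum>z\<in>?Z. indicator (cell \<delta> z) x * ennreal ((w x)\<^sup>2)) \<partial>lborel)"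
    unfolding nrm_sq_def
  proof (rule nn_integral_mono_AE)
    have "AE x in lborel. x \<notin> \<Omega> \<longrightarrow> w x = 0" using w by (simp add: supp_def)
    then show "AE x in lborel. ennreal ((w x)\<^sup>2) \<le> (\<Sum>z\<in>?Z. indicator (cell \<delta> z) x * ennreal ((w x)\<^sup>2))"
    proof eventually_elim
      case (elim x)
      show ?case
      proof (cases "x \<in> \<Omega>")
        case True
        have "ennreal ((w x)\<^sup>2) = indicator (cell \<delta> (cell_idx \<delta> x)) x * ennreal ((w x)\<^sup>2)" by (simp add: cell_def)
        also have "\<dots> \<le> (\<Sum>z\<in>?Z. indicator (cell \<delta> z) x * ennreal ((w x)\<^sup>2))"
          using True by (intro member_le_sum fin) auto
        finally show ?thesis .
      qed (use elim in simp)
    qed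
  qed
  also have "\<dots> = (\<Sum>z\<in>?Z. \<integral>\<^sup>+x. indicator (cell \<delta> z) x * ennreal ((w x)\<^sup>2) \<partial>lborel)"
    by (rule nn_integral_sum) measurable
  also have "\<dots> = (\<Sum>z\<in>?Z. ennreal ((\<integral>x. indicator (cell \<delta> z) x * w x \<partial>lborel)\<^sup>2 / \<delta> ^ ?N)
      + ennreal (1 / (2 * \<delta> ^ ?N)) * (\<integral>\<^sup>+x. \<integral>\<^sup>+y. indicator (cell \<delta> z) x * indicator (cell \<delta> z) y * ?D x y \<partial>lborel \<partial>lborel))"
  proof (rule sum.cong[OF refl])
    fix z assume "z \<in> ?Z"
    then obtain x0 where z: "z = cell_idx \<delta> x0" by blast
    show "(\<integral>\<^sup>+x. indicator (cell \<delta> z) x * ennreal ((w x)\<^sup>2) \<partial>lborel)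
      = ennreal ((\<integral>x. indicator (cell \<delta> z) x * w x \<partial>lborel)\<^sup>2 / \<delta> ^ ?N)
      + ennreal (1 / (2 * \<delta> ^ ?N)) * (\<integral>\<^sup>+x. \<integral>\<^sup>+y. indicator (cell \<delta> z) x * indicator (cell \<delta> z) y * ?D x y \<partial>lborel \<partial>lborel)"
      unfolding z by (rule mean_square_deviation[OF sw cell_measurable emeasure_cell[OF \<delta>]]) (use \<delta> in simp)
  qed
  also have "\<dots> = (\<Sum>z\<in>?Z. ennreal ((\<integral>x. indicator (cell \<delta> z) x * w x \<partial>lborel)\<^sup>2 / \<delta> ^ ?N))
      + ennreal (1 / (2 * \<delta> ^ ?N)) * (\<Sum>z\<in>?Z. \<integral>\<^sup>+x. \<integral>\<^sup>+y. indicator (cell \<delta> z) x * indicator (cell \<delta> z) y * ?D x y \<partial>lborel \<partial>lborel)"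
    by (simp add: sum.distrib sum_distrib_left)
  also have "(\<Sum>z\<in>?Z. \<integral>\<^sup>+x. \<integral>\<^sup>+y. indicator (cell \<delta> z) x * indicator (cell \<delta> z) y * ?D x y \<partial>lborel \<partial>lborel)
     = (\<integral>\<^sup>+x. \<integral>\<^sup>+y. (\<Sum>z\<in>?Z. indicator (cell \<delta> z) x * indicator (cell \<delta> z) y * ?D x y) \<partial>lborel \<partial>lborel)"
  proof -
    have "(\<integral>\<^sup>+x. \<integral>\<^sup>+y. (\<Sum>z\<in>?Z. indicator (cell \<delta> z) x * indicator (cell \<delta> z) y * ?D x y) \<partial>lborel \<partial>lborel)
      = (\<integral>\<^sup>+x. (\<Sum>z\<in>?Z. \<integral>\<^sup>+y. indicator (cell \<delta> z) x * indicator (cell \<delta> z) y * ?D x y \<partial>lborel) \<partial>lborel)"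
      by (intro nn_integral_cong nn_integral_sum) measurable
    also have "\<dots> = (\<Sum>z\<in>?Z. \<integral>\<^sup>+x. \<integral>\<^sup>+y. indicator (cell \<delta> z) x * indicator (cell \<delta> z) y * ?D x y \<partial>lborel \<partial>lborel)"
      by (rule nn_integral_sum) measurable
    finally show ?thesis by simp
  qed
  also have "\<dots> \<le> (\<integral>\<^sup>+x. \<integral>\<^sup>+y. ennreal ?\<rho> * ?K x y \<partial>lborel \<partial>lborel)"
  proof (intro nn_integral_mono)
    fix x y
    show "(\<Sum>z\<in>?Z. indicator (cell \<delta> z) x * indicator (cell \<delta> z) y * ?D x y) \<le> ennreal ?\<rho> * ?K x y"
    \<comment> \<open>For two points of one cell at most one summand survives, and for points of
      different cells none does. The case x = y is set apart because the kernel divides by |x -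
      y|.\<close>
    proof (cases "cell_idx \<delta> x = cell_idx \<delta> y \<and> x \<noteq> y")
      case True
      have "(\<Sum>z\<in>?Z. indicator (cell \<delta> z) x * indicator (cell \<delta> z) y * ?D x y) = (\<Sum>z\<in>?Z. if z = cell_idx \<delta> x then ?D x y else 0)"
        using True by (intro sum.cong) (auto simp: cell_def indicator_def)
      also have "\<dots> \<le> ?D x y" using fin by (simp add: sum.delta)
      also have "\<dots> \<le> ennreal (?\<rho> * ((w x - w y)\<^sup>2 / norm (x - y) powr (real ?N + 2 * s)))"
      proof (rule ennreal_leI)
        have "norm (x - y) \<le> real ?N * \<delta>" by (rule cell_diam[OF \<delta>, of _ "cell_idx \<delta> x"]) (use True in \<open>auto simp: cell_def\<close>)
        then have "norm (x - y) powr (real ?N + 2 * s) \<le> ?\<rho>" using s by (intro powr_mono2) auto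
        then have "(w x - w y)\<^sup>2 * norm (x - y) powr (real ?N + 2 * s) \<le> (w x - w y)\<^sup>2 * ?\<rho>" by (intro mult_left_mono) auto
        moreover have "0 < norm (x - y) powr (real ?N + 2 * s)" using True by simp
        ultimately show "(w x - w y)\<^sup>2 \<le> ?\<rho> * ((w x - w y)\<^sup>2 / norm (x - y) powr (real ?N + 2 * s))"
          by (simp add: pos_le_divide_eq mult.commute)
      qed
      also have "\<dots> = ennreal ?\<rho> * ?K x y" by (rule ennreal_mult) auto
      finally show ?thesis .
    next
      case False
      then have "(\<Sum>z\<in>?Z. indicator (cell \<delta> z) x * indicator (cell \<delta> z) y * ?D x y) = 0"
        by (intro sum.neutral ballI) (auto simp: cell_def indicator_def)
      then show ?thesis by (rule order_trans[OF eq_refl zero_le])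
    qed
  qed
  also have "\<dots> = ennreal ?\<rho> * (\<integral>\<^sup>+x. \<integral>\<^sup>+y. ?K x y \<partial>lborel \<partial>lborel)"
    by (simp add: nn_integral_cmult)
  also have "(\<integral>\<^sup>+x. \<integral>\<^sup>+y. ?K x y \<partial>lborel \<partial>lborel) = ennreal (1 / ?c) * seminorm_sq s w"
  proof -
    have 1: "(\<integral>\<^sup>+x. \<integral>\<^sup>+y. ?K x y \<partial>lborel \<partial>lborel)
      = (\<integral>\<^sup>+p. ennreal ((w (fst p) - w (snd p))\<^sup>2 / norm (fst p - snd p) powr (real ?N + 2 * s)) \<partial>(lborel \<Otimes>\<^sub>M lborel))"
      using lborel.nn_integral_fst[of "\<lambda>(x, y). ?K x y" lborel] by (simp add: case_prod_beta')
    have "ennreal (1 / ?c) * ennreal ?c = 1" using c by (simp add: ennreal_mult[symmetric])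
    then show ?thesis unfolding 1 using s by (simp add: seminorm_sq_def mult.assoc[symmetric])
  qed
  also have "ennreal (1 / (2 * \<delta> ^ ?N)) * (ennreal ?\<rho> * (ennreal (1 / ?c) * seminorm_sq s w)) = ennreal (cell_const s \<delta>) * seminorm_sq s w"
    using c \<delta> by (simp add: mult.assoc[symmetric] ennreal_mult[symmetric] cell_const_def)
  finally show ?thesis by (simp add: add_left_mono mult_left_mono)
qed

text \<open>The averages over cells of the scales 1/(j+1) are bounded and countable in number, so
  one diagonal subsequence makes all of them converge. Given \<open>e\<close>, a fine scale makes
  the seminorm term small, and at that scale only finitely many averages remain to be
  controlled.\<close>

lemma Rellich:
  assumes s: "0 < s" "s < 1" and w: "\<And>n. supp (w n)"
    and b: "\<And>n. seminorm_sq s (w n) \<le> ennreal K" "\<And>n. nrm_sq (w n) \<le> ennreal K" and K: "K \<ge> 0"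
  obtains r :: "nat \<Rightarrow> nat" where "strict_mono r"
    "\<And>e. e > 0 \<Longrightarrow> \<exists>N. \<forall>m\<ge>N. \<forall>n\<ge>N. nrm_sq (\<lambda>x. w (r m) x - w (r n) x) \<le> ennreal e"
proof -
  let ?N = "DIM('a)"
  define \<delta> where "\<delta> j = 1 / real (Suc j)" for j
  have \<delta>: "\<delta> j > 0" "\<delta> j \<le> 1" for j by (auto simp: \<delta>_def)
  define S where "S = (\<Union>j. Pair j ` (cell_idx (\<delta> j) ` \<Omega>))"
  define F where "F n p = (\<integral>x. indicator (cell (\<delta> (fst p)) (snd p)) x * w n x \<partial>lborel)" for n p
  have cS: "countable S" unfolding S_def
    by (intro countable_UN countable_image countable_finite[OF finite_cell_idx[OF \<delta>(1) bounded_domain]]) auto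
  have sqi: "sqint lborel (indicat_real (cell (\<delta> j) (cell_idx (\<delta> j) (x0::'a))))"
    and vqi: "(\<integral>x. (norm (indicat_real (cell (\<delta> j) (cell_idx (\<delta> j) (x0::'a))) x))\<^sup>2 \<partial>lborel) \<le> 1" for j x0
  proof -
    let ?Q = "cell (\<delta> j) (cell_idx (\<delta> j) x0)"
    have e: "(norm (indicat_real ?Q x))\<^sup>2 = indicat_real ?Q x" for x by (simp add: indicator_def)
    have "integrable lborel (indicat_real ?Q)" by (intro integrable_real_indicator) (auto simp: emeasure_cell[OF \<delta>(1)])
    then show "sqint lborel (indicat_real ?Q)" unfolding sqint_def e by simp
    have "measure lborel ?Q = \<delta> j ^ ?N" using \<delta>(1)[of j] by (simp add: measure_def emeasure_cell)
    also have "\<dots> \<le> 1" using \<delta>[of j] by (intro power_le_one) auto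
    finally show "(\<integral>x. (norm (indicat_real ?Q x))\<^sup>2 \<partial>lborel) \<le> 1" unfolding e by simp
  qed
  have bF: "norm (F n p) \<le> sqrt K" if pS: "p \<in> S" for n p
  proof -
    obtain j x0 where p: "p = (j, cell_idx (\<delta> j) x0)" using pS unfolding S_def by blast
    let ?q = "indicat_real (cell (\<delta> j) (cell_idx (\<delta> j) x0))"
    have nw: "(\<integral>x. (norm (w n x))\<^sup>2 \<partial>lborel) \<le> K"
      using b(2)[of n] sqint_nn_eq[OF supp_sqint[OF w]] K by (simp add: nrm_sq_def)
    have "(F n p)\<^sup>2 \<le> (\<integral>x. (norm (?q x))\<^sup>2 \<partial>lborel) * (\<integral>x. (norm (w n x))\<^sup>2 \<partial>lborel)"
      using sqint_Cauchy_Schwarz[OF sqi supp_sqint[OF w]] by (simp add: F_def p)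
    also have "\<dots> \<le> 1 * K" using nw vqi by (intro mult_mono) (auto simp: integral_nonneg_AE)
    finally show ?thesis by (simp add: real_le_rsqrt)
  qed
  obtain r where r: "strict_mono (r::nat\<Rightarrow>nat)" "\<And>p. p \<in> S \<Longrightarrow> \<exists>l. (\<lambda>n. F (r n) p) \<longlonglongrightarrow> l"
    using function_convergent_subsequence[OF cS, of F "sqrt K"] bF by blast
  show thesis
  proof (rule that[OF r(1)])
    fix e :: real assume e: "e > 0"
    define C where "C = real ?N powr (real ?N + 2 * s) / (2 * c_const ?N s)"
    have C: "C \<ge> 0" using c_const_pos[OF s] by (simp add: C_def)
    \<comment> \<open>The factor 4 K anticipates the seminorm bound for the difference of two
      members of the sequence.\<close>
    have "(\<lambda>j. C * (\<delta> j) powr (2 * s) * (4 * K)) \<longlonglongrightarrow> 0"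
    proof -
      have "(\<lambda>j. \<delta> j) \<longlonglongrightarrow> 0" unfolding \<delta>_def using LIMSEQ_inverse_real_of_nat by (simp add: inverse_eq_divide)
      then have "(\<lambda>j. (\<delta> j) powr (2 * s)) \<longlonglongrightarrow> 0 powr (2 * s)"
        using s by (intro tendsto_powr2) (auto intro!: always_eventually less_imp_le[OF \<delta>(1)])
      from tendsto_mult[OF tendsto_mult[OF tendsto_const[of C] this] tendsto_const[of "4 * K"]]
      show ?thesis using s by simp
    qed
    then have "\<forall>\<^sub>F j in sequentially. C * (\<delta> j) powr (2 * s) * (4 * K) < e / 2"
      using e by (intro order_tendstoD(2)) auto
    then obtain j where j: "C * (\<delta> j) powr (2 * s) * (4 * K) < e / 2" using eventually_happens'[OF sequentially_bot] by blast
    let ?Z = "cell_idx (\<delta> j) ` \<Omega>"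
    have fin: "finite ?Z" by (rule finite_cell_idx[OF \<delta>(1) bounded_domain])
    \<comment> \<open>The summand 1 keeps \<open>M\<close> positive for an empty domain. With it,
      \<open>\<eta>\<close> is the tolerance per average at which all averages together cost at most
      e/2.\<close>
    define M where "M = (\<Sum>z\<in>?Z. 1 / \<delta> j ^ ?N) + 1"
    have M: "M > 0" unfolding M_def using \<delta>(1)[of j] by (intro add_nonneg_pos sum_nonneg) auto
    define \<eta> where "\<eta> = sqrt (e / 2 / M)"
    have \<eta>: "\<eta> > 0" "\<eta>\<^sup>2 = e / 2 / M" using e M by (auto simp: \<eta>_def)
    have "\<exists>N. \<forall>m\<ge>N. \<forall>n\<ge>N. \<bar>F (r m) (j, z) - F (r n) (j, z)\<bar> < \<eta>" if "z \<in> ?Z" for z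
    proof -
      have "(j, z) \<in> S" using that by (auto simp: S_def)
      from r(2)[OF this] obtain l where "(\<lambda>n. F (r n) (j, z)) \<longlonglongrightarrow> l" by blast
      then have "Cauchy (\<lambda>n. F (r n) (j, z))" by (rule LIMSEQ_imp_Cauchy)
      from CauchyD[OF this \<eta>(1)] show ?thesis by simp
    qed
    then obtain N where N: "\<And>z m n. z \<in> ?Z \<Longrightarrow> m \<ge> N z \<Longrightarrow> n \<ge> N z \<Longrightarrow> \<bar>F (r m) (j, z) - F (r n) (j, z)\<bar> < \<eta>" by metis
    define N0 where "N0 = (\<Sum>z\<in>?Z. N z)"
    have N0: "N z \<le> N0" if "z \<in> ?Z" for z unfolding N0_def using that fin by (intro member_le_sum) auto
    show "\<exists>N. \<forall>m\<ge>N. \<forall>n\<ge>N. nrm_sq (\<lambda>x. w (r m) x - w (r n) x) \<le> ennreal e"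
    proof (intro exI[of _ N0] allI impI)
      fix m n assume mn: "m \<ge> N0" "n \<ge> N0"
      let ?d = "\<lambda>x. w (r m) x - w (r n) x"
      have sd: "supp ?d" by (rule supp_diff[OF w w])
      have Sd: "seminorm_sq s ?d \<le> ennreal (4 * K)"
      proof -
        have "seminorm_sq s ?d \<le> 2 * seminorm_sq s (w (r m)) + 2 * seminorm_sq s (w (r n))"
          by (rule seminorm_sq_diff_le) (use s supp_measurable[OF w] in auto)
        also have "\<dots> \<le> 2 * ennreal K + 2 * ennreal K" by (intro add_mono mult_left_mono b) auto
        also have "\<dots> = ennreal (2 * K) + ennreal (2 * K)" using K by (simp add: ennreal_mult)
        also have "\<dots> = ennreal (2 * K + 2 * K)" by (rule ennreal_plus[symmetric]) (use K in auto)
        finally show ?thesis by simp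
      qed
      have I: "(\<integral>x. indicator (cell (\<delta> j) z) x * ?d x \<partial>lborel)\<^sup>2 / \<delta> j ^ ?N \<le> \<eta>\<^sup>2 * (1 / \<delta> j ^ ?N)" if z: "z \<in> ?Z" for z
      proof -
        obtain x0 where x0: "z = cell_idx (\<delta> j) x0" using z by blast
        have "integrable lborel (\<lambda>x. indicator (cell (\<delta> j) z) x * w k x)" for k
          using sqint_inner_integrable[OF sqi supp_sqint[OF w]] by (simp add: x0)
        then have "(\<integral>x. indicator (cell (\<delta> j) z) x * ?d x \<partial>lborel) = F (r m) (j, z) - F (r n) (j, z)"
          by (simp add: F_def right_diff_distrib)
        moreover have "\<bar>F (r m) (j, z) - F (r n) (j, z)\<bar> < \<eta>" using N0[OF z] mn by (intro N[OF z]) auto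
        ultimately have "\<bar>\<integral>x. indicator (cell (\<delta> j) z) x * ?d x \<partial>lborel\<bar> \<le> \<eta>" by simp
        then have "(\<integral>x. indicator (cell (\<delta> j) z) x * ?d x \<partial>lborel)\<^sup>2 \<le> \<eta>\<^sup>2" using \<eta>(1) by (simp add: abs_le_square_iff[symmetric])
        then show ?thesis using \<delta>(1)[of j] by (simp add: divide_right_mono)
      qed
      have cc: "0 \<le> cell_const s (\<delta> j)" unfolding cell_const_eq[OF \<delta>(1)] C_def[symmetric] using C by simp
      have "nrm_sq ?d \<le> (\<Sum>z\<in>?Z. ennreal ((\<integral>x. indicator (cell (\<delta> j) z) x * ?d x \<partial>lborel)\<^sup>2 / \<delta> j ^ ?N)) + ennreal (cell_const s (\<delta> j)) * seminorm_sq s ?d"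
        by (rule cell_bound[OF \<delta>(1) s sd])
      also have "\<dots> \<le> (\<Sum>z\<in>?Z. ennreal (\<eta>\<^sup>2 * (1 / \<delta> j ^ ?N))) + ennreal (cell_const s (\<delta> j)) * ennreal (4 * K)"
        by (intro add_mono sum_mono ennreal_leI I mult_left_mono Sd) auto
      also have "(\<Sum>z\<in>?Z. ennreal (\<eta>\<^sup>2 * (1 / \<delta> j ^ ?N))) = ennreal (\<Sum>z\<in>?Z. \<eta>\<^sup>2 * (1 / \<delta> j ^ ?N))"
        by (rule sum_ennreal) (use \<delta>(1)[of j] in simp)
      also have "ennreal (cell_const s (\<delta> j)) * ennreal (4 * K) = ennreal (cell_const s (\<delta> j) * (4 * K))"
        by (rule ennreal_mult[symmetric]) (use cc K in auto)
      also have "ennreal (\<Sum>z\<in>?Z. \<eta>\<^sup>2 * (1 / \<delta> j ^ ?N)) + ennreal (cell_const s (\<delta> j) * (4 * K))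
        = ennreal ((\<Sum>z\<in>?Z. \<eta>\<^sup>2 * (1 / \<delta> j ^ ?N)) + cell_const s (\<delta> j) * (4 * K))"
        by (rule ennreal_plus[symmetric]) (use \<delta>(1)[of j] cc K in \<open>auto intro!: sum_nonneg\<close>)
      also have "\<dots> \<le> ennreal e"
      proof (rule ennreal_leI)
        have "(\<Sum>z\<in>?Z. \<eta>\<^sup>2 * (1 / \<delta> j ^ ?N)) = \<eta>\<^sup>2 * (M - 1)" unfolding M_def by (simp add: sum_distrib_left)
        also have "\<dots> \<le> \<eta>\<^sup>2 * M" by (intro mult_left_mono) auto
        also have "\<dots> = e / 2" unfolding \<eta>(2) using M by simp
        finally have "(\<Sum>z\<in>?Z. \<eta>\<^sup>2 * (1 / \<delta> j ^ ?N)) \<le> e / 2" .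
        moreover have "cell_const s (\<delta> j) * (4 * K) < e / 2" using j \<delta>(1)[of j] by (simp add: cell_const_eq C_def)
        ultimately show "(\<Sum>z\<in>?Z. \<eta>\<^sup>2 * (1 / \<delta> j ^ ?N)) + cell_const s (\<delta> j) * (4 * K) \<le> e" by linarith
      qed
      finally show "nrm_sq ?d \<le> ennreal e" .
    qed
  qed
qed

end

section \<open>Completeness\<close>

context frac_measure begin

text \<open>Order 1 is split off because limits are handled differently there: the orders below 1
  obey a Fatou argument, while at order 1 convergence goes through weak gradients.\<close>

lemma Xnorm_split_1:
  assumes m: "f \<in> borel_measurable borel"
  shows "Xnorm_sq M f = (\<integral>\<^sup>+s. indicator {0..<1} s * seminorm_sq s f \<partial>M) + seminorm_sq 1 f * emeasure M {1}"
proof -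
  note [measurable] = seminorm_sq_measurable_M[OF m]
  have s1: "A \<inter> {0..1} \<in> sets M" if "A \<in> sets borel" for A :: "real set"
    using that unfolding setsM by (auto simp: sets_restrict_space)
  have "{1} \<in> sets M" using s1[of "{1}"] by simp
  moreover have "{0..<1} \<in> sets M" using s1[of "{0..<1}"] by (simp add: Int_absorb2 subset_eq)
  ultimately have [measurable]: "{1} \<in> sets M" "{0..<1} \<in> sets M" by auto
  have "Xnorm_sq M f = (\<integral>\<^sup>+s. indicator {0..<1} s * seminorm_sq s f + seminorm_sq 1 f * indicator {1} s \<partial>M)"
    unfolding Xnorm_sq_def by (rule nn_integral_cong) (auto simp: spaceM indicator_def)
  also have "\<dots> = (\<integral>\<^sup>+s. indicator {0..<1} s * seminorm_sq s f \<partial>M) + (\<integral>\<^sup>+s. seminorm_sq 1 f * indicator {1} s \<partial>M)"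
    by (rule nn_integral_add) measurable
  also have "(\<integral>\<^sup>+s. seminorm_sq 1 f * indicator {1} s \<partial>M) = seminorm_sq 1 f * emeasure M {1}"
    by (rule nn_integral_cmult_indicator) measurable
  finally show ?thesis .
qed

lemma sets_M_I: "A \<in> sets borel \<Longrightarrow> A \<subseteq> {0..1} \<Longrightarrow> A \<in> sets M"
  unfolding setsM by (auto simp: sets_restrict_space image_iff intro!: bexI[of _ A])

text \<open>Chebyshev's inequality in the order variable: a lower bound on a set of orders of
  positive mass passes to the energy.\<close>

lemma le_Q_of_le_seminorm:
  assumes A: "A \<in> sets M" "0 < measure M A" and f: "fin f" and le: "\<And>s. s \<in> A \<Longrightarrow> a \<le> seminorm_sq s f"
  shows "a \<le> ennreal (Q f / measure M A)"
proof -
  let ?m = "measure M A"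
  have "a * ennreal ?m = (\<integral>\<^sup>+s. a * indicator A s \<partial>M)"
    using A(1) finite_measure.emeasure_eq_measure[OF finM, of A] by (simp add: nn_integral_cmult_indicator)
  also have "\<dots> \<le> Xnorm_sq M f"
    unfolding Xnorm_sq_def by (rule nn_integral_mono) (auto simp: indicator_def le)
  also have "\<dots> = ennreal (Q f)" by (rule fin_Xnorm[OF f])
  finally have "a * ennreal ?m * ennreal (1 / ?m) \<le> ennreal (Q f) * ennreal (1 / ?m)" by (rule mult_right_mono) simp
  moreover have "ennreal ?m * ennreal (1 / ?m) = 1" using A(2) by (simp add: ennreal_mult[symmetric])
  ultimately show ?thesis using A(2) by (simp add: mult.assoc ennreal_mult[symmetric])
qed

end

lemma shift_diff_liminf:
  fixes w :: "nat \<Rightarrow> 'a::euclidean_space \<Rightarrow> real"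
  assumes [measurable]: "f \<in> borel_measurable borel" "\<And>j. w j \<in> borel_measurable borel" "u \<in> borel_measurable borel"
    and ae: "AE x in lborel. (\<lambda>j. w j x) \<longlonglongrightarrow> u x"
  shows "shift_diff (\<lambda>x. f x - u x) h \<le> liminf (\<lambda>j. shift_diff (\<lambda>x. f x - w j x) h)"
proof -
  have "shift_diff (\<lambda>x. f x - u x) h = (\<integral>\<^sup>+x. liminf (\<lambda>j. ennreal (((f (x + h) - w j (x + h)) - (f x - w j x))\<^sup>2)) \<partial>lborel)"
    unfolding shift_diff_def
  proof (rule nn_integral_cong_AE, use ae AE_shift[OF ae, of h] in eventually_elim)
    case (elim x)
    have "(\<lambda>j. ennreal (((f (x + h) - w j (x + h)) - (f x - w j x))\<^sup>2)) \<longlonglongrightarrow> ennreal (((f (x + h) - u (x + h)) - (f x - u x))\<^sup>2)"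
      by (intro tendsto_ennrealI tendsto_power tendsto_diff tendsto_const elim)
    from lim_imp_Liminf[OF trivial_limit_sequentially this] show ?case by simp
  qed
  also have "\<dots> \<le> liminf (\<lambda>j. \<integral>\<^sup>+x. ennreal (((f (x + h) - w j (x + h)) - (f x - w j x))\<^sup>2) \<partial>lborel)"
    by (rule nn_integral_liminf) measurable
  finally show ?thesis unfolding shift_diff_def .
qed

lemma tendsto_0_le_ennreal:
  fixes f :: "'b \<Rightarrow> ennreal"
  assumes "\<And>e. e > 0 \<Longrightarrow> \<forall>\<^sub>F n in F. f n \<le> ennreal e"
  shows "(f \<longlongrightarrow> 0) F"
proof (rule order_tendstoI)
  fix a :: ennreal assume "0 < a"
  then obtain b where b: "0 < b" "b < a" using dense by blast
  then obtain c where c: "b = ennreal c" "c \<ge> 0" by (cases b) auto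
  then have "c > 0" using b by (simp add: ennreal_less_zero_iff)
  from assms[OF this] show "\<forall>\<^sub>F n in F. f n < a"
    by eventually_elim (use b c in auto)
qed simp

lemma cmult_Liminf_le: "(c::ennreal) * liminf f \<le> liminf (\<lambda>n. c * f n)"
  unfolding le_Liminf_iff
proof (intro allI impI)
  fix y assume y: "y < c * liminf f"
  show "\<forall>\<^sub>F n in sequentially. y < c * f n"
  proof -
    have l: "liminf f = (SUP n. INF k\<in>{n..}. f k)" by (rule liminf_SUP_INF)
    have "c * liminf f = (SUP n. c * (INF k\<in>{n..}. f k))" unfolding l by (rule SUP_mult_left_ennreal)
    then obtain n where n: "y < c * (INF k\<in>{n..}. f k)" using y by (auto simp: less_SUP_iff)
    show ?thesis
    proof (rule eventually_mono[OF eventually_ge_at_top[of n]])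
      fix k assume "n \<le> k"
      then have "(INF k\<in>{n..}. f k) \<le> f k" by (intro INF_lower) simp
      then have "c * (INF k\<in>{n..}. f k) \<le> c * f k" by (rule mult_left_mono) simp
      with n show "y < c * f k" by (rule less_le_trans)
    qed
  qed
qed

text \<open>Lower semicontinuity under almost everywhere convergence. For positive orders Fatou is
  applied twice, in space for each fixed shift and then in the shift.\<close>

lemma seminorm_liminf:
  fixes w :: "nat \<Rightarrow> 'a::euclidean_space \<Rightarrow> real"
  assumes s: "0 \<le> s" "s < 1" and m [measurable]: "f \<in> borel_measurable borel" "\<And>j. w j \<in> borel_measurable borel" "u \<in> borel_measurable borel"
    and ae: "AE x in lborel. (\<lambda>j. w j x) \<longlonglongrightarrow> u x"
  shows "seminorm_sq s (\<lambda>x. f x - u x) \<le> liminf (\<lambda>j. seminorm_sq s (\<lambda>x. f x - w j x))"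
proof (cases "s = 0")
  case True
  have "(\<integral>\<^sup>+x. ennreal ((f x - u x)\<^sup>2) \<partial>lborel) = (\<integral>\<^sup>+x. liminf (\<lambda>j. ennreal ((f x - w j x)\<^sup>2)) \<partial>lborel)"
  proof (rule nn_integral_cong_AE, use ae in eventually_elim)
    case (elim x)
    have "(\<lambda>j. ennreal ((f x - w j x)\<^sup>2)) \<longlonglongrightarrow> ennreal ((f x - u x)\<^sup>2)"
      by (intro tendsto_ennrealI tendsto_power tendsto_diff tendsto_const elim)
    from lim_imp_Liminf[OF trivial_limit_sequentially this] show ?case by simp
  qed
  also have "\<dots> \<le> liminf (\<lambda>j. \<integral>\<^sup>+x. ennreal ((f x - w j x)\<^sup>2) \<partial>lborel)"
    by (rule nn_integral_liminf) measurable
  finally show ?thesis unfolding True seminorm_sq_0 nrm_sq_def .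
next
  case False
  then have s': "0 < s" "s < 1" using s by auto
  have md: "(\<lambda>x. f x - u x) \<in> borel_measurable borel" "(\<lambda>x. f x - w j x) \<in> borel_measurable borel" for j by measurable
  have [measurable]: "shift_diff (\<lambda>x. f x - w j x) \<in> borel_measurable borel" for j by (rule shift_diff_measurable) measurable
  let ?c = "ennreal (c_const DIM('a) s)"
  have "(\<integral>\<^sup>+h. kern s h * shift_diff (\<lambda>x. f x - u x) h \<partial>lborel)
    \<le> (\<integral>\<^sup>+h. liminf (\<lambda>j. kern s h * shift_diff (\<lambda>x. f x - w j x) h) \<partial>lborel)"
  proof (rule nn_integral_mono)
    fix h :: 'a
    have "kern s h * shift_diff (\<lambda>x. f x - u x) h \<le> kern s h * liminf (\<lambda>j. shift_diff (\<lambda>x. f x - w j x) h)"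
      by (intro mult_left_mono shift_diff_liminf m ae) simp
    also have "\<dots> \<le> liminf (\<lambda>j. kern s h * shift_diff (\<lambda>x. f x - w j x) h)" by (rule cmult_Liminf_le)
    finally show "kern s h * shift_diff (\<lambda>x. f x - u x) h \<le> liminf (\<lambda>j. kern s h * shift_diff (\<lambda>x. f x - w j x) h)" .
  qed
  also have "\<dots> \<le> liminf (\<lambda>j. \<integral>\<^sup>+h. kern s h * shift_diff (\<lambda>x. f x - w j x) h \<partial>lborel)"
    by (rule nn_integral_liminf) measurable
  finally have "?c * (\<integral>\<^sup>+h. kern s h * shift_diff (\<lambda>x. f x - u x) h \<partial>lborel)
     \<le> ?c * liminf (\<lambda>j. \<integral>\<^sup>+h. kern s h * shift_diff (\<lambda>x. f x - w j x) h \<partial>lborel)" by (rule mult_left_mono) simp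
  also have "\<dots> \<le> liminf (\<lambda>j. ?c * (\<integral>\<^sup>+h. kern s h * shift_diff (\<lambda>x. f x - w j x) h \<partial>lborel))" by (rule cmult_Liminf_le)
  finally show ?thesis unfolding seminorm_sq_frac[OF s' md(1)] seminorm_sq_frac[OF s' md(2)] .
qed

text \<open>The gradient components are Cauchy in L2, and closedness identifies their limits as the
  weak gradient of \<open>u\<close>.\<close>

lemma seminorm_1_complete:
  fixes w :: "nat \<Rightarrow> 'a::euclidean_space \<Rightarrow> real"
  assumes w: "\<And>n. sqint lborel (w n)" "\<And>n. seminorm_sq 1 (w n) < \<infinity>" and u: "sqint lborel u"
    and l2: "(\<lambda>n. nrm_sq (\<lambda>x. w n x - u x)) \<longlonglongrightarrow> 0"
    and cau: "\<And>e. e > 0 \<Longrightarrow> \<exists>N. \<forall>m\<ge>N. \<forall>n\<ge>N. seminorm_sq 1 (\<lambda>x. w m x - w n x) \<le> ennreal e"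
  shows "(\<lambda>n. seminorm_sq 1 (\<lambda>x. w n x - u x)) \<longlonglongrightarrow> 0"
proof -
  have "\<exists>G. has_weak_grad (w n) G \<and> sqint lborel G" for n
    by (rule seminorm_sq_1_finite[OF w(2)[of n]]) blast
  then have "\<exists>G. \<forall>n. has_weak_grad (w n) (G n) \<and> sqint lborel (G n)" by (intro choice allI)
  then obtain G where G: "\<And>n. has_weak_grad (w n) (G n)" "\<And>n. sqint lborel (G n)" by blast
  have Gd: "has_weak_grad (\<lambda>x. w m x - w n x) (\<lambda>x. G m x - G n x)" for m n
    using has_weak_grad_add_scaled[OF G(1)[of m] G(1)[of n], of "-1"] by simp
  have "\<exists>g. sqint lborel g \<and> (\<lambda>n. \<integral>\<^sup>+x. ennreal ((G n x \<bullet> i - g x)\<^sup>2) \<partial>lborel) \<longlonglongrightarrow> 0" if i: "i \<in> Basis" for i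
  proof -
    have "\<exists>N. \<forall>m\<ge>N. \<forall>n\<ge>N. (\<integral>\<^sup>+x. ennreal ((G m x \<bullet> i - G n x \<bullet> i)\<^sup>2) \<partial>lborel) \<le> ennreal e" if e: "e > 0" for e
    proof -
      obtain N where N: "\<And>m n. m \<ge> N \<Longrightarrow> n \<ge> N \<Longrightarrow> seminorm_sq 1 (\<lambda>x. w m x - w n x) \<le> ennreal e" using cau[OF e] by blast
      have le: "(\<integral>\<^sup>+x. ennreal ((G m x \<bullet> i - G n x \<bullet> i)\<^sup>2) \<partial>lborel) \<le> seminorm_sq 1 (\<lambda>x. w m x - w n x)" for m n
        unfolding seminorm_sq_1[OF Gd]
      proof (rule nn_integral_mono, rule ennreal_leI)
        fix x
        have "\<bar>(G m x - G n x) \<bullet> i\<bar>\<^sup>2 \<le> (norm (G m x - G n x))\<^sup>2" by (rule power_mono[OF Basis_le_norm[OF i]]) simp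
        then show "(G m x \<bullet> i - G n x \<bullet> i)\<^sup>2 \<le> (norm (G m x - G n x))\<^sup>2" by (simp add: inner_diff_left)
      qed
      show ?thesis by (intro exI[of _ N] allI impI) (rule order_trans[OF le N])
    qed
    from L2_complete[OF sqint_component[OF G(2) i] this]
    obtain g r where "sqint lborel g" "(\<lambda>n. \<integral>\<^sup>+x. ennreal ((G n x \<bullet> i - g x)\<^sup>2) \<partial>lborel) \<longlonglongrightarrow> 0" by blast
    then show ?thesis by blast
  qed
  then have "\<exists>g. \<forall>i\<in>Basis. sqint lborel (g i) \<and> (\<lambda>n. \<integral>\<^sup>+x. ennreal ((G n x \<bullet> i - g i x)\<^sup>2) \<partial>lborel) \<longlonglongrightarrow> 0"
    by (intro bchoice ballI)
  then obtain g where g: "\<And>i. i \<in> Basis \<Longrightarrow> sqint lborel (g i)"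
    "\<And>i. i \<in> Basis \<Longrightarrow> (\<lambda>n. \<integral>\<^sup>+x. ennreal ((G n x \<bullet> i - g i x)\<^sup>2) \<partial>lborel) \<longlonglongrightarrow> 0" by blast
  define H where "H x = (\<Sum>i\<in>Basis. g i x *\<^sub>R i)" for x
  have Hi: "H x \<bullet> i = g i x" if "i \<in> Basis" for x i
    using that by (simp add: H_def inner_sum_left inner_Basis if_distrib[of "\<lambda>z. _ * z"] cong: if_cong)
  have Hs: "sqint lborel H" by (rule sqint_of_components) (simp add: Hi g)
  have Hw: "has_weak_grad u H"
    by (rule has_weak_grad_closed[OF G(1) w(1) G(2) u Hs l2[unfolded nrm_sq_def]]) (simp add: Hi g)
  have Gu: "has_weak_grad (\<lambda>x. w n x - u x) (\<lambda>x. G n x - H x)" for n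
    using has_weak_grad_add_scaled[OF G(1)[of n] Hw, of "-1"] by simp
  have mG [measurable]: "G n \<in> borel_measurable borel" for n using G(2) by (simp add: sqint_def)
  have mg: "i \<in> Basis \<Longrightarrow> g i \<in> borel_measurable borel" for i using g(1) by (simp add: sqint_def)
  have "seminorm_sq 1 (\<lambda>x. w n x - u x) = (\<Sum>i\<in>Basis. \<integral>\<^sup>+x. ennreal ((G n x \<bullet> i - g i x)\<^sup>2) \<partial>lborel)" for n
  proof -
    have "(norm (G n x - H x))\<^sup>2 = (\<Sum>i\<in>Basis. (G n x \<bullet> i - g i x)\<^sup>2)" for x
      unfolding power2_norm_eq_inner by (subst euclidean_inner) (simp add: power2_eq_square inner_diff_left Hi)
    then have "seminorm_sq 1 (\<lambda>x. w n x - u x) = (\<integral>\<^sup>+x. (\<Sum>i\<in>Basis. ennreal ((G n x \<bullet> i - g i x)\<^sup>2)) \<partial>lborel)"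
      unfolding seminorm_sq_1[OF Gu] by simp
    also have "\<dots> = (\<Sum>i\<in>Basis. \<integral>\<^sup>+x. ennreal ((G n x \<bullet> i - g i x)\<^sup>2) \<partial>lborel)"
    proof (rule nn_integral_sum)
      fix i :: 'a assume "i \<in> Basis"
      then have [measurable]: "g i \<in> borel_measurable borel" by (rule mg)
      show "(\<lambda>x. ennreal ((G n x \<bullet> i - g i x)\<^sup>2)) \<in> borel_measurable lborel" by measurable
    qed
    finally show ?thesis .
  qed
  moreover have "(\<lambda>n. \<Sum>i\<in>Basis. \<integral>\<^sup>+x. ennreal ((G n x \<bullet> i - g i x)\<^sup>2) \<partial>lborel) \<longlonglongrightarrow> (\<Sum>i\<in>(Basis::'a set). 0)"
    by (intro tendsto_sum g)
  ultimately show ?thesis by simp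
qed

context frac_measure begin

text \<open>The L2 hypothesis provides the limit as an actual function; the energy distances to it
  are then controlled separately for orders below 1 and at 1. Approximability by test functions is
  inherited by a diagonal choice.\<close>

lemma Xplus_complete:
  fixes w :: "nat \<Rightarrow> 'a::euclidean_space \<Rightarrow> real"
  assumes w: "\<And>n. w n \<in> Xplus M \<Omega>"
    and l2: "\<And>e. e > 0 \<Longrightarrow> \<exists>N. \<forall>m\<ge>N. \<forall>n\<ge>N. nrm_sq (\<lambda>x. w m x - w n x) \<le> ennreal e"
    and cau: "\<And>e. e > 0 \<Longrightarrow> \<exists>N. \<forall>m\<ge>N. \<forall>n\<ge>N. Q (\<lambda>x. w m x - w n x) \<le> e"
  obtains u where "u \<in> Xplus M \<Omega>" "(\<lambda>n. Q (\<lambda>x. w n x - u x)) \<longlonglongrightarrow> 0" "(\<lambda>n. nrm_sq (\<lambda>x. w n x - u x)) \<longlonglongrightarrow> 0"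
proof -
  note fw = Xplus_fin[OF w] and sw = Xplus_sqint[OF w]
  have mw [measurable]: "w n \<in> borel_measurable borel" for n using fw by (simp add: fin_def)
  obtain u r where u: "sqint lborel u" "strict_mono r" "AE x in lborel. (\<lambda>k. w (r k) x) \<longlonglongrightarrow> u x"
    "(\<lambda>n. \<integral>\<^sup>+x. ennreal ((w n x - u x)\<^sup>2) \<partial>lborel) \<longlonglongrightarrow> 0"
    by (rule L2_complete[OF sw l2[unfolded nrm_sq_def]]) blast+
  have l2u: "(\<lambda>n. nrm_sq (\<lambda>x. w n x - u x)) \<longlonglongrightarrow> 0" using u(4) by (simp add: nrm_sq_def)
  have mu [measurable]: "u \<in> borel_measurable borel" using u(1) by (simp add: sqint_def)
  have Xd: "Xnorm_sq M (\<lambda>x. w m x - w n x) = ennreal (Q (\<lambda>x. w m x - w n x))" for m n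
    by (rule fin_Xnorm[OF fin_diff[OF fw fw]])
  have md: "(\<lambda>x. w m x - w n x) \<in> borel_measurable borel" "(\<lambda>x. w m x - u x) \<in> borel_measurable borel" for m n by measurable
  define A where "A f = (\<integral>\<^sup>+s. indicator {0..<1} s * seminorm_sq s f \<partial>M)" for f :: "'a \<Rightarrow> real"
  have "{0..<1} \<in> sets M" unfolding setsM by (auto simp: sets_restrict_space image_iff intro!: bexI[of _ "{0..<1}"])
  then have mA: "(\<lambda>s. indicator {0..<1} s * seminorm_sq s f) \<in> borel_measurable M" if "f \<in> borel_measurable borel" for f :: "'a \<Rightarrow> real"
    using seminorm_sq_measurable_M[OF that] by measurable
  have A_le: "A (\<lambda>x. w n x - u x) \<le> ennreal e" if N: "\<And>m n. m \<ge> N \<Longrightarrow> n \<ge> N \<Longrightarrow> Q (\<lambda>x. w m x - w n x) \<le> e" and n: "n \<ge> N" for n N e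
  proof -
    have "A (\<lambda>x. w n x - u x) \<le> (\<integral>\<^sup>+s. liminf (\<lambda>j. indicator {0..<1} s * seminorm_sq s (\<lambda>x. w n x - w (r j) x)) \<partial>M)"
      unfolding A_def
    proof (rule nn_integral_mono)
      fix s
      show "indicator {0..<1} s * seminorm_sq s (\<lambda>x. w n x - u x) \<le> liminf (\<lambda>j. indicator {0..<1} s * seminorm_sq s (\<lambda>x. w n x - w (r j) x))"
      proof (cases "s \<in> {0..<1}")
        case True
        then show ?thesis using seminorm_liminf[of s "w n" "\<lambda>j. w (r j)" u] mw mu u(3) by simp
      qed simp
    qed
    also have "\<dots> \<le> liminf (\<lambda>j. A (\<lambda>x. w n x - w (r j) x))"
      unfolding A_def by (rule nn_integral_liminf) (rule mA[OF md(1)])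
    also have "\<dots> \<le> liminf (\<lambda>j. ennreal e)"
    proof (rule Liminf_mono, rule eventually_mono[OF eventually_ge_at_top[of N]])
      fix j assume "N \<le> j"
      then have "N \<le> r j" using seq_suble[OF u(2), of j] by linarith
      have "A (\<lambda>x. w n x - w (r j) x) \<le> Xnorm_sq M (\<lambda>x. w n x - w (r j) x)"
        unfolding Xnorm_split_1[OF md(1)] A_def by simp
      also have "\<dots> \<le> ennreal e" by (subst Xd) (rule ennreal_leI[OF N[OF n \<open>N \<le> r j\<close>]])
      finally show "A (\<lambda>x. w n x - w (r j) x) \<le> ennreal e" .
    qed
    also have "\<dots> = ennreal e" by (simp add: Liminf_const)
    finally show ?thesis .
  qed
  have A0: "(\<lambda>n. A (\<lambda>x. w n x - u x)) \<longlonglongrightarrow> 0"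
  proof (rule tendsto_0_le_ennreal)
    fix e :: real assume "e > 0"
    from cau[OF this] obtain N where N: "\<And>m n. m \<ge> N \<Longrightarrow> n \<ge> N \<Longrightarrow> Q (\<lambda>x. w m x - w n x) \<le> e" by blast
    show "\<forall>\<^sub>F n in sequentially. A (\<lambda>x. w n x - u x) \<le> ennreal e"
      by (rule eventually_mono[OF eventually_ge_at_top[of N]]) (rule A_le[OF N])
  qed
  have S1: "(\<lambda>n. seminorm_sq 1 (\<lambda>x. w n x - u x) * emeasure M {1}) \<longlonglongrightarrow> 0"
  \<comment> \<open>Without mass at 1 the order-1 seminorm may be infinite, but its product with 0
    is 0. With mass at 1 the energy controls it.\<close>
  proof (cases "emeasure M {1} = 0")
    case False
    define m1 where "m1 = measure M {1}"
    have em: "emeasure M {1} = ennreal m1" unfolding m1_def by (rule finite_measure.emeasure_eq_measure[OF finM])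
    have m1: "m1 > 0" using False by (simp add: em measure_nonneg less_le m1_def)
    have le1: "seminorm_sq 1 f \<le> ennreal (Q f / m1)" if f: "fin f" for f :: "'a \<Rightarrow> real"
      unfolding m1_def by (rule le_Q_of_le_seminorm[OF sets_M_I _ f]) (use m1 in \<open>auto simp: m1_def\<close>)
    have fin1: "seminorm_sq 1 f < \<infinity>" if f: "fin f" for f :: "'a \<Rightarrow> real"
      using le1[OF f] by (rule le_less_trans) simp
    have "(\<lambda>n. seminorm_sq 1 (\<lambda>x. w n x - u x)) \<longlonglongrightarrow> 0"
    proof (rule seminorm_1_complete[OF sw fin1[OF fw] u(1) l2u])
      fix e :: real assume "e > 0"
      then have "e * m1 > 0" using m1 by simp
      from cau[OF this] obtain N where N: "\<And>m n. m \<ge> N \<Longrightarrow> n \<ge> N \<Longrightarrow> Q (\<lambda>x. w m x - w n x) \<le> e * m1" by blast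
      show "\<exists>N. \<forall>m\<ge>N. \<forall>n\<ge>N. seminorm_sq 1 (\<lambda>x. w m x - w n x) \<le> ennreal e"
      proof (intro exI[of _ N] allI impI)
        fix m n assume "N \<le> m" "N \<le> n"
        then have "Q (\<lambda>x. w m x - w n x) / m1 \<le> e" using N[of m n] m1 by (simp add: pos_divide_le_eq)
        then show "seminorm_sq 1 (\<lambda>x. w m x - w n x) \<le> ennreal e"
          using order_trans[OF le1[OF fin_diff[OF fw[of m] fw[of n]]] ennreal_leI] by blast
      qed
    qed
    from tendsto_mult_ennreal[OF this tendsto_const[of "emeasure M {1}"]] show ?thesis by (simp add: em)
  qed simp
  have X0: "(\<lambda>n. Xnorm_sq M (\<lambda>x. w n x - u x)) \<longlonglongrightarrow> 0"
    unfolding Xnorm_split_1[OF md(2)] A_def[symmetric] using tendsto_add[OF A0 S1] by simp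
  have "\<forall>\<^sub>F n in sequentially. Xnorm_sq M (\<lambda>x. w n x - u x) < \<infinity>"
    using order_tendstoD(2)[OF X0, of \<infinity>] by simp
  then obtain n where "Xnorm_sq M (\<lambda>x. w n x - u x) < \<infinity>" using eventually_happens'[OF sequentially_bot] by blast
  then have "fin (\<lambda>x. w n x - u x)" using md by (simp add: fin_def)
  from fin_diff[OF fw[of n] this] have fu: "fin u" by simp
  have Q0: "(\<lambda>n. Q (\<lambda>x. w n x - u x)) \<longlonglongrightarrow> 0"
    using tendsto_enn2real[of "\<lambda>n. Xnorm_sq M (\<lambda>x. w n x - u x)" 0 sequentially] X0 by simp
  \<comment> \<open>One test function for each \<open>w k\<close>, at energy distance below 1/(k+1);
    these approximate the limit as well.\<close>
  have "\<exists>\<phi>. \<phi> \<in> Cc_inf \<Omega> \<and> Q (\<lambda>x. \<phi> x - w k x) < 1 / real (Suc k)" for k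
  proof -
    obtain \<phi> where \<phi>: "\<And>j. \<phi> j \<in> Cc_inf \<Omega>" "(\<lambda>j. Q (\<lambda>x. \<phi> j x - w k x)) \<longlonglongrightarrow> 0" by (rule Xplus_approx[OF w[of k]]) blast
    have "\<forall>\<^sub>F j in sequentially. Q (\<lambda>x. \<phi> j x - w k x) < 1 / real (Suc k)" by (rule order_tendstoD(2)[OF \<phi>(2)]) simp
    then obtain j where "Q (\<lambda>x. \<phi> j x - w k x) < 1 / real (Suc k)" using eventually_happens'[OF sequentially_bot] by blast
    with \<phi>(1) show ?thesis by blast
  qed
  then have "\<exists>\<phi>. \<forall>k. \<phi> k \<in> Cc_inf \<Omega> \<and> Q (\<lambda>x. \<phi> k x - w k x) < 1 / real (Suc k)" by (intro choice allI)
  then obtain \<phi> where \<phi>: "\<And>k. \<phi> k \<in> Cc_inf \<Omega>" "\<And>k. Q (\<lambda>x. \<phi> k x - w k x) < 1 / real (Suc k)" by blast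
  note f\<phi> = Cc_inf_fin[OF \<phi>(1)]
  have sym: "Q (\<lambda>x. f x - g x) = Q (\<lambda>x. g x - f x)" if "fin f" "fin g" for f g :: "'a \<Rightarrow> real"
    unfolding Q_diff[OF that] Q_diff[OF that(2,1)] by (simp add: Xinner_commute[of f])
  have "(\<lambda>k. Q (\<lambda>x. u x - \<phi> k x)) \<longlonglongrightarrow> 0"
  proof (rule Lim_null_comparison)
    show "\<forall>\<^sub>F k in sequentially. norm (Q (\<lambda>x. u x - \<phi> k x)) \<le> 2 * Q (\<lambda>x. w k x - u x) + 2 * (1 / real (Suc k))"
    proof (rule always_eventually, rule allI)
      fix k
      have "Q (\<lambda>x. u x - \<phi> k x) = Q (\<lambda>x. \<phi> k x - u x)" by (rule sym[OF fu f\<phi>])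
      also have "\<dots> = Q (\<lambda>x. (w k x - u x) + (\<phi> k x - w k x))" by simp
      also have "\<dots> \<le> 2 * Q (\<lambda>x. w k x - u x) + 2 * Q (\<lambda>x. \<phi> k x - w k x)"
        by (rule Q_add_le[OF fin_diff[OF fw fu] fin_diff[OF f\<phi> fw]])
      finally show "norm (Q (\<lambda>x. u x - \<phi> k x)) \<le> 2 * Q (\<lambda>x. w k x - u x) + 2 * (1 / real (Suc k))"
        using \<phi>(2)[of k] by simp
    qed
    have "(\<lambda>k. 1 / real (Suc k)) \<longlonglongrightarrow> 0" using LIMSEQ_inverse_real_of_nat by (simp add: inverse_eq_divide)
    from tendsto_add[OF tendsto_mult[OF tendsto_const[of 2] Q0] tendsto_mult[OF tendsto_const[of 2] this]]
    show "(\<lambda>k. 2 * Q (\<lambda>x. w k x - u x) + 2 * (1 / real (Suc k))) \<longlonglongrightarrow> 0" by simp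
  qed
  moreover have "AE x in lborel. x \<notin> \<Omega> \<longrightarrow> u x = 0"
  proof -
    have "AE x in lborel. \<forall>n. x \<notin> \<Omega> \<longrightarrow> w n x = 0"
      unfolding AE_all_countable using w by (simp add: Xplus_def)
    with u(3) show ?thesis
    proof eventually_elim
      case (elim x)
      show ?case
      proof
        assume "x \<notin> \<Omega>"
        then have "(\<lambda>k. w (r k) x) = (\<lambda>k. 0)" using elim by simp
        then show "u x = 0" using elim(1) by (simp add: LIMSEQ_const_iff)
      qed
    qed
  qed
  ultimately have "u \<in> Xplus M \<Omega>" by (intro XplusI[OF u(1) _ fu \<phi>(1)])
  then show thesis by (rule that[OF _ Q0 l2u])
qed

end

section \<open>Coercivity and minimisers\<close>

lemma ennreal_le_divide_const:
  assumes "c > 0" "ennreal c * x \<le> y" shows "x \<le> ennreal (1 / c) * y"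
proof -
  have "ennreal (1 / c) * (ennreal c * x) \<le> ennreal (1 / c) * y" by (rule mult_left_mono[OF assms(2)]) simp
  moreover have "ennreal (1 / c) * ennreal c = 1" using assms(1) by (simp add: ennreal_mult[symmetric])
  ultimately show ?thesis by (simp add: mult.assoc[symmetric])
qed

locale domain_measure = domain \<Omega> R + frac_measure M for \<Omega> :: "'a::euclidean_space set" and R M
begin

lemma Xplus_supp: "u \<in> Xplus M \<Omega> \<Longrightarrow> supp u"
  by (auto simp: supp_def Xplus_def sqint_def)

text \<open>A shift of length \<open>R\<close> moves the support off itself, so twice the squared L2
  norm equals the squared norm of the shifted difference, which is at most R^2 times that of the
  gradient: a Poincare inequality. The order 1/2 is an arbitrary choice strictly between 0 and
  1.\<close>

lemma coercive_gradient:
  assumes m1: "0 < measure M {1}"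
  obtains C where "C > 0" "\<And>u. supp u \<Longrightarrow> fin u \<Longrightarrow> seminorm_sq (1/2) u \<le> ennreal (C * Q u)"
proof -
  obtain B where B: "B > 0" "\<And>(u :: 'a \<Rightarrow> real) G s. has_weak_grad u G \<Longrightarrow> sqint lborel u \<Longrightarrow> sqint lborel G \<Longrightarrow> 0 \<le> s \<Longrightarrow> s \<le> 1 \<Longrightarrow>
    seminorm_sq s u \<le> ennreal B * (nrm_sq u + (\<integral>\<^sup>+x. ennreal ((norm (G x))\<^sup>2) \<partial>lborel))"
    by (rule seminorm_smooth_bound) blast
  let ?m = "measure M {1}"
  show thesis
  proof (rule that[of "B * (R\<^sup>2 + 1) / ?m"])
    show "0 < B * (R\<^sup>2 + 1) / ?m" using B(1) m1 by (simp add: add_nonneg_pos)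
    fix u assume u: "supp u" and f: "fin u"
    have S1: "seminorm_sq 1 u \<le> ennreal (Q u / ?m)"
      by (rule le_Q_of_le_seminorm[OF sets_M_I m1 f]) auto
    then have "seminorm_sq 1 u < \<infinity>" by (rule le_less_trans) simp
    then obtain G where G: "has_weak_grad u G" "sqint lborel G" by (rule seminorm_sq_1_finite)
    let ?D = "\<integral>\<^sup>+x. ennreal ((norm (G x))\<^sup>2) \<partial>lborel"
    have D: "?D \<le> ennreal (Q u / ?m)" using S1 unfolding seminorm_sq_1[OF G(1)] .
    obtain b :: 'a where b: "b \<in> Basis" using nonempty_Basis by blast
    have "nrm_sq u \<le> 2 * nrm_sq u" by (simp add: mult_2)
    also have "\<dots> = shift_diff u (R *\<^sub>R b)" using Rpos b by (intro shift_diff_far[OF u, symmetric]) simp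
    also have "\<dots> \<le> ennreal ((norm (R *\<^sub>R b))\<^sup>2) * ?D"
      unfolding shift_diff_def by (rule difference_norm_le_weak_grad[OF G(1) supp_sqint[OF u] G(2)])
    also have "(norm (R *\<^sub>R b))\<^sup>2 = R\<^sup>2" using b by simp
    finally have n: "nrm_sq u \<le> ennreal (R\<^sup>2) * ?D" .
    have "seminorm_sq (1/2) u \<le> ennreal B * (nrm_sq u + ?D)" by (rule B(2)[OF G(1) supp_sqint[OF u] G(2)]) auto
    also have "\<dots> \<le> ennreal B * (ennreal (R\<^sup>2) * ?D + 1 * ?D)" by (intro mult_left_mono add_mono n) auto
    also have "\<dots> = ennreal B * (ennreal (R\<^sup>2) + ennreal 1) * ?D" by (simp add: distrib_right distrib_left mult.assoc)
    also have "ennreal (R\<^sup>2) + ennreal 1 = ennreal (R\<^sup>2 + 1)" by (rule ennreal_plus[symmetric]) auto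
    also have "ennreal B * ennreal (R\<^sup>2 + 1) * ?D \<le> ennreal B * ennreal (R\<^sup>2 + 1) * ennreal (Q u / ?m)" by (rule mult_left_mono[OF D]) simp
    also have "\<dots> = ennreal (B * (R\<^sup>2 + 1) / ?m * Q u)"
    proof -
      have nn: "0 \<le> B" "0 \<le> R\<^sup>2 + 1" "0 \<le> Q u / ?m" using B(1) m1 by auto
      have "ennreal B * ennreal (R\<^sup>2 + 1) * ennreal (Q u / ?m) = ennreal (B * (R\<^sup>2 + 1) * (Q u / ?m))"
        by (simp only: ennreal_mult nn mult_nonneg_nonneg)
      then show ?thesis by (simp add: field_simps)
    qed
    finally show "seminorm_sq (1/2) u \<le> ennreal (B * (R\<^sup>2 + 1) / ?m * Q u)" .
  qed
qed

text \<open>For \<open>s\<close> in [s1, s2] the seminorm of order \<open>s1\<close> is at most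
  \<open>lo s1 / lo s + up s s1\<close> times that of order \<open>s\<close>. The factor is bounded
  because the interval is compact and avoids 0 and 1, and averaging over the interval gives the
  energy.\<close>

lemma coercive_fractional:
  assumes s: "0 < s1" "s2 < 1" and m: "0 < measure M {s1..s2}"
  obtains C where "C > 0" "\<And>u. supp u \<Longrightarrow> fin u \<Longrightarrow> seminorm_sq s1 u \<le> ennreal (C * Q u)"
proof -
  let ?m = "measure M {s1..s2}" and ?c = "c_const DIM('a)"
  let ?k = "\<lambda>s. lo s1 / lo s + up s s1"
  have "continuous_on {s1..s2} ?k"
  proof -
    have l: "continuous_on {s1..s2} lo" by (rule continuous_on_subset[OF lo_continuous]) (use s in auto)
    have g: "continuous_on {s1..s2} (gam_const DIM('a))"
      by (rule continuous_on_subset[OF gam_const_continuous]) (use s in auto)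
    have c: "continuous_on {s1..s2} ?c" unfolding c_const_eq[abs_def] by (intro continuous_intros g)
    have p: "lo x \<noteq> 0" "?c x \<noteq> 0" if "x \<in> {s1..s2}" for x
      using that s lo_pos[of x] c_const_pos[of x] by auto
    show ?thesis unfolding up_def[abs_def] using p Rpos by (intro continuous_intros l c) auto
  qed
  then have "bounded (?k ` {s1..s2})" by (intro compact_imp_bounded compact_continuous_image) auto
  then obtain K0 where "\<forall>x\<in>?k ` {s1..s2}. norm x \<le> K0" unfolding bounded_iff by blast
  then have K0: "\<And>s. s1 \<le> s \<Longrightarrow> s \<le> s2 \<Longrightarrow> ?k s \<le> K0" by force
  define K where "K = \<bar>K0\<bar> + 1"
  have "K > 0" by (simp add: K_def add_nonneg_pos)
  moreover have "?k s \<le> K" if "s1 \<le> s" "s \<le> s2" for s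
    using K0[OF that] unfolding K_def by linarith
  ultimately have K: "K > 0" "\<And>s. s1 \<le> s \<Longrightarrow> s \<le> s2 \<Longrightarrow> ?k s \<le> K" by auto
  show thesis
  proof (rule that[of "K / ?m"])
    show "0 < K / ?m" using K(1) m by simp
    fix u assume u: "supp u" and f: "fin u"
    have le: "ennreal (1 / K) * seminorm_sq s1 u \<le> seminorm_sq s u" if "s \<in> {s1..s2}" for s
    proof -
      have s': "0 < s" "s < 1" "s1 \<le> s" "s \<le> s2" using that s by auto
      have lp: "0 < lo s" by (rule lo_pos) (use s' in auto)
      have l1: "0 \<le> lo s1" by (rule lo_nonneg) (use s' s in auto)
      have upn: "0 \<le> up s s1" by (rule up_nonneg) (use s' s in auto)
      have "nrm_sq u \<le> ennreal (1 / lo s) * seminorm_sq s u"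
        by (rule ennreal_le_divide_const[OF lp seminorm_lower[OF _ _ u]]) (use s' in auto)
      then have n: "ennreal (lo s1) * nrm_sq u \<le> ennreal (lo s1) * (ennreal (1 / lo s) * seminorm_sq s u)"
        by (rule mult_left_mono) simp
      have "seminorm_sq s1 u \<le> ennreal (lo s1) * nrm_sq u + ennreal (up s s1) * seminorm_sq s u"
        by (rule seminorm_upper[OF _ _ _ _ u]) (use s' s in auto)
      also have "\<dots> \<le> ennreal (lo s1) * (ennreal (1 / lo s) * seminorm_sq s u) + ennreal (up s s1) * seminorm_sq s u"
        by (intro add_mono n) simp
      also have "\<dots> = (ennreal (lo s1) * ennreal (1 / lo s) + ennreal (up s s1)) * seminorm_sq s u"
        by (simp add: distrib_right mult.assoc)
      also have "ennreal (lo s1) * ennreal (1 / lo s) + ennreal (up s s1) = ennreal (?k s)"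
        using lp l1 upn by (simp add: ennreal_mult[symmetric])
      also have "ennreal (?k s) * seminorm_sq s u \<le> ennreal K * seminorm_sq s u"
        by (intro mult_right_mono ennreal_leI K(2) s') simp
      finally have "ennreal (1 / K) * seminorm_sq s1 u \<le> ennreal (1 / K) * (ennreal K * seminorm_sq s u)" by (rule mult_left_mono) simp
      moreover have "ennreal (1 / K) * ennreal K = 1" using K(1) by (simp add: ennreal_mult[symmetric])
      ultimately show ?thesis by (simp add: mult.assoc[symmetric])
    qed
    have "ennreal (1 / K) * seminorm_sq s1 u \<le> ennreal (Q u / ?m)"
      by (rule le_Q_of_le_seminorm[OF sets_M_I m f le]) (use s in auto)
    from ennreal_le_divide_const[OF _ this] have "seminorm_sq s1 u \<le> ennreal K * ennreal (Q u / ?m)" using K(1) by simp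
    also have "\<dots> = ennreal (K / ?m * Q u)" using K(1) m by (simp add: ennreal_mult[symmetric])
    finally show "seminorm_sq s1 u \<le> ennreal (K / ?m * Q u)" .
  qed
qed

lemma coercive:
  assumes sbar: "0 < sbar" "sbar \<le> 1" and pos: "emeasure M {sbar..1} > 0"
  obtains s0 C where "0 < s0" "s0 < 1" "C > 0" "\<And>u. supp u \<Longrightarrow> fin u \<Longrightarrow> seminorm_sq s0 u \<le> ennreal (C * Q u)"
proof (cases "measure M {1} > 0")
  case True
  obtain C where "C > 0" "\<And>u. supp u \<Longrightarrow> fin u \<Longrightarrow> seminorm_sq (1/2) u \<le> ennreal (C * Q u)"
    by (rule coercive_gradient[OF True]) blast
  then show thesis by (intro that[of "1/2" C]) auto
next
  case False
  have em: "emeasure M A = ennreal (measure M A)" for A by (rule finite_measure.emeasure_eq_measure[OF finM])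
  have z1: "emeasure M {1} = 0" using False measure_nonneg[of M "{1}"] unfolding em by (simp add: less_le)
  have ms: "{1} \<in> sets M" "{sbar..<1} \<in> sets M" "{sbar..1 - 1 / real (Suc k)} \<in> sets M" for k
  proof -
    have "0 < 1 / real (Suc k)" by simp
    then show "{sbar..1 - 1 / real (Suc k)} \<in> sets M" using sbar by (intro sets_M_I) auto
  qed (use sbar in \<open>auto intro!: sets_M_I\<close>)
  \<comment> \<open>If 1 carries no mass, the mass of [sbar, 1] sits on [sbar, 1), a countable union
    of intervals ending below 1, so one of these has positive mass.\<close>
  have "\<exists>k. emeasure M {sbar..1 - 1 / real (Suc k)} \<noteq> 0"
  proof (rule ccontr)
    assume "\<not> ?thesis"
    then have "emeasure M (\<Union>k. {sbar..1 - 1 / real (Suc k)}) = 0" by (intro emeasure_UN_eq_0) (use ms in auto)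
    moreover have sub: "{sbar..<1} \<subseteq> (\<Union>k. {sbar..1 - 1 / real (Suc k)})"
    proof
      fix s assume s: "s \<in> {sbar..<1}"
      then have "0 < 1 - s" by simp
      then obtain k :: nat where k: "1 / real (Suc k) < 1 - s" using nat_approx_posE by blast
      then show "s \<in> (\<Union>k. {sbar..1 - 1 / real (Suc k)})" using s by (intro UN_I[of k]) auto
    qed
    moreover have um: "(\<Union>k. {sbar..1 - 1 / real (Suc k)}) \<in> sets M" using ms(3) by (intro sets.countable_UN) blast
    ultimately have z2: "emeasure M {sbar..<1} = 0" using emeasure_mono[OF sub um] by simp
    have "{sbar..1} = {sbar..<1} \<union> {1}" using sbar by auto
    then have "emeasure M {sbar..1} \<le> emeasure M {sbar..<1} + emeasure M {1}"
      using emeasure_subadditive[OF ms(2,1)] by simp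
    then show False using z1 z2 pos by simp
  qed
  then obtain k where k: "emeasure M {sbar..1 - 1 / real (Suc k)} \<noteq> 0" by blast
  then have mp: "0 < measure M {sbar..1 - 1 / real (Suc k)}" unfolding em by (simp add: less_le)
  have s2: "1 - 1 / real (Suc k) < 1" by simp
  have "sbar < 1"
  proof (rule ccontr)
    assume "\<not> sbar < 1"
    then have "1 - 1 / real (Suc k) < sbar" using s2 by linarith
    then have "{sbar..1 - 1 / real (Suc k)} = {}" by (rule atLeastatMost_empty)
    then show False using k by simp
  qed
  obtain C where "C > 0" "\<And>u. supp u \<Longrightarrow> fin u \<Longrightarrow> seminorm_sq sbar u \<le> ennreal (C * Q u)"
    by (rule coercive_fractional[OF sbar(1) s2 mp]) blast
  then show thesis using sbar(1) \<open>sbar < 1\<close> by (intro that[of sbar C]) auto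
qed

end

section \<open>Rayleigh quotients and the first eigenvalue\<close>

abbreviation nrm :: "('a::euclidean_space \<Rightarrow> real) \<Rightarrow> real" where
  "nrm u \<equiv> enn2real (nrm_sq u)"

lemma nrm_sq_eq: "sqint lborel u \<Longrightarrow> nrm_sq u = ennreal (nrm u)"
  using sqint_nn_eq[of lborel u] by (simp add: nrm_sq_def)

lemma nrm_eq: "sqint lborel u \<Longrightarrow> nrm u = (\<integral>x. (u x)\<^sup>2 \<partial>lborel)"
  using sqint_nn_eq[of lborel u] by (simp add: nrm_sq_def integral_nonneg_AE)

lemma nrm_add_scaled:
  assumes "sqint lborel u" "sqint lborel v"
  shows "nrm (\<lambda>x. u x + t * v x) = nrm u + 2 * t * (\<integral>x. u x * v x \<partial>lborel) + t\<^sup>2 * nrm v"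
  using integral_norm_sq_add_scaled[OF assms, of t] nrm_eq[OF sqint_add_scaled[OF assms, of t]]
    nrm_eq[OF assms(1)] nrm_eq[OF assms(2)] by simp

lemma nrm_pos:
  assumes "sqint lborel u" "nonzero_fun u" shows "nrm u > 0"
proof (rule ccontr)
  assume "\<not> nrm u > 0"
  then have "nrm u = 0" by (simp add: less_le)
  then have "nrm_sq u = 0" using nrm_sq_eq[OF assms(1)] by simp
  moreover have [measurable]: "u \<in> borel_measurable borel" using assms(1) by (simp add: sqint_def)
  ultimately have "AE x in lborel. ennreal ((u x)\<^sup>2) = 0"
    unfolding nrm_sq_def by (subst (asm) nn_integral_0_iff_AE) measurable
  then have "AE x in lborel. u x = 0" by eventually_elim simp
  with assms(2) show False by (simp add: nonzero_fun_def)
qed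

locale coercive_form = domain_measure +
  fixes s0 C :: real
  assumes s0: "0 < s0" "s0 < 1" and C: "C > 0"
    and coerc: "\<And>u. supp u \<Longrightarrow> fin u \<Longrightarrow> seminorm_sq s0 u \<le> ennreal (C * Q u)"
begin

lemma Poincare:
  assumes "supp u" "fin u" shows "nrm u \<le> C / lo s0 * Q u"
proof -
  have lp: "lo s0 > 0" by (rule lo_pos) (use s0 in auto)
  have "ennreal (lo s0) * nrm_sq u \<le> seminorm_sq s0 u" by (rule seminorm_lower) (use s0 assms in auto)
  also have "\<dots> \<le> ennreal (C * Q u)" by (rule coerc[OF assms])
  finally have "ennreal (lo s0 * nrm u) \<le> ennreal (C * Q u)"
    using nrm_sq_eq[OF supp_sqint[OF assms(1)]] lp by (simp add: ennreal_mult)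
  then have "lo s0 * nrm u \<le> C * Q u" using C by (subst (asm) ennreal_le_iff) auto
  then show ?thesis using lp by (simp add: field_simps)
qed

definition admissible :: "('a \<Rightarrow> real) \<Rightarrow> bool" where
  "admissible u \<longleftrightarrow> u \<in> Xplus M \<Omega> \<and> nonzero_fun u"

lemma lambda0_eq: "lambda0 M \<Omega> = Inf {Q u / nrm u | u. admissible u}"
proof -
  have "(\<integral>\<^sup>+ x\<in>\<Omega>. ennreal ((u x)\<^sup>2) \<partial>lborel) = nrm_sq u" if "u \<in> Xplus M \<Omega>" for u
  proof -
    have ae: "AE x in lborel. x \<notin> \<Omega> \<longrightarrow> u x = 0" using that by (simp add: Xplus_def)
    show ?thesis unfolding nrm_sq_def
      by (rule nn_integral_cong_AE) (use ae in \<open>eventually_elim, auto simp: indicator_def\<close>)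
  qed
  then have e: "(x = Q u / enn2real (\<integral>\<^sup>+ x\<in>\<Omega>. ennreal ((u x)\<^sup>2) \<partial>lborel) \<and> u \<in> Xplus M \<Omega> \<and> nonzero_fun u)
    \<longleftrightarrow> (x = Q u / nrm u \<and> admissible u)" for x u
    unfolding admissible_def by (cases "u \<in> Xplus M \<Omega>") simp_all
  show ?thesis unfolding lambda0_def e ..
qed

lemma admissible_facts:
  assumes "admissible u" shows "u \<in> Xplus M \<Omega>" "supp u" "fin u" "nrm u > 0"
  using assms Xplus_supp Xplus_fin nrm_pos[OF Xplus_sqint] by (auto simp: admissible_def)

lemma bdd_ratio: "bdd_below {Q u / D u | u. admissible u}" if "\<And>u. D u \<ge> (0::real)"
  by (rule bdd_belowI[of _ 0]) (use that in auto)

text \<open>Free of division, so it also covers functions of norm 0: sums of members of a minimising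
  sequence and variations of a minimiser may vanish.\<close>

lemma lambda0_le: assumes u: "u \<in> Xplus M \<Omega>" shows "lambda0 M \<Omega> * nrm u \<le> Q u"
proof (cases "nrm u = 0")
  case False
  have "nonzero_fun u"
  proof (rule ccontr)
    assume "\<not> nonzero_fun u"
    then have ae: "AE x in lborel. u x = 0" by (simp add: nonzero_fun_def)
    have "nrm_sq u = (\<integral>\<^sup>+x. 0 \<partial>(lborel :: 'a measure))" unfolding nrm_sq_def by (rule nn_integral_cong_AE) (use ae in \<open>eventually_elim, simp\<close>)
    then show False using False by simp
  qed
  then have a: "admissible u" using u by (simp add: admissible_def)
  have "lambda0 M \<Omega> \<le> Q u / nrm u"
    unfolding lambda0_eq by (rule cInf_lower[OF _ bdd_ratio]) (use a in auto)
  then show ?thesis using admissible_facts(4)[OF a] by (simp add: field_simps)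
qed simp

text \<open>The Poincare inequality bounds every quotient below by \<open>lo s0 / C\<close>. The
  function \<open>w\<close> ensures that the infimum is taken over a nonempty set.\<close>

lemma lambda0_pos: assumes "admissible w" shows "lambda0 M \<Omega> > 0"
proof -
  have lp: "lo s0 > 0" by (rule lo_pos) (use s0 in auto)
  have "lo s0 / C \<le> lambda0 M \<Omega>"
    unfolding lambda0_eq
  proof (rule cInf_greatest)
    show "{Q u / nrm u | u. admissible u} \<noteq> {}" using assms by blast
    fix x assume "x \<in> {Q u / nrm u | u. admissible u}"
    then obtain u where u: "x = Q u / nrm u" "admissible u" by blast
    show "lo s0 / C \<le> x"
      using Poincare[OF admissible_facts(2,3)[OF u(2)]] admissible_facts(4)[OF u(2)] lp C unfolding u(1) by (simp add: field_simps)
  qed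
  moreover have "lo s0 / C > 0" using lp C by simp
  ultimately show ?thesis by linarith
qed

text \<open>A pure comparison of quotients with the denominators \<open>D\<close> and
  \<open>nrm\<close>. The error \<open>\<eta> * Q u\<close> is harmless because it adds at most
  \<open>\<eta>\<close> to the reciprocal quotient, whence the shape of the lower bound.\<close>

lemma lambda_eps_bounds:
  assumes w: "admissible w" and \<eta>: "0 < \<eta>" "\<eta> < 1"
    and D: "\<And>u. u \<in> Xplus M \<Omega> \<Longrightarrow> (1 - \<eta>) * nrm u \<le> D u \<and> D u \<le> (1 + \<eta>) * nrm u + \<eta> * Q u" "\<And>u. D u \<ge> 0"
  shows "1 / ((1 + \<eta>) / lambda0 M \<Omega> + \<eta>) \<le> Inf {Q u / D u | u. admissible u}"
    and "Inf {Q u / D u | u. admissible u} \<le> lambda0 M \<Omega> / (1 - \<eta>)"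
proof -
  let ?l = "lambda0 M \<Omega>" and ?S = "{Q u / D u | u. admissible u}"
  have l: "?l > 0" by (rule lambda0_pos[OF w])
  show "1 / ((1 + \<eta>) / ?l + \<eta>) \<le> Inf ?S"
  proof (rule cInf_greatest)
    show "?S \<noteq> {}" using w by blast
    fix x assume "x \<in> ?S"
    then obtain u where u: "x = Q u / D u" "admissible u" by blast
    note a = admissible_facts[OF u(2)]
    have "0 < (1 - \<eta>) * nrm u" using a(4) \<eta> by simp
    then have Dp: "D u > 0" using D(1)[OF a(1)] by linarith
    have "nrm u \<le> Q u / ?l" using lambda0_le[OF a(1)] l by (simp add: field_simps)
    then have "(1 + \<eta>) * nrm u \<le> (1 + \<eta>) * (Q u / ?l)" using \<eta> by (intro mult_left_mono) auto
    then have "D u \<le> (1 + \<eta>) * (Q u / ?l) + \<eta> * Q u" using D(1)[OF a(1)] by linarith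
    also have "\<dots> = ((1 + \<eta>) / ?l + \<eta>) * Q u" by (simp add: algebra_simps)
    finally have "D u \<le> ((1 + \<eta>) / ?l + \<eta>) * Q u" .
    moreover have "0 < (1 + \<eta>) / ?l + \<eta>" using l \<eta> by (intro add_pos_pos divide_pos_pos) auto
    ultimately show "1 / ((1 + \<eta>) / ?l + \<eta>) \<le> x" unfolding u(1) using Dp by (simp add: pos_le_divide_eq pos_divide_le_eq mult.commute)
  qed
  show "Inf ?S \<le> ?l / (1 - \<eta>)"
  proof -
    have "(1 - \<eta>) * Inf ?S \<le> ?l"
      unfolding lambda0_eq
    proof (rule cInf_greatest)
      show "{Q u / nrm u | u. admissible u} \<noteq> {}" using w by blast
      fix x assume "x \<in> {Q u / nrm u | u. admissible u}"
      then obtain u where u: "x = Q u / nrm u" "admissible u" by blast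
      note a = admissible_facts[OF u(2)]
      have p: "0 < (1 - \<eta>) * nrm u" using a(4) \<eta> by simp
      have "Inf ?S \<le> Q u / D u" by (rule cInf_lower[OF _ bdd_ratio]) (use u D in auto)
      also have "\<dots> \<le> Q u / ((1 - \<eta>) * nrm u)" using D(1)[OF a(1)] p by (intro divide_left_mono) auto
      finally have "(1 - \<eta>) * Inf ?S \<le> (1 - \<eta>) * (Q u / ((1 - \<eta>) * nrm u))" using \<eta> by (intro mult_left_mono) auto
      also have "\<dots> = x" using \<eta> unfolding u(1) by simp
      finally show "(1 - \<eta>) * Inf ?S \<le> x" .
    qed
    then show ?thesis using \<eta> by (simp add: pos_le_divide_eq mult.commute)
  qed
qed

text \<open>As \<open>m\<close> has total mass 1 and is carried by [0, e], the bounds at single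
  orders integrate without changing their constants.\<close>

lemma Xnorm_small_order:
  assumes m: "frac_measure m" "emeasure m (space m) = 1" and e: "AE s in m. s \<le> e" "e \<le> s0"
    and \<eta>: "0 \<le> \<eta>" "\<eta> \<le> 1" "\<And>s. 0 \<le> s \<Longrightarrow> s \<le> e \<Longrightarrow> 1 - \<eta> \<le> lo s \<and> lo s \<le> 1 + \<eta> \<and> C * up s0 s \<le> \<eta>"
    and u: "supp u" "fin u"
  shows "ennreal ((1 - \<eta>) * nrm u) \<le> Xnorm_sq m u" "Xnorm_sq m u \<le> ennreal ((1 + \<eta>) * nrm u + \<eta> * Q u)"
proof -
  interpret m: frac_measure m by (rule m(1))
  note n = nrm_sq_eq[OF supp_sqint[OF u(1)]]
  have A: "AE s in m. 0 \<le> s \<and> s \<le> e" using e(1) AE_space by eventually_elim (simp add: m.spaceM)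
  have lw: "ennreal ((1 - \<eta>) * nrm u) \<le> seminorm_sq s u" if "0 \<le> s" "s \<le> e" for s
  proof -
    have "ennreal ((1 - \<eta>) * nrm u) \<le> ennreal (lo s * nrm u)" using \<eta>(3)[OF that] by (intro ennreal_leI mult_right_mono) auto
    also have "\<dots> = ennreal (lo s) * nrm_sq u" 
      by (rule trans[OF ennreal_mult'' arg_cong[where f="\<lambda>x. ennreal (lo s) * x", OF n[symmetric]]]) simp
    also have "\<dots> \<le> seminorm_sq s u" by (rule seminorm_lower) (use that e s0 u in auto)
    finally show ?thesis .
  qed
  have upb: "seminorm_sq s u \<le> ennreal ((1 + \<eta>) * nrm u + \<eta> * Q u)" if "0 \<le> s" "s \<le> e" for s
  proof -
    have un: "0 \<le> up s0 s" by (rule up_nonneg) (use that e s0 in auto)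
    have "seminorm_sq s u \<le> ennreal (lo s) * nrm_sq u + ennreal (up s0 s) * seminorm_sq s0 u"
      by (rule seminorm_upper) (use that e s0 u in auto)
    also have "\<dots> \<le> ennreal (1 + \<eta>) * ennreal (nrm u) + ennreal (up s0 s) * ennreal (C * Q u)"
      unfolding n[symmetric] using \<eta>(3)[OF that] by (intro add_mono mult_right_mono mult_left_mono coerc u ennreal_leI) auto
    also have "\<dots> = ennreal ((1 + \<eta>) * nrm u + up s0 s * (C * Q u))"
      using \<eta> un C by (subst ennreal_plus) (auto simp: ennreal_mult)
    also have "\<dots> \<le> ennreal ((1 + \<eta>) * nrm u + \<eta> * Q u)"
    proof (intro ennreal_leI add_left_mono)
      have "(C * up s0 s) * Q u \<le> \<eta> * Q u" using \<eta>(3)[OF that] by (intro mult_right_mono) auto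
      then show "up s0 s * (C * Q u) \<le> \<eta> * Q u" by (simp add: mult_ac)
    qed
    finally show ?thesis .
  qed
  have "ennreal ((1 - \<eta>) * nrm u) = (\<integral>\<^sup>+s. ennreal ((1 - \<eta>) * nrm u) \<partial>m)" using m(2) by simp
  also have "\<dots> \<le> Xnorm_sq m u" unfolding Xnorm_sq_def
  proof (rule nn_integral_mono_AE)
    show "AE s in m. ennreal ((1 - \<eta>) * nrm u) \<le> seminorm_sq s u"
      using A
    proof eventually_elim
      case (elim s) then show ?case by (elim conjE, intro lw)
    qed
  qed
  finally show "ennreal ((1 - \<eta>) * nrm u) \<le> Xnorm_sq m u" .
  define K where "K = (1 + \<eta>) * nrm u + \<eta> * Q u"
  have "Xnorm_sq m u \<le> (\<integral>\<^sup>+s. ennreal K \<partial>m)" unfolding Xnorm_sq_def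
  proof (rule nn_integral_mono_AE)
    show "AE s in m. seminorm_sq s u \<le> ennreal K"
      using A
    proof eventually_elim
      case (elim s) then show ?case unfolding K_def by (elim conjE, intro upb)
    qed
  qed
  also have "\<dots> = ennreal K" using m(2) by simp
  finally show "Xnorm_sq m u \<le> ennreal ((1 + \<eta>) * nrm u + \<eta> * Q u)" unfolding K_def .
qed

lemma small_order_exists:
  assumes "\<eta> > 0"
  obtains d where "d > 0" "d \<le> s0" "\<And>s. 0 \<le> s \<Longrightarrow> s < d \<Longrightarrow> 1 - \<eta> \<le> lo s \<and> lo s \<le> 1 + \<eta> \<and> C * up s0 s \<le> \<eta>"
proof -
  have z: "(0::real) \<in> {0..1}" by simp
  obtain d1 where d1: "d1 > 0" "\<And>s. s \<in> {0..1} \<Longrightarrow> dist s 0 < d1 \<Longrightarrow> dist (lo s) (lo 0) < \<eta>"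
    using lo_continuous[unfolded continuous_on_iff, rule_format, OF z assms] by blast
  have "\<eta> / C > 0" using assms C by simp
  then obtain d2 where d2: "d2 > 0" "\<And>s. s \<in> {0..1} \<Longrightarrow> dist s 0 < d2 \<Longrightarrow> dist (up s0 s) (up s0 0) < \<eta> / C"
    using up_continuous[OF s0, unfolded continuous_on_iff, rule_format, OF z] by blast
  show thesis
  proof (rule that[of "min s0 (min d1 d2)"])
    fix s assume s: "0 \<le> s" "s < min s0 (min d1 d2)"
    then have "s \<in> {0..1}" "dist s 0 < d1" "dist s 0 < d2" using s0 by auto
    then have "dist (lo s) 1 < \<eta>" "dist (up s0 s) 0 < \<eta> / C" using d1(2)[of s] d2(2)[of s] by (auto simp: lo_0 up_0)
    then have "\<bar>lo s - 1\<bar> < \<eta>" "up s0 s < \<eta> / C" by (auto simp: dist_real_def)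
    moreover from this(2) have "C * up s0 s < \<eta>" using C by (simp add: field_simps)
    ultimately show "1 - \<eta> \<le> lo s \<and> lo s \<le> 1 + \<eta> \<and> C * up s0 s \<le> \<eta>" by linarith
  qed (use s0 d1 d2 in auto)
qed

text \<open>Compactness gives an \<open>L\<^sup>2\<close> Cauchy subsequence; as half the sum of two almost-minimisers is
  again an almost-minimiser, the parallelogram law upgrades this to the energy norm.\<close>

lemma minimizing_sequence_converges:
  fixes w :: "nat \<Rightarrow> 'a \<Rightarrow> real"
  assumes w: "\<And>n. w n \<in> Xplus M \<Omega>" and lQ: "(\<lambda>n. Q (w n)) \<longlonglongrightarrow> lambda0 M \<Omega>" and lN: "(\<lambda>n. nrm (w n)) \<longlonglongrightarrow> 1"
  obtains r u where "strict_mono r" "u \<in> Xplus M \<Omega>" "(\<lambda>n. Q (\<lambda>x. w (r n) x - u x)) \<longlonglongrightarrow> 0" "(\<lambda>n. nrm (\<lambda>x. w (r n) x - u x)) \<longlonglongrightarrow> 0"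
proof -
  let ?l = "lambda0 M \<Omega>"
  note sw = Xplus_supp[OF w] and fw = Xplus_fin[OF w] and qw = Xplus_sqint[OF w]
  have "Bseq (\<lambda>n. Q (w n))" "Bseq (\<lambda>n. nrm (w n))" using lQ lN by (auto intro!: convergent_imp_Bseq simp: convergent_def)
  then obtain K1 K2 where K1: "\<And>n. norm (Q (w n)) \<le> K1" and K2: "\<And>n. norm (nrm (w n)) \<le> K2" unfolding Bseq_def by blast
  define K where "K = C * K1 + K2"
  have K12: "K1 \<ge> 0" "K2 \<ge> 0" using order_trans[OF norm_ge_zero K1] order_trans[OF norm_ge_zero K2] by auto
  have CK: "0 \<le> C * K1" using C K12 by simp
  have b1: "seminorm_sq s0 (w n) \<le> ennreal K" for n
  proof -
    have "C * Q (w n) \<le> C * K1" using K1[of n] C by (intro mult_left_mono) auto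
    then have "C * Q (w n) \<le> K" using K12 by (simp add: K_def)
    from order_trans[OF coerc[OF sw fw] ennreal_leI[OF this]] show ?thesis .
  qed
  have b2: "nrm_sq (w n) \<le> ennreal K" for n
    by (subst nrm_sq_eq[OF qw[of n]], rule ennreal_leI) (use K2[of n] CK in \<open>simp add: K_def\<close>)
  have "\<exists>r. strict_mono (r :: nat \<Rightarrow> nat) \<and> (\<forall>e>0. \<exists>N. \<forall>m\<ge>N. \<forall>n\<ge>N. nrm_sq (\<lambda>x. w (r m) x - w (r n) x) \<le> ennreal e)"
  proof (rule Rellich[where w = w and K = K, OF s0 sw b1 b2])
    show "0 \<le> K" using CK K12 by (simp add: K_def)
  next
    fix r :: "nat \<Rightarrow> nat"
    assume r1: "strict_mono r" and r2: "\<And>e. e > 0 \<Longrightarrow> \<exists>N. \<forall>m\<ge>N. \<forall>n\<ge>N. nrm_sq (\<lambda>x. w (r m) x - w (r n) x) \<le> ennreal e"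
    show ?thesis by (intro exI[of _ r] conjI allI impI r1 r2)
  qed
  then obtain r where r: "strict_mono (r :: nat \<Rightarrow> nat)"
    "\<And>e. e > 0 \<Longrightarrow> \<exists>N. \<forall>m\<ge>N. \<forall>n\<ge>N. nrm_sq (\<lambda>x. w (r m) x - w (r n) x) \<le> ennreal e" by blast
  define v where "v n = w (r n)" for n
  have v: "v n \<in> Xplus M \<Omega>" for n by (simp add: v_def w)
  note fv = Xplus_fin[OF v] and qv = Xplus_sqint[OF v]
  have lQv: "(\<lambda>n. Q (v n)) \<longlonglongrightarrow> ?l" and lNv: "(\<lambda>n. nrm (v n)) \<longlonglongrightarrow> 1"
    using LIMSEQ_subseq_LIMSEQ[OF lQ r(1)] LIMSEQ_subseq_LIMSEQ[OF lN r(1)] by (simp_all add: v_def o_def)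
  \<comment> \<open>\<open>Q - lambda0 * nrm\<close> is a nonnegative quadratic form on
    \<open>Xplus\<close>. Its parallelogram law with the term at the sum dropped bounds it at the
    difference, and the L2 part is then moved to the right.\<close>
  have par: "Q (\<lambda>x. v m x - v n x) \<le> 2 * (Q (v m) - ?l * nrm (v m)) + 2 * (Q (v n) - ?l * nrm (v n)) + ?l * nrm (\<lambda>x. v m x - v n x)" for m n
  proof -
    have N1: "nrm (\<lambda>x. v m x + v n x) = nrm (v m) + 2 * (\<integral>x. v m x * v n x \<partial>lborel) + nrm (v n)"
      using nrm_add_scaled[OF qv[of m] qv[of n], of 1] by simp
    have N2: "nrm (\<lambda>x. v m x - v n x) = nrm (v m) - 2 * (\<integral>x. v m x * v n x \<partial>lborel) + nrm (v n)"
      using nrm_add_scaled[OF qv[of m] qv[of n], of "-1"] by simp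
    have Q1: "Q (\<lambda>x. v m x + v n x) = Q (v m) + 2 * Xinner M (v m) (v n) + Q (v n)"
      using Q_add_scaled[OF fv[of m] fv[of n], of 1] by simp
    have Q2: "Q (\<lambda>x. v m x - v n x) = Q (v m) - 2 * Xinner M (v m) (v n) + Q (v n)" by (rule Q_diff[OF fv fv])
    have "(\<lambda>x. v m x + v n x) \<in> Xplus M \<Omega>" using Xplus_add_scaled[OF v[of m] v[of n], of 1] by simp
    from lambda0_le[OF this] have "?l * (nrm (v m) + 2 * (\<integral>x. v m x * v n x \<partial>lborel) + nrm (v n)) \<le> Q (v m) + 2 * Xinner M (v m) (v n) + Q (v n)"
      unfolding N1 Q1 .
    then show ?thesis unfolding N2 Q2 by (simp add: algebra_simps)
  qed
  have cau: "\<exists>N. \<forall>m\<ge>N. \<forall>n\<ge>N. Q (\<lambda>x. v m x - v n x) \<le> e" if e: "e > 0" for e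
  proof -
    have "(\<lambda>n. Q (v n) - ?l * nrm (v n)) \<longlonglongrightarrow> ?l - ?l * 1" by (intro tendsto_diff tendsto_mult tendsto_const lQv lNv)
    then have "(\<lambda>n. Q (v n) - ?l * nrm (v n)) \<longlonglongrightarrow> 0" by simp
    moreover have "e / 8 > 0" using e by simp
    ultimately have "\<forall>\<^sub>F n in sequentially. Q (v n) - ?l * nrm (v n) < e / 8" by (rule order_tendstoD(2))
    then obtain N1 where N1: "\<And>n. n \<ge> N1 \<Longrightarrow> Q (v n) - ?l * nrm (v n) < e / 8" by (auto simp: eventually_sequentially)
    \<comment> \<open>The divisor |l| + 1 is positive whatever the eigenvalue is, so its sign need
      not be discussed here.\<close>
    define e' where "e' = e / (2 * (\<bar>?l\<bar> + 1))"
    have e': "e' > 0" using e by (simp add: e'_def add_nonneg_pos)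
    obtain N2 where N2: "\<And>m n. m \<ge> N2 \<Longrightarrow> n \<ge> N2 \<Longrightarrow> nrm_sq (\<lambda>x. v m x - v n x) \<le> ennreal e'" using r(2)[OF e'] unfolding v_def by blast
    show ?thesis
    proof (intro exI[of _ "max N1 N2"] allI impI)
      fix m n assume mn: "max N1 N2 \<le> m" "max N1 N2 \<le> n"
      have "ennreal (nrm (\<lambda>x. v m x - v n x)) = nrm_sq (\<lambda>x. v m x - v n x)"
        by (rule nrm_sq_eq[OF sqint_diff[OF qv[of m] qv[of n]], symmetric])
      also have "\<dots> \<le> ennreal e'" by (rule N2) (use mn in auto)
      finally have "ennreal (nrm (\<lambda>x. v m x - v n x)) \<le> ennreal e'" .
      then have "nrm (\<lambda>x. v m x - v n x) \<le> e'" using e' by (subst (asm) ennreal_le_iff) auto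
      then have "(\<bar>?l\<bar> + 1) * nrm (\<lambda>x. v m x - v n x) \<le> (\<bar>?l\<bar> + 1) * e'" by (intro mult_left_mono) auto
      moreover have "(\<bar>?l\<bar> + 1) * e' = e / 2"
      proof -
        have "a * (e / (2 * a)) = e / 2" if "a \<noteq> 0" for a :: real using that by simp
        moreover have "\<bar>?l\<bar> + 1 \<noteq> 0" by linarith
        ultimately show ?thesis unfolding e'_def by blast
      qed
      moreover have "?l * nrm (\<lambda>x. v m x - v n x) \<le> (\<bar>?l\<bar> + 1) * nrm (\<lambda>x. v m x - v n x)" by (intro mult_right_mono) auto
      ultimately have z: "?l * nrm (\<lambda>x. v m x - v n x) \<le> e / 2" by linarith
      have "Q (v m) - ?l * nrm (v m) < e / 8" "Q (v n) - ?l * nrm (v n) < e / 8" 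
        using N1[of m] N1[of n] mn by (simp_all only: max.bounded_iff)
      then have "2 * (Q (v m) - ?l * nrm (v m)) + 2 * (Q (v n) - ?l * nrm (v n)) + ?l * nrm (\<lambda>x. v m x - v n x)
        \<le> 2 * (e / 8) + 2 * (e / 8) + e / 2" using z by (intro add_mono mult_left_mono) auto
      also have "\<dots> = e" by simp
      finally show "Q (\<lambda>x. v m x - v n x) \<le> e" using par[of m n] by (rule order_trans[rotated])
    qed
  qed
  have l2v: "\<And>e. e > 0 \<Longrightarrow> \<exists>N. \<forall>m\<ge>N. \<forall>n\<ge>N. nrm_sq (\<lambda>x. v m x - v n x) \<le> ennreal e" using r(2) unfolding v_def .
  obtain u where u: "u \<in> Xplus M \<Omega>" "(\<lambda>n. Q (\<lambda>x. v n x - u x)) \<longlonglongrightarrow> 0" "(\<lambda>n. nrm_sq (\<lambda>x. v n x - u x)) \<longlonglongrightarrow> 0"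
  proof (rule Xplus_complete[where w = v, OF v l2v cau])
    fix u assume "u \<in> Xplus M \<Omega>" "(\<lambda>n. Q (\<lambda>x. v n x - u x)) \<longlonglongrightarrow> 0" "(\<lambda>n. nrm_sq (\<lambda>x. v n x - u x)) \<longlonglongrightarrow> 0"
    then show thesis by (rule that)
  qed
  have "(\<lambda>n. nrm (\<lambda>x. v n x - u x)) \<longlonglongrightarrow> 0"
    using tendsto_enn2real[of "\<lambda>n. nrm_sq (\<lambda>x. v n x - u x)" 0 sequentially] u(3) by simp
  then show thesis using u(1,2) unfolding v_def by (intro that[OF r(1)])
qed

lemma minimizer_eigenfunction:
  assumes u: "u \<in> Xplus M \<Omega>" "Q u = lambda0 M \<Omega>" "nrm u = 1"
  shows "is_eigenfunction0 M \<Omega> (lambda0 M \<Omega>) u"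
  unfolding is_eigenfunction0_def
proof (intro conjI ballI)
  let ?l = "lambda0 M \<Omega>"
  show "u \<in> Xplus M \<Omega>" by (rule u(1))
  show "nonzero_fun u"
  proof (rule ccontr)
    assume "\<not> nonzero_fun u"
    then have ae: "AE x in lborel. u x = 0" by (simp add: nonzero_fun_def)
    have "nrm_sq u = (\<integral>\<^sup>+x. 0 \<partial>(lborel :: 'a measure))" unfolding nrm_sq_def by (rule nn_integral_cong_AE) (use ae in \<open>eventually_elim, simp\<close>)
    then show False using u(3) by simp
  qed
  fix v assume v: "v \<in> Cc_inf \<Omega>"
  note vX = Cc_inf_Xplus[OF v]
  \<comment> \<open>At a minimiser the polynomial of \<open>Q - lambda0 * nrm\<close> along
    \<open>u + t * v\<close> is nonnegative with constant term 0, so its linear coefficient must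
    vanish.\<close>
  have "(Xinner M u v - ?l * (\<integral>x. u x * v x \<partial>lborel))\<^sup>2 \<le> 0 * (Q v - ?l * nrm v)"
  proof (rule quadratic_discriminant)
    fix t
    have "?l * nrm (\<lambda>x. u x + t * v x) \<le> Q (\<lambda>x. u x + t * v x)" by (rule lambda0_le[OF Xplus_add_scaled[OF u(1) vX]])
    then show "0 \<le> 0 + 2 * t * (Xinner M u v - ?l * (\<integral>x. u x * v x \<partial>lborel)) + t\<^sup>2 * (Q v - ?l * nrm v)"
      unfolding Q_add_scaled[OF Xplus_fin[OF u(1)] Xplus_fin[OF vX]] nrm_add_scaled[OF Xplus_sqint[OF u(1)] Xplus_sqint[OF vX]] u(2,3)
      by (simp add: algebra_simps)
  qed
  then have "Xinner M u v = ?l * (\<integral>x. u x * v x \<partial>lborel)" by simp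
  moreover have "(LINT x:\<Omega>|lborel. u x * v x) = (\<integral>x. u x * v x \<partial>lborel)"
  proof -
    obtain K where K: "K \<subseteq> \<Omega>" "\<And>x. x \<notin> K \<Longrightarrow> v x = 0" by (rule Cc_inf_support[OF v]) blast
    have "(\<lambda>x. indicator \<Omega> x *\<^sub>R (u x * v x)) = (\<lambda>x. u x * v x)"
    proof
      fix x show "indicator \<Omega> x *\<^sub>R (u x * v x) = u x * v x" using K by (cases "x \<in> \<Omega>") auto
    qed
    then show ?thesis by (simp only: set_lebesgue_integral_def)
  qed
  ultimately show "Xinner M u v = ?l * (LINT x:\<Omega>|lborel. u x * v x)" by simp
qed

end

section \<open>The limit of small orders\<close>

text \<open>The threshold in \<open>n\<close> may depend on the tolerance index \<open>k\<close>:
  for each tolerance the comparison of forms holds only for sufficiently small orders.\<close>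

lemma LIMSEQ_squeeze_family:
  fixes x :: "nat \<Rightarrow> real"
  assumes "L \<longlonglongrightarrow> l" "U \<longlonglongrightarrow> l" and b: "\<And>k::nat. \<forall>\<^sub>F n in sequentially. L k \<le> x n \<and> x n \<le> U k"
  shows "x \<longlonglongrightarrow> l"
proof (rule order_tendstoI)
  fix a assume "a < l"
  then have "\<forall>\<^sub>F k in sequentially. a < L k" by (rule order_tendstoD(1)[OF assms(1)])
  then obtain k where "a < L k" using eventually_happens'[OF sequentially_bot] by blast
  then show "\<forall>\<^sub>F n in sequentially. a < x n" by (intro eventually_mono[OF b[of k]]) simp
next
  fix a assume "l < a"
  then have "\<forall>\<^sub>F k in sequentially. U k < a" by (rule order_tendstoD(2)[OF assms(2)])
  then obtain k where "U k < a" using eventually_happens'[OF sequentially_bot] by blast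
  then show "\<forall>\<^sub>F n in sequentially. x n < a" by (intro eventually_mono[OF b[of k]]) simp
qed

lemma Xnorm_sq_restricted:
  assumes "AE s in m. s \<in> A"
  shows "(\<integral>\<^sup>+ s\<in>A. seminorm_sq s u \<partial>m) = Xnorm_sq m u"
  unfolding Xnorm_sq_def
proof (rule nn_integral_cong_AE)
  show "AE s in m. seminorm_sq s u * indicator A s = seminorm_sq s u"
    using assms by eventually_elim simp
qed

theorem theorem1p2:
  fixes \<Omega> :: "'a::euclidean_space set"
    and \<mu>p :: "real measure" and \<mu>m :: "nat \<Rightarrow> real measure"
    and \<epsilon> :: "nat \<Rightarrow> real" and sbar :: real
    and u :: "nat \<Rightarrow> 'a \<Rightarrow> real"
  assumes "open \<Omega>" and "bounded \<Omega>" and "C1_boundary \<Omega>"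
    and "sets \<mu>p = sets (restrict_space borel {0..1})" and "finite_measure \<mu>p"
    and "0 < sbar" and "sbar \<le> 1" and "emeasure \<mu>p {sbar..1} > 0"
    and "decseq \<epsilon>" and "\<epsilon> \<longlonglongrightarrow> 0"
    and "\<And>n. sets (\<mu>m n) = sets (restrict_space borel {0..1})"
    and "\<And>n. finite_measure (\<mu>m n)"
    and "\<And>n. emeasure (\<mu>m n) ({0..1} - {0..\<epsilon> n}) = 0"
    and "\<And>n. emeasure (\<mu>m n) ({0..\<epsilon> n} \<inter> {0..1}) = 1"
    and "\<And>n. is_eigenfunction_eps \<mu>p (\<mu>m n) (\<epsilon> n) \<Omega> (lambda_eps \<mu>p (\<mu>m n) (\<epsilon> n) \<Omega>) (u n)"
    and "\<And>n. (\<integral>\<^sup>+ s\<in>{0..\<epsilon> n}. seminorm_sq s (u n) \<partial>\<mu>m n) = 1"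
  shows "(\<lambda>n. lambda_eps \<mu>p (\<mu>m n) (\<epsilon> n) \<Omega>) \<longlonglongrightarrow> lambda0 \<mu>p \<Omega>
    \<and> (\<exists>u0 r. is_eigenfunction0 \<mu>p \<Omega> (lambda0 \<mu>p \<Omega>) u0 \<and> strict_mono r
        \<and> Xweak_conv \<mu>p \<Omega> (\<lambda>k. u (r k)) u0
        \<and> (\<lambda>k. LINT x:\<Omega>|lborel. (u (r k) x - u0 x)\<^sup>2) \<longlonglongrightarrow> 0)"
proof -
  obtain B where B: "\<And>x. x \<in> \<Omega> \<Longrightarrow> norm x \<le> B" using \<open>bounded \<Omega>\<close> by (auto simp: bounded_iff)
  \<comment> \<open>Twice the radius of a ball containing the domain, plus 1 to make the bound on
    distances strict.\<close>
  define R where "R = 2 * \<bar>B\<bar> + 1"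
  have diam\<Omega>: "norm (x - y) < R" if "x \<in> \<Omega>" "y \<in> \<Omega>" for x y
    using B[OF that(1)] B[OF that(2)] norm_triangle_ineq4[of x y] unfolding R_def by linarith
  have "1 \<le> R" by (simp add: R_def)
  then interpret dm: domain_measure \<Omega> R \<mu>p
    by (intro domain_measure.intro domain.intro frac_measure.intro diam\<Omega> assms(4,5))
  obtain s0 C where sC: "0 < s0" "s0 < 1" "C > 0"
    "\<And>u. dm.supp u \<Longrightarrow> dm.fin u \<Longrightarrow> seminorm_sq s0 u \<le> ennreal (C * enn2real (Xnorm_sq \<mu>p u))"
    by (rule dm.coercive[OF assms(6-8)]) blast
  interpret p: coercive_form \<Omega> R \<mu>p s0 C
    by (rule coercive_form.intro[OF dm.domain_measure_axioms coercive_form_axioms.intro[OF sC]])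
  interpret m: frac_measure "\<mu>m n" for n
    by (rule frac_measure.intro[OF assms(11,12)])
  let ?l = "lambda0 \<mu>p \<Omega>" and ?Q = "\<lambda>v. enn2real (Xnorm_sq \<mu>p v)" and ?D = "\<lambda>n v. enn2real (Xnorm_sq (\<mu>m n) v)"
  define lam where "lam n = lambda_eps \<mu>p (\<mu>m n) (\<epsilon> n) \<Omega>" for n
  have cell: "{0..\<epsilon> n} \<inter> {0..1} \<in> sets (\<mu>m n)" "{0..1} - {0..\<epsilon> n} \<in> sets (\<mu>m n)" for n
    by (auto intro!: m.sets_M_I)
  have AEe: "AE s in \<mu>m n. s \<in> {0..\<epsilon> n}" for n
    by (rule AE_I[OF _ assms(13)[of n] cell(2)]) (auto simp: m.spaceM)
  have tot: "emeasure (\<mu>m n) (space (\<mu>m n)) = 1" for n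
  proof -
    have "space (\<mu>m n) = ({0..\<epsilon> n} \<inter> {0..1}) \<union> ({0..1} - {0..\<epsilon> n})" by (auto simp: m.spaceM)
    also have "emeasure (\<mu>m n) \<dots> = emeasure (\<mu>m n) ({0..\<epsilon> n} \<inter> {0..1}) + emeasure (\<mu>m n) ({0..1} - {0..\<epsilon> n})"
      by (rule plus_emeasure[symmetric]) (use cell in auto)
    finally show ?thesis using assms(13,14)[of n] by simp
  qed
  have eig: "u n \<in> Xplus \<mu>p \<Omega>" "nonzero_fun (u n)" for n using assms(15)[of n] by (auto simp: is_eigenfunction_eps_def)
  have adm: "p.admissible (u n)" for n using eig by (simp add: p.admissible_def)
  note l_pos = p.lambda0_pos[OF adm[of 0]]
  have D1: "Xnorm_sq (\<mu>m n) (u n) = 1" for n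
    using assms(16)[of n] unfolding Xnorm_sq_restricted[OF AEe] .
  have lam_eq: "lam n = Inf {?Q v / ?D n v | v. p.admissible v}" for n
    unfolding lam_def lambda_eps_def Xnorm_sq_restricted[OF AEe] p.admissible_def by simp
  \<comment> \<open>The indicator equals 1 almost everywhere for \<open>\<mu>m n\<close>; exchanging
    the integrands also requires the form to be measurable in the order.\<close>
  have weak: "Xinner \<mu>p (u n) v = lam n * Xinner (\<mu>m n) (u n) v" if v: "v \<in> Cc_inf \<Omega>" for n v
  proof -
    have mf: "(\<lambda>s. form s (u n) v) \<in> borel_measurable (\<mu>m n)"
      using dm.Xplus_fin[OF eig(1)[of n]] Cc_inf_measurable[OF v] by (intro m.form_measurable_M) (auto simp: dm.fin_def)
    have mi: "indicat_real {0..\<epsilon> n} \<in> borel_measurable (\<mu>m n)"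
    proof -
      have "indicat_real {0..\<epsilon> n} \<in> borel_measurable (restrict_space borel {0..1})" by (rule measurable_restrict_space1) measurable
      then show ?thesis using measurable_cong_sets[OF m.setsM refl] by blast
    qed
    have "(\<integral>s. indicator {0..\<epsilon> n} s * form s (u n) v \<partial>\<mu>m n) = Xinner (\<mu>m n) (u n) v"
      unfolding Xinner_def
    proof (rule integral_cong_AE)
      show "(\<lambda>s. indicator {0..\<epsilon> n} s * form s (u n) v) \<in> borel_measurable (\<mu>m n)"
        by (rule borel_measurable_times[OF mi mf])
      show "AE s in \<mu>m n. indicator {0..\<epsilon> n} s * form s (u n) v = form s (u n) v"
        using AEe[of n] by eventually_elim simp
    qed (rule mf)
    then show ?thesis using assms(15)[of n] v unfolding is_eigenfunction_eps_def lam_def by auto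
  qed
  \<comment> \<open>The comparison of the denominators, uniform over \<open>Xplus\<close>, valid
    once \<open>\<epsilon> n\<close> is below the order threshold of the tolerance. It also shows
    that the small-order energy is finite on \<open>Xplus\<close>.\<close>
  have two_sided: "\<forall>\<^sub>F n in sequentially. \<forall>v\<in>Xplus \<mu>p \<Omega>. m.fin n v \<and> (1 - \<eta>) * nrm v \<le> ?D n v \<and> ?D n v \<le> (1 + \<eta>) * nrm v + \<eta> * ?Q v"
    if \<eta>: "0 < \<eta>" "\<eta> < 1" for \<eta>
  proof -
    obtain d where d: "d > 0" "d \<le> s0" "\<And>s. 0 \<le> s \<Longrightarrow> s < d \<Longrightarrow> 1 - \<eta> \<le> dm.lo s \<and> dm.lo s \<le> 1 + \<eta> \<and> C * dm.up s0 s \<le> \<eta>"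
      by (rule p.small_order_exists[OF \<eta>(1)]) blast
    have "\<forall>\<^sub>F n in sequentially. \<epsilon> n < d" by (rule order_tendstoD(2)[OF assms(10) d(1)])
    then show ?thesis
    proof eventually_elim
      case (elim n)
      show ?case
      proof
        fix v assume v: "v \<in> Xplus \<mu>p \<Omega>"
        note fv = dm.Xplus_fin[OF v]
        have A: "AE s in \<mu>m n. s \<le> \<epsilon> n" using AEe[of n] by eventually_elim simp
        have b: "1 - \<eta> \<le> dm.lo s \<and> dm.lo s \<le> 1 + \<eta> \<and> C * dm.up s0 s \<le> \<eta>" if "0 \<le> s" "s \<le> \<epsilon> n" for s
          by (rule d(3)) (use that elim in auto)
        have le: "\<epsilon> n \<le> s0" using elim d(2) by linarith
        have \<eta>': "0 \<le> \<eta>" "\<eta> \<le> 1" using \<eta> by auto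
        note X = p.Xnorm_small_order[OF m.frac_measure_axioms tot A le \<eta>' b dm.Xplus_supp[OF v] fv]
        have fin: "m.fin n v" using X(2) fv by (auto simp: m.fin_def dm.fin_def intro: le_less_trans)
        define K where "K = (1 + \<eta>) * nrm v + \<eta> * ?Q v"
        define L where "L = (1 - \<eta>) * nrm v"
        have KL: "K \<ge> 0" using \<eta> by (simp add: K_def)
        have "ennreal L \<le> ennreal (?D n v)" "ennreal (?D n v) \<le> ennreal K"
          using X m.fin_Xnorm[OF fin] by (simp_all add: K_def L_def)
        then have "L \<le> ?D n v" "?D n v \<le> K"
          by (simp_all only: ennreal_le_iff[OF enn2real_nonneg] ennreal_le_iff[OF KL])
        then show "m.fin n v \<and> (1 - \<eta>) * nrm v \<le> ?D n v \<and> ?D n v \<le> (1 + \<eta>) * nrm v + \<eta> * ?Q v"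
          using fin by (simp add: K_def L_def)
      qed
    qed
  qed
  \<comment> \<open>The tolerances 1/(k+2) stay strictly below 1, so \<open>1 - h k\<close> never
    vanishes.\<close>
  define h where "h k = 1 / real (Suc (Suc k))" for k
  have h: "0 < h k" "h k < 1" for k by (auto simp: h_def)
  have h0: "h \<longlonglongrightarrow> 0" unfolding h_def
    using LIMSEQ_Suc[OF LIMSEQ_inverse_real_of_nat] by (simp add: inverse_eq_divide)
  have lim_lam: "lam \<longlonglongrightarrow> ?l"
  proof (rule LIMSEQ_squeeze_family)
    have "(\<lambda>k. 1 / ((1 + h k) / ?l + h k)) \<longlonglongrightarrow> 1 / ((1 + 0) / ?l + 0)"
      using l_pos by (intro tendsto_divide tendsto_add tendsto_const h0) auto
    then show "(\<lambda>k. 1 / ((1 + h k) / ?l + h k)) \<longlonglongrightarrow> ?l" by simp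
    have "(\<lambda>k. ?l / (1 - h k)) \<longlonglongrightarrow> ?l / (1 - 0)" by (intro tendsto_divide tendsto_diff tendsto_const h0) auto
    then show "(\<lambda>k. ?l / (1 - h k)) \<longlonglongrightarrow> ?l" by simp
    fix k
    show "\<forall>\<^sub>F n in sequentially. 1 / ((1 + h k) / ?l + h k) \<le> lam n \<and> lam n \<le> ?l / (1 - h k)"
      using two_sided[OF h[of k]]
    proof eventually_elim
      case (elim n)
      have D: "v \<in> Xplus \<mu>p \<Omega> \<Longrightarrow> (1 - h k) * nrm v \<le> ?D n v \<and> ?D n v \<le> (1 + h k) * nrm v + h k * ?Q v" for v
        using elim by blast
      show ?case unfolding lam_eq
        using p.lambda_eps_bounds[where D = "?D n", OF adm[of 0] h[of k] D enn2real_nonneg] by blast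
    qed
  qed
  \<comment> \<open>The equation is given for test functions only. Energy approximants of
    \<open>u n\<close> also converge in the small-order form, because that form is bounded by a
    multiple of the energy, so the equation extends to \<open>u n\<close> as its own test function.
    The bound is available for large \<open>n\<close>, hence the word eventually.\<close>
  have ev_Q: "\<forall>\<^sub>F n in sequentially. ?Q (u n) = lam n"
    using two_sided[OF h[of 0]]
  proof eventually_elim
    case (elim n)
    note fu = dm.Xplus_fin[OF eig(1)[of n]]
    have mfu: "m.fin n (u n)" using elim eig(1) by blast
    obtain \<phi> where \<phi>: "\<And>k. \<phi> k \<in> Cc_inf \<Omega>" "(\<lambda>k. ?Q (\<lambda>x. \<phi> k x - u n x)) \<longlonglongrightarrow> 0"
      by (rule dm.Xplus_approx[OF eig(1)[of n]]) blast
    note f\<phi> = dm.Cc_inf_fin[OF \<phi>(1)] and mf\<phi> = m.Cc_inf_fin[OF \<phi>(1)]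
    have dX: "(\<lambda>x. \<phi> k x - u n x) \<in> Xplus \<mu>p \<Omega>" for k
      using dm.Xplus_add_scaled[OF dm.Cc_inf_Xplus[OF \<phi>(1)[of k]] eig(1)[of n], of "-1"] by simp
    \<comment> \<open>The Poincare constant replaces the L2 norm in the upper bound with tolerance
      \<open>h 0\<close>.\<close>
    define c where "c = (1 + h 0) * (C / dm.lo s0) + h 0"
    have Dle: "?D n (\<lambda>x. \<phi> k x - u n x) \<le> c * ?Q (\<lambda>x. \<phi> k x - u n x)" for k
    proof -
      have "nrm (\<lambda>x. \<phi> k x - u n x) \<le> C / dm.lo s0 * ?Q (\<lambda>x. \<phi> k x - u n x)"
        by (rule p.Poincare[OF dm.Xplus_supp[OF dX] dm.Xplus_fin[OF dX]])
      then have "(1 + h 0) * nrm (\<lambda>x. \<phi> k x - u n x) \<le> (1 + h 0) * (C / dm.lo s0 * ?Q (\<lambda>x. \<phi> k x - u n x))"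
        using h[of 0] by (intro mult_left_mono) auto
      moreover have "?D n (\<lambda>x. \<phi> k x - u n x) \<le> (1 + h 0) * nrm (\<lambda>x. \<phi> k x - u n x) + h 0 * ?Q (\<lambda>x. \<phi> k x - u n x)"
        using elim dX by blast
      ultimately show ?thesis unfolding c_def by (simp add: algebra_simps)
    qed
    have D0: "(\<lambda>k. ?D n (\<lambda>x. \<phi> k x - u n x)) \<longlonglongrightarrow> 0"
    proof (rule Lim_null_comparison)
      show "\<forall>\<^sub>F k in sequentially. norm (?D n (\<lambda>x. \<phi> k x - u n x)) \<le> c * ?Q (\<lambda>x. \<phi> k x - u n x)"
        using Dle by (intro always_eventually allI) simp
      show "(\<lambda>k. c * ?Q (\<lambda>x. \<phi> k x - u n x)) \<longlonglongrightarrow> 0" by (rule tendsto_mult_right_zero[OF \<phi>(2)])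
    qed
    have 1: "(\<lambda>k. Xinner \<mu>p (\<phi> k) (u n)) \<longlonglongrightarrow> Xinner \<mu>p (u n) (u n)" by (rule dm.Xinner_tendsto[OF f\<phi> fu fu \<phi>(2)])
    have "(\<lambda>k. Xinner (\<mu>m n) (\<phi> k) (u n)) \<longlonglongrightarrow> Xinner (\<mu>m n) (u n) (u n)" by (rule m.Xinner_tendsto[OF mf\<phi> mfu mfu D0])
    then have 2: "(\<lambda>k. lam n * Xinner (\<mu>m n) (\<phi> k) (u n)) \<longlonglongrightarrow> lam n * Xinner (\<mu>m n) (u n) (u n)" by (intro tendsto_mult tendsto_const)
    have "Xinner \<mu>p (\<phi> k) (u n) = lam n * Xinner (\<mu>m n) (\<phi> k) (u n)" for k
      using weak[OF \<phi>(1)] by (simp add: dm.Xinner_commute[of "\<phi> k"] m.Xinner_commute[of n "\<phi> k"])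
    then have "Xinner \<mu>p (u n) (u n) = lam n * Xinner (\<mu>m n) (u n) (u n)" using 1 2 by (simp add: LIMSEQ_unique)
    then show ?case unfolding dm.Xinner_self[OF fu] m.Xinner_self[OF mfu] D1 by simp
  qed
  have lim_Q: "(\<lambda>n. ?Q (u n)) \<longlonglongrightarrow> ?l"
    by (rule Lim_transform_eventually[OF lim_lam]) (use ev_Q in eventually_elim, simp)
  have lim_N: "(\<lambda>n. nrm (u n)) \<longlonglongrightarrow> 1"
  proof (rule LIMSEQ_squeeze_family)
    \<comment> \<open>These bounds solve the two-sided estimate for the L2 norm, given that the
      small-order energy of \<open>u n\<close> is 1 and its energy is eventually below l +
      1.\<close>
    have "(\<lambda>k. (1 - h k * (?l + 1)) / (1 + h k)) \<longlonglongrightarrow> (1 - 0 * (?l + 1)) / (1 + 0)"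
      by (intro tendsto_divide tendsto_diff tendsto_add tendsto_mult tendsto_const h0) auto
    then show "(\<lambda>k. (1 - h k * (?l + 1)) / (1 + h k)) \<longlonglongrightarrow> 1" by simp
    have "(\<lambda>k. 1 / (1 - h k)) \<longlonglongrightarrow> 1 / (1 - 0)" by (intro tendsto_divide tendsto_diff tendsto_const h0) auto
    then show "(\<lambda>k. 1 / (1 - h k)) \<longlonglongrightarrow> 1" by simp
    fix k
    have "\<forall>\<^sub>F n in sequentially. ?Q (u n) < ?l + 1" by (rule order_tendstoD(2)[OF lim_Q]) simp
    with two_sided[OF h[of k]]
    show "\<forall>\<^sub>F n in sequentially. (1 - h k * (?l + 1)) / (1 + h k) \<le> nrm (u n) \<and> nrm (u n) \<le> 1 / (1 - h k)"
    proof eventually_elim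
      case (elim n)
      have b: "(1 - h k) * nrm (u n) \<le> 1" "1 \<le> (1 + h k) * nrm (u n) + h k * ?Q (u n)"
        using elim(1) eig(1)[of n] D1[of n] by auto
      have "h k * ?Q (u n) \<le> h k * (?l + 1)" using elim(2) h[of k] by (intro mult_left_mono) auto
      then have "1 - h k * (?l + 1) \<le> (1 + h k) * nrm (u n)" using b(2) by linarith
      then show ?case using b(1) h[of k] by (simp add: pos_divide_le_eq pos_le_divide_eq mult.commute)
    qed
  qed
  obtain r u0 where r: "strict_mono r" and u0: "u0 \<in> Xplus \<mu>p \<Omega>"
    and Qr: "(\<lambda>n. ?Q (\<lambda>x. u (r n) x - u0 x)) \<longlonglongrightarrow> 0" and Nr: "(\<lambda>n. nrm (\<lambda>x. u (r n) x - u0 x)) \<longlonglongrightarrow> 0"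
    by (rule p.minimizing_sequence_converges[where w = u, OF eig(1) lim_Q lim_N]) blast
  note fu0 = dm.Xplus_fin[OF u0] and fu = dm.Xplus_fin[OF eig(1)]
  have "?Q u0 = ?l"
    by (rule LIMSEQ_unique[OF dm.Q_tendsto[OF fu fu0 Qr]]) (use LIMSEQ_subseq_LIMSEQ[OF lim_Q r] in \<open>simp add: o_def\<close>)
  moreover have "nrm u0 = 1"
  proof -
    note su0 = dm.Xplus_sqint[OF u0] and su = dm.Xplus_sqint[OF eig(1)]
    have "(\<lambda>n. \<integral>\<^sup>+x. ennreal ((u (r n) x - u0 x)\<^sup>2) \<partial>lborel) \<longlonglongrightarrow> 0"
      using tendsto_ennrealI[OF Nr] nrm_sq_eq[OF sqint_diff[OF su su0]] by (simp add: nrm_sq_def)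
    then have "(\<lambda>n. \<integral>x. u (r n) x * u0 x \<partial>lborel) \<longlonglongrightarrow> (\<integral>x. u0 x * u0 x \<partial>lborel)"
      by (rule sqint_inner_tendsto[OF su su0 su0])
    then have "(\<lambda>n. \<integral>x. u (r n) x * u0 x \<partial>lborel) \<longlonglongrightarrow> nrm u0"
      using nrm_eq[OF su0] by (simp add: power2_eq_square)
    moreover have "(\<lambda>n. nrm (u (r n))) \<longlonglongrightarrow> 1" using LIMSEQ_subseq_LIMSEQ[OF lim_N r] by (simp add: o_def)
    moreover have "nrm (\<lambda>x. u (r n) x - u0 x) = nrm (u (r n)) - 2 * (\<integral>x. u (r n) x * u0 x \<partial>lborel) + nrm u0" for n
      using nrm_add_scaled[OF su[of "r n"] su0, of "-1"] by simp
    \<comment> \<open>The cross term tends to \<open>nrm u0\<close>, so the squared distances tend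
      to 1 - \<open>nrm u0\<close>, while they are known to tend to 0.\<close>
    ultimately have "(\<lambda>n. nrm (\<lambda>x. u (r n) x - u0 x)) \<longlonglongrightarrow> 1 - 2 * nrm u0 + nrm u0"
      by (simp only:) (intro tendsto_add tendsto_diff tendsto_mult tendsto_const; assumption)
    from LIMSEQ_unique[OF this Nr] show ?thesis by simp
  qed
  ultimately have "is_eigenfunction0 \<mu>p \<Omega> ?l u0" by (rule p.minimizer_eigenfunction[OF u0])
  \<comment> \<open>Convergence is strong in the energy, and Cauchy-Schwarz continuity of the inner
    product gives the weak statement.\<close>
  moreover have "Xweak_conv \<mu>p \<Omega> (\<lambda>k. u (r k)) u0"
    unfolding Xweak_conv_def
  proof
    fix v assume "v \<in> Xplus \<mu>p \<Omega>"
    then have fv: "dm.fin v" by (rule dm.Xplus_fin)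
    show "(\<lambda>k. Xinner \<mu>p (u (r k)) v) \<longlonglongrightarrow> Xinner \<mu>p u0 v"
      by (rule dm.Xinner_tendsto[OF fu fu0 fv Qr])
  qed
  moreover have "(\<lambda>k. LINT x:\<Omega>|lborel. (u (r k) x - u0 x)\<^sup>2) \<longlonglongrightarrow> 0"
  proof -
    have "(LINT x:\<Omega>|lborel. (u (r k) x - u0 x)\<^sup>2) = nrm (\<lambda>x. u (r k) x - u0 x)" for k
    proof -
      note su0 = dm.Xplus_sqint[OF u0] and su = dm.Xplus_sqint[OF eig(1)[of "r k"]]
      have [measurable]: "u (r k) \<in> borel_measurable borel" "u0 \<in> borel_measurable borel" using su su0 by (auto simp: sqint_def)
      have [measurable]: "\<Omega> \<in> sets borel" using \<open>open \<Omega>\<close> by simp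
      have "AE x in lborel. x \<notin> \<Omega> \<longrightarrow> u (r k) x = 0" "AE x in lborel. x \<notin> \<Omega> \<longrightarrow> u0 x = 0"
        using eig(1)[of "r k"] u0 by (auto simp: Xplus_def)
      then have "AE x in lborel. indicator \<Omega> x *\<^sub>R (u (r k) x - u0 x)\<^sup>2 = (u (r k) x - u0 x)\<^sup>2"
        by eventually_elim (auto simp: indicator_def)
      then show ?thesis unfolding set_lebesgue_integral_def nrm_eq[OF sqint_diff[OF su su0]]
        by (intro integral_cong_AE) measurable
    qed
    then show ?thesis using Nr by simp
  qed
  ultimately show ?thesis using lim_lam r unfolding lam_def by blast
qed

end
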